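(* Let $n$ and $r$ be integers with $0\le r\le n-2$. Then $G_n^r$ is the unique graph (up to isomorphism) with maximum $SLEE$ among all graphs on $n$ vertices with exactly $r$ cut vertices.
   Context: All graphs are finite and simple. For a graph $G$ on $n$ vertices with degree matrix $D$ and adjacency matrix $A$, the signless Laplacian is $Q=D+A$ with eigenvalues $q_1,\ldots,q_n$, and $SLEE(G)=\sum_{i=1}^n e^{q_i}$. A cut vertex is a vertex whose removal increases the number of connected components. The graph $G_n^r$ is obtained from the complete graph $K_{n-r}$ with vertices $u_1,\ldots,u_{n-r}$ by attaching to each $u_i$ a pendent path consisting of $n_i\ge0$ new vertices (a path $u_iw_1\ldots w_{n_i}$ whose new vertices have no other neighbors), where $n_1+\cdots+n_{n-r}=r$ and $|n_i-n_j|\le1$ for all $i,j$; i.e. each $n_i$ equals $\lfloor r/(n-r)\rfloor$ or $\lfloor r/(n-r)\rfloor+1$. *)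

theory Defs
  imports
    "Graph_Theory.Digraph_Isomorphism"
    "Jordan_Normal_Form.Char_Poly"
    Complex_Main
begin

text \<open>
  A finite simple graph is a \<^locale>\<open>pair_graph\<close>: a finite, loop-free, symmetric digraph whose arcs
  are pairs of vertices, so that every undirected edge is represented by its two orientations.
\<close>

section \<open>Cut vertices\<close>

text \<open>
  The strongly connected components of a symmetric digraph are the connected components of the
  undirected graph it represents.
\<close>

definition num_components :: "('a, 'b) pre_digraph \<Rightarrow> nat" where
  "num_components G = card (pre_digraph.sccs G)"

definition cut_vertex :: "'a pair_pre_digraph \<Rightarrow> 'a \<Rightarrow> bool" where
  "cut_vertex G v \<longleftrightarrow> v \<in> pverts G \<and>
     num_components (with_proj G) < num_components (pre_digraph.del_vert (with_proj G) v)"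

definition graphs_with_cut_vertices :: "nat \<Rightarrow> nat \<Rightarrow> 'a pair_pre_digraph set" where
  "graphs_with_cut_vertices n r =
     {G. pair_graph G \<and> card (pverts G) = n \<and> card {v. cut_vertex G v} = r}"


section \<open>The signless Laplacian Estrada index\<close>

text \<open>
  Rows and columns are indexed by positions in a list \<open>vs\<close> that enumerates the vertices. In a
  symmetric digraph the out-degree of a vertex is its number of neighbours.
\<close>

definition degree_mat :: "'a list \<Rightarrow> 'a pair_pre_digraph \<Rightarrow> real mat" where
  "degree_mat vs G = mat (length vs) (length vs)
     (\<lambda>(i, j). if i = j then real (out_degree (with_proj G) (vs ! i)) else 0)"

definition adjacency_mat :: "'a list \<Rightarrow> 'a pair_pre_digraph \<Rightarrow> real mat" where
  "adjacency_mat vs G = mat (length vs) (length vs)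
     (\<lambda>(i, j). if (vs ! i, vs ! j) \<in> parcs G then 1 else 0)"

definition signless_laplacian :: "'a list \<Rightarrow> 'a pair_pre_digraph \<Rightarrow> real mat" where
  "signless_laplacian vs G = degree_mat vs G + adjacency_mat vs G"

text \<open>
  The eigenvalues are counted with multiplicity, as roots of the characteristic polynomial. That
  polynomial splits over the reals because the matrix is symmetric. The choice of the enumeration
  is irrelevant, see \<open>slee_eq\<close> below.
\<close>

definition slee :: "'a pair_pre_digraph \<Rightarrow> real" where
  "slee G = (\<Sum>q\<in>#proots (char_poly (signless_laplacian
     (SOME vs. distinct vs \<and> set vs = pverts G) G)). exp q)"

lemma signless_laplacian_carrier [simp]:
  "signless_laplacian vs G \<in> carrier_mat (length vs) (length vs)"
  by (simp add: signless_laplacian_def degree_mat_def adjacency_mat_def)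

lemma signless_laplacian_permute:
  assumes vs: "distinct vs" and ws: "distinct ws" and eq: "set vs = set ws"
  shows "similar_mat (signless_laplacian vs G) (signless_laplacian ws G)"
proof -
  define n where "n = length vs"
  have lw: "length ws = n"
    using distinct_card[OF vs] distinct_card[OF ws] eq by (simp add: n_def)
  define P :: "real mat" where "P = mat n n (\<lambda>(i, j). if vs ! i = ws ! j then 1 else 0)"
  define Q :: "real mat" where "Q = mat n n (\<lambda>(i, j). if ws ! i = vs ! j then 1 else 0)"
  have "\<exists>k<n. ws ! k = vs ! i" if "i < n" for i
    using that eq lw unfolding n_def by (metis in_set_conv_nth)
  then obtain f where f: "\<And>i. i < n \<Longrightarrow> f i < n \<and> ws ! f i = vs ! i"
    by metis
  have "\<exists>k<n. vs ! k = ws ! i" if "i < n" for i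
    using that eq lw unfolding n_def by (metis in_set_conv_nth)
  then obtain g where g: "\<And>i. i < n \<Longrightarrow> g i < n \<and> vs ! g i = ws ! i"
    by metis
  have fP: "vs ! i = ws ! j \<longleftrightarrow> j = f i" if "i < n" "j < n" for i j
    using f[OF that(1)] nth_eq_iff_index_eq[OF ws, of "f i" j] that lw by auto
  have gP: "ws ! i = vs ! j \<longleftrightarrow> j = g i" if "i < n" "j < n" for i j
    using g[OF that(1)] nth_eq_iff_index_eq[OF vs, of "g i" j] that n_def by auto
  have fg: "f (g i) = i" "g (f i) = i" if "i < n" for i
    using f[OF that] g[OF that] fP[of "g i" i] gP[of "f i" i] that by auto
  have fi: "f i < n" and gi: "g i < n" if "i < n" for i
    using f g that by auto
  have P: "P \<in> carrier_mat n n" and Q: "Q \<in> carrier_mat n n"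
    by (auto simp: P_def Q_def)
  have P_mult: "P * M = mat n n (\<lambda>(i, j). M $$ (f i, j))" if "M \<in> carrier_mat n n" for M
  proof (rule eq_matI)
    fix i j assume "i < dim_row (mat n n (\<lambda>(i, j). M $$ (f i, j)))"
      "j < dim_col (mat n n (\<lambda>(i, j). M $$ (f i, j)))"
    then have ij: "i < n" "j < n" by auto
    have "(P * M) $$ (i, j) = (\<Sum>k<n. (if k = f i then 1 else 0) * M $$ (k, j))"
      using ij that fP by (auto simp: P_def scalar_prod_def lessThan_atLeast0 intro!: sum.cong)
    also have "\<dots> = (\<Sum>k<n. if k = f i then M $$ (k, j) else 0)"
      by (rule sum.cong) auto
    also have "\<dots> = M $$ (f i, j)" using fi ij by simp
    finally show "(P * M) $$ (i, j) = mat n n (\<lambda>(i, j). M $$ (f i, j)) $$ (i, j)"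
      using ij by simp
  qed (use that P in auto)
  have mult_Q: "M * Q = mat n n (\<lambda>(i, j). M $$ (i, f j))" if "M \<in> carrier_mat n n" for M
  proof (rule eq_matI)
    fix i j assume "i < dim_row (mat n n (\<lambda>(i, j). M $$ (i, f j)))"
      "j < dim_col (mat n n (\<lambda>(i, j). M $$ (i, f j)))"
    then have ij: "i < n" "j < n" by auto
    have sw: "ws ! k = vs ! j \<longleftrightarrow> k = f j" if "k < n" for k
      using fP[OF ij(2) that] by auto
    have "(M * Q) $$ (i, j) = (\<Sum>k<n. M $$ (i, k) * (if k = f j then 1 else 0))"
      using ij that sw by (auto simp: Q_def scalar_prod_def lessThan_atLeast0 intro!: sum.cong)
    also have "\<dots> = (\<Sum>k<n. if k = f j then M $$ (i, k) else 0)"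
      by (rule sum.cong) auto
    also have "\<dots> = M $$ (i, f j)" using fi ij by simp
    finally show "(M * Q) $$ (i, j) = mat n n (\<lambda>(i, j). M $$ (i, f j)) $$ (i, j)"
      using ij by simp
  qed (use that Q in auto)
  have PQ: "P * Q = 1\<^sub>m n"
    unfolding P_mult[OF Q] by (rule eq_matI) (auto simp: Q_def f fi nth_eq_iff_index_eq[OF vs] n_def[symmetric])
  have QP: "Q * P = 1\<^sub>m n"
    by (rule mat_mult_left_right_inverse[OF P Q PQ])
  have L: "signless_laplacian ws G \<in> carrier_mat n n"
    and L': "signless_laplacian vs G \<in> carrier_mat n n"
    using signless_laplacian_carrier[of ws G] signless_laplacian_carrier[of vs G] lw n_def
    by simp_all
  have PL: "P * signless_laplacian ws G \<in> carrier_mat n n"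
    using P L by auto
  have "signless_laplacian vs G = P * signless_laplacian ws G * Q"
    unfolding mult_Q[OF PL] unfolding P_mult[OF L]
  proof (rule eq_matI)
    fix i j assume "i < dim_row (mat n n (\<lambda>(i, j). mat n n (\<lambda>(i, j).
        signless_laplacian ws G $$ (f i, j)) $$ (i, f j)))"
      "j < dim_col (mat n n (\<lambda>(i, j). mat n n (\<lambda>(i, j).
        signless_laplacian ws G $$ (f i, j)) $$ (i, f j)))"
    then have ij: "i < n" "j < n" by auto
    have "f i = f j \<longleftrightarrow> i = j" by (metis fg(2) ij)
    then have "signless_laplacian vs G $$ (i, j) = signless_laplacian ws G $$ (f i, f j)"
      using ij f[OF ij(1)] f[OF ij(2)] lw
      by (simp add: signless_laplacian_def degree_mat_def adjacency_mat_def n_def)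
    then show "signless_laplacian vs G $$ (i, j) = mat n n (\<lambda>(i, j). mat n n (\<lambda>(i, j).
        signless_laplacian ws G $$ (f i, j)) $$ (i, f j)) $$ (i, j)"
      using ij fi by simp
  qed (use L' in auto)
  then show ?thesis
    unfolding similar_mat_def using similar_mat_witI[OF PQ QP _ L' L P Q] by blast
qed

lemma slee_eq:
  assumes "distinct vs" "set vs = pverts G"
  shows "slee G = (\<Sum>q\<in>#proots (char_poly (signless_laplacian vs G)). exp q)"
proof -
  let ?ws = "SOME vs. distinct vs \<and> set vs = pverts G"
  have "distinct ?ws \<and> set ?ws = pverts G"
    by (rule someI[of "\<lambda>vs. distinct vs \<and> set vs = pverts G" vs]) (simp add: assms)
  then have "similar_mat (signless_laplacian ?ws G) (signless_laplacian vs G)"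
    using assms signless_laplacian_permute[of ?ws vs G] by argo
  then have "char_poly (signless_laplacian ?ws G) = char_poly (signless_laplacian vs G)"
    by (rule char_poly_similar)
  then show ?thesis by (simp only: slee_def)
qed


section \<open>Complete graphs with pendent paths\<close>

text \<open>
  The complete graph on the vertices \<open>u\<^sub>i = (i, 0)\<close> for \<open>i < m\<close>, with a pendent path
  \<open>(i, 0), (i, 1), \<dots>, (i, p i)\<close> attached to each \<open>u\<^sub>i\<close>.
\<close>

definition clique_with_paths :: "nat \<Rightarrow> (nat \<Rightarrow> nat) \<Rightarrow> (nat \<times> nat) pair_pre_digraph" where
  "clique_with_paths m p = \<lparr>
     pverts = (SIGMA i:{..<m}. {..p i}),
     parcs = {((i, 0), (i', 0)) | i i'. i < m \<and> i' < m \<and> i \<noteq> i'}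
       \<union> {((i, j), (i, Suc j)) | i j. i < m \<and> j < p i}
       \<union> {((i, Suc j), (i, j)) | i j. i < m \<and> j < p i} \<rparr>"

text \<open>
  Admissible path lengths for \<open>G\<^sub>n\<^sup>r\<close>, which is \<open>clique_with_paths (n - r) p\<close> for any \<open>p\<close> with
  \<open>balanced_lengths n r p\<close>; different choices only permute the path lengths.
\<close>

definition balanced_lengths :: "nat \<Rightarrow> nat \<Rightarrow> (nat \<Rightarrow> nat) \<Rightarrow> bool" where
  "balanced_lengths n r p \<longleftrightarrow> (\<Sum>i<n - r. p i) = r \<and>
     (\<forall>i<n - r. \<forall>j<n - r. \<bar>int (p i) - int (p j)\<bar> \<le> 1)"

lemma pair_graph_clique_with_paths: "pair_graph (clique_with_paths m p)"
proof -
  let ?G = "clique_with_paths m p"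
  have sub: "parcs ?G \<subseteq> pverts ?G \<times> pverts ?G"
    by (auto simp: clique_with_paths_def)
  have fin: "finite (pverts ?G)"
    by (simp add: clique_with_paths_def)
  show ?thesis
  proof unfold_locales
    show "finite (parcs ?G)"
      using sub fin by (meson finite_SigmaI finite_subset)
    show "symmetric (with_proj ?G)"
      by (auto simp: symmetric_def sym_def clique_with_paths_def)
  qed (use sub fin in \<open>auto simp: clique_with_paths_def\<close>)
qed

lemma card_clique_with_paths:
  assumes "balanced_lengths n r p" "r \<le> n"
  shows "card (pverts (clique_with_paths (n - r) p)) = n"
  using assms by (simp add: clique_with_paths_def balanced_lengths_def sum_Suc)

lemma balanced_lengths_exists:
  assumes "r < n"
  shows "balanced_lengths n r (\<lambda>i. r div (n - r) + (if i < r mod (n - r) then 1 else 0))"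
proof -
  let ?m = "n - r"
  have "r mod ?m < ?m" using assms by simp
  then have "{..<?m} \<inter> {i. i < r mod ?m} = {..<r mod ?m}"
    by auto
  then have "(\<Sum>i<?m. if i < r mod ?m then 1 else 0::nat) = r mod ?m"
    by (simp add: sum.If_cases)
  then show ?thesis
    by (simp add: balanced_lengths_def sum.distrib)
qed

end

theory Submission
  imports Defs "Jordan_Normal_Form.Schur_Decomposition"
begin

text \<open>
  The index is the sum of the traces of \<open>Q\<^sup>k / k!\<close>, so it suffices to compare traces of powers. If a
  graph is changed by moving edges from one half of a path to their mirror images on the other half,
  and the first half has no other neighbours, then in the coordinates \<open>e (\<tau> x) \<plusminus> e x\<close> the matrix
  of the new graph dominates the absolute values of the matrix of the old one; hence all traces of
  powers increase weakly.

  The dominator tree with respect to a vertex that is no cut vertex embeds every graph with \<open>r\<close> cut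
  vertices into the line graph of a tree with \<open>r\<close> inner edges. As long as two vertices of that
  tree have degree at least three, a reflection along the path between them followed by
  adding edges increases the index. What remains are complete graphs with pendent paths, whose
  lengths are balanced by reflections.
\<close>

section \<open>Traces of powers\<close>

text \<open>In the standard basis the matrices before and after a move are not comparable entrywise.
  In the reflected basis they are: the part of the graph that stays has nonnegative entries there,
  because the first half embeds into its mirror image and so has no larger degrees, and the moved
  edges only change the sign of entries between an antisymmetric coordinate and one of another kind.
  This yields a weak inequality. For branchings, strictness comes from the edges added afterwards.
  Balancing adds no edge, so it needs a closed walk on which the change of sign is visible; the walk
  passes from an antisymmetric to a symmetric coordinate through a difference of degrees across the
  middle, which at least three clique vertices provide. With two, the graph is a single path for all
  lengths.

  The tree is stored without its common root. Its edges are the vertices of the graph and its inner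
  edges stand for the cut vertices, so moves that keep the inner edges keep \<open>r\<close>.
  Disconnected graphs need no reduction, since all components hang below the same root.\<close>

primrec mpow :: "'a set \<Rightarrow> ('a \<Rightarrow> 'a \<Rightarrow> real) \<Rightarrow> nat \<Rightarrow> 'a \<Rightarrow> 'a \<Rightarrow> real" where
  "mpow V A 0 = (\<lambda>x y. if x = y then 1 else 0)"
| "mpow V A (Suc k) = (\<lambda>x y. \<Sum>z\<in>V. mpow V A k x z * A z y)"

definition tr :: "'a set \<Rightarrow> ('a \<Rightarrow> 'a \<Rightarrow> real) \<Rightarrow> real" where
  "tr V A = (\<Sum>x\<in>V. A x x)"

text \<open>Rows and columns are indexed by vertices and everything is read off the arc set. So the
  matrix is additive over disjoint arc sets, and maps of vertices act on it directly.\<close>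

definition sl :: "('a \<times> 'a) set \<Rightarrow> 'a \<Rightarrow> 'a \<Rightarrow> real" where
  "sl E x y = (if x = y then real (card (E `` {x})) else 0) + (if (x, y) \<in> E then 1 else 0)"

section \<open>Spectra of real symmetric matrices and the exponential trace series\<close>

text \<open>For an eigenvector v the Hermitian form \<open>s\<close> of A at v is its own conjugate,
  and it equals c times the positive real number \<open>N\<close>.\<close>

lemma symmetric_eigenvalue_real:
  fixes A :: "real mat"
  assumes A: "A \<in> carrier_mat n n" and sym: "\<And>i j. i < n \<Longrightarrow> j < n \<Longrightarrow> A $$ (i,j) = A $$ (j,i)"
    and ev: "eigenvalue (map_mat complex_of_real A) c"
  shows "complex_of_real (Re c) = c"
proof -
  let ?B = "map_mat complex_of_real A"
  from ev A obtain v where v: "v \<in> carrier_vec n" "v \<noteq> 0\<^sub>v n" "?B *\<^sub>v v = c \<cdot>\<^sub>v v"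
    unfolding eigenvalue_def eigenvector_def by auto
  have row: "(\<Sum>j<n. complex_of_real (A $$ (i,j)) * v $ j) = c * v $ i" if "i < n" for i
  proof -
    have "(?B *\<^sub>v v) $ i = (\<Sum>j<n. complex_of_real (A $$ (i,j)) * v $ j)"
      using that A v(1) by (auto simp: scalar_prod_def lessThan_atLeast0 intro!: sum.cong)
    then show ?thesis using v(1,3) that by simp
  qed
  define N where "N = (\<Sum>i<n. cnj (v $ i) * v $ i)"
  define s where "s = (\<Sum>i<n. cnj (v $ i) * (\<Sum>j<n. complex_of_real (A $$ (i,j)) * v $ j))"
  have "s = (\<Sum>i<n. cnj (v $ i) * (c * v $ i))"
    unfolding s_def by (intro sum.cong refl) (simp add: row)
  then have sN: "s = c * N" unfolding N_def by (simp add: sum_distrib_left mult.left_commute)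
  have "cnj s = (\<Sum>i<n. \<Sum>j<n. v $ i * (complex_of_real (A $$ (i,j)) * cnj (v $ j)))"
    unfolding s_def by (simp add: sum_distrib_left)
  also have "\<dots> = (\<Sum>j<n. \<Sum>i<n. v $ i * (complex_of_real (A $$ (i,j)) * cnj (v $ j)))"
    by (rule sum.swap)
  also have "\<dots> = s" unfolding s_def sum_distrib_left
    by (intro sum.cong refl) (auto simp: sym)
  finally have cs: "cnj s = s" .
  have Nr: "N = complex_of_real (\<Sum>i<n. (cmod (v $ i))\<^sup>2)"
    unfolding N_def by (simp add: complex_norm_square mult.commute del: of_real_power)
  have "\<exists>i<n. v $ i \<noteq> 0"
  proof (rule ccontr)
    assume "\<not> ?thesis"
    then have "v = 0\<^sub>v n" using v(1) by (intro eq_vecI) auto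
    then show False using v(2) by simp
  qed
  then obtain i where i: "i < n" "v $ i \<noteq> 0" by blast
  have "(\<Sum>i<n. (cmod (v $ i))\<^sup>2) > 0"
    by (rule sum_pos2[of _ i]) (use i in auto)
  then have N0: "N \<noteq> 0" unfolding Nr of_real_eq_0_iff by simp
  have "cnj c * N = c * N" using cs unfolding sN by (simp add: Nr)
  then have "cnj c = c" using N0 by simp
  then show ?thesis by (simp add: complex_eq_iff)
qed

text \<open>The factorization over the complex numbers has only real roots, so it descends along the
  injective embedding of polynomials.\<close>

lemma symmetric_char_poly_splits:
  fixes A :: "real mat"
  assumes A: "A \<in> carrier_mat n n" and sym: "\<And>i j. i < n \<Longrightarrow> j < n \<Longrightarrow> A $$ (i,j) = A $$ (j,i)"
  shows "\<exists>as. char_poly A = (\<Prod>a\<leftarrow>as. [:- a, 1:])"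
proof -
  interpret h: map_poly_inj_idom_hom complex_of_real ..
  let ?B = "map_mat complex_of_real A"
  have B: "?B \<in> carrier_mat n n" using A by simp
  obtain cs where cs: "char_poly ?B = (\<Prod>a\<leftarrow>cs. [:- a, 1:])"
    using char_poly_factorized[OF B] by blast
  have real: "complex_of_real (Re c) = c" if "c \<in> set cs" for c
  proof (rule symmetric_eigenvalue_real[OF A sym])
    have "poly (char_poly ?B) c = 0" unfolding cs poly_prod_list
      using that by (auto simp: prod_list_zero_iff o_def image_iff)
    then show "eigenvalue ?B c" using eigenvalue_root_char_poly[OF B] by blast
  qed auto
  have "map_poly complex_of_real (char_poly A) = char_poly ?B"
    by (rule of_real_hom.char_poly_hom[OF A, symmetric])
  also have "\<dots> = (\<Prod>a\<leftarrow>cs. map_poly complex_of_real [:- Re a, 1:])"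
    unfolding cs by (intro arg_cong[of _ _ prod_list] map_cong refl) (simp add: real)
  also have "\<dots> = map_poly complex_of_real (\<Prod>a\<leftarrow>cs. [:- Re a, 1:])"
    by (simp add: h.hom_prod_list o_def)
  finally have "char_poly A = (\<Prod>a\<leftarrow>cs. [:- Re a, 1:])" by (rule h.injectivity)
  then have "char_poly A = (\<Prod>a\<leftarrow>map Re cs. [:- a, 1:])" by (simp add: o_def)
  then show ?thesis by blast
qed

lemma index_mult_mat_sum:
  assumes "X \<in> carrier_mat n n" "Y \<in> carrier_mat n n" "i < n" "j < n"
  shows "(X * Y) $$ (i,j) = (\<Sum>l<n. X $$ (i,l) * Y $$ (l,j))"
  using assms by (simp add: scalar_prod_def lessThan_atLeast0)

text \<open>In a product of upper triangular matrices only indices i \<le> l \<le> j contribute to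
  the entry (i, j): none below the diagonal, a single one on it.\<close>

lemma upper_triangular_pow_diag:
  fixes B :: "real mat"
  assumes B: "B \<in> carrier_mat n n" and ut: "upper_triangular B"
  shows "upper_triangular (B ^\<^sub>m k) \<and> (\<forall>i<n. (B ^\<^sub>m k) $$ (i,i) = (B $$ (i,i)) ^ k)"
proof (induction k)
  case 0
  then show ?case using B by auto
next
  case (Suc k)
  have C: "B ^\<^sub>m k \<in> carrier_mat n n" using B by simp
  have e: "(B ^\<^sub>m Suc k) $$ (i,j) = (\<Sum>l<n. (B ^\<^sub>m k) $$ (i,l) * B $$ (l,j))" if "i < n" "j < n" for i j
    using index_mult_mat_sum[OF C B that] by simp
  have z: "(B ^\<^sub>m k) $$ (i,l) * B $$ (l,j) = 0" if "i < n" "l < n" "j < n" "l < i \<or> j < l" for i l j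
    using that upper_triangularD[of "B ^\<^sub>m k" l i] upper_triangularD[OF ut, of j l] Suc C B by auto
  have "upper_triangular (B ^\<^sub>m Suc k)"
  proof (rule upper_triangularI)
    fix i j assume "j < i" "i < dim_row (B ^\<^sub>m Suc k)"
    then have ij: "j < i" "i < n" using B C by auto
    have "(\<Sum>l<n. (B ^\<^sub>m k) $$ (i,l) * B $$ (l,j)) = 0"
      by (rule sum.neutral) (use z[of i _ j] ij in \<open>auto, meson not_less order.strict_trans1\<close>)
    then show "(B ^\<^sub>m Suc k) $$ (i,j) = 0" using e[of i j] ij by linarith
  qed
  moreover have "(B ^\<^sub>m Suc k) $$ (i,i) = (B $$ (i,i)) ^ Suc k" if i: "i < n" for i
  proof -
    have "(\<Sum>l<n. (B ^\<^sub>m k) $$ (i,l) * B $$ (l,i)) = (\<Sum>l<n. if l = i then (B ^\<^sub>m k) $$ (i,i) * B $$ (i,i) else 0)"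
      by (rule sum.cong) (use z i in \<open>auto, metis nat_neq_iff\<close>)
    then show ?thesis using e[OF i i] Suc i by simp
  qed
  ultimately show ?case by blast
qed

text \<open>The Schur form has the eigenvalues on its diagonal, so the trace of the k-th power is
  the sum of their k-th powers; finitely many exponential series are then added.\<close>

lemma sum_exp_roots_eq_trace_series:
  fixes A :: "real mat"
  assumes A: "A \<in> carrier_mat n n" and sym: "\<And>i j. i < n \<Longrightarrow> j < n \<Longrightarrow> A $$ (i,j) = A $$ (j,i)"
  shows "(\<lambda>k. (\<Sum>i<n. (A ^\<^sub>m k) $$ (i,i)) / fact k) sums (\<Sum>q\<in>#proots (char_poly A). exp q)"
proof -
  obtain es where es: "char_poly A = (\<Prod>a\<leftarrow>es. [:- a, 1:])"
    using symmetric_char_poly_splits[OF assms] by auto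
  obtain B P Q where dec: "schur_decomposition A es = (B,P,Q)" by (cases "schur_decomposition A es")
  from schur_decomposition[OF A es dec] have w: "similar_mat_wit A B P Q" "upper_triangular B" "diag_mat B = es"
    by auto
  from similar_mat_witD2[OF A w(1)] have QP: "Q * P = 1\<^sub>m n" and B: "B \<in> carrier_mat n n"
    and P: "P \<in> carrier_mat n n" and Q: "Q \<in> carrier_mat n n" by auto
  have len: "length es = n" using w(3) B by (auto simp: diag_mat_def)
  have esi: "es ! i = B $$ (i,i)" if "i < n" for i using that w(3) B by (auto simp: diag_mat_def)
  have roots: "proots (char_poly A) = mset es"
    unfolding es by (induction es) (simp_all add: proots_mult prod_list_zero_iff image_iff del: mult_pCons_left mult_pCons_right)
  have trk: "(\<Sum>i<n. (A ^\<^sub>m k) $$ (i,i)) = (\<Sum>i<n. (es ! i) ^ k)" for k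
  proof -
    let ?C = "B ^\<^sub>m k"
    have C: "?C \<in> carrier_mat n n" using B by simp
    have PC: "P * ?C \<in> carrier_mat n n" using P C by simp
    have Ak: "A ^\<^sub>m k = P * ?C * Q" by (rule similar_mat_wit_pow_id[OF w(1)])
    have "(\<Sum>i<n. (A ^\<^sub>m k) $$ (i,i)) = (\<Sum>i<n. \<Sum>l<n. (P * ?C) $$ (i,l) * Q $$ (l,i))"
      unfolding Ak by (intro sum.cong refl index_mult_mat_sum[OF PC Q]) auto
    also have "\<dots> = (\<Sum>l<n. \<Sum>i<n. Q $$ (l,i) * (P * ?C) $$ (i,l))"
      by (subst sum.swap) (simp add: mult.commute)
    also have "\<dots> = (\<Sum>l<n. (Q * (P * ?C)) $$ (l,l))"
      by (intro sum.cong refl index_mult_mat_sum[OF Q PC, symmetric]) auto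
    \<comment> \<open>Cyclicity of the trace has brought \<open>Q\<close> to the front, where it
      cancels against \<open>P\<close>.\<close>
    also have "Q * (P * ?C) = ?C"
      using assoc_mult_mat[OF Q P C] left_mult_one_mat[OF C] unfolding QP by argo
    also have "(\<Sum>l<n. ?C $$ (l,l)) = (\<Sum>i<n. (es ! i) ^ k)"
      using upper_triangular_pow_diag[OF B w(2), of k] esi by simp
    finally show ?thesis .
  qed
  have "(\<lambda>k. \<Sum>i<n. (es ! i) ^ k / fact k) sums (\<Sum>i<n. exp (es ! i))"
    by (intro sums_sum) (use exp_converges[where 'a = real] in \<open>simp add: divide_inverse mult.commute\<close>)
  moreover have "(\<Sum>i<n. exp (es ! i)) = (\<Sum>q\<in>#proots (char_poly A). exp q)"
    unfolding roots mset_map[symmetric] sum_mset_sum_list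
    by (simp add: sum_list_sum_nth len lessThan_atLeast0)
  ultimately show ?thesis unfolding trk by (simp add: sum_divide_distrib)
qed

lemma slee_sums:
  assumes "pair_graph G"
  shows "(\<lambda>k. tr (pverts G) (mpow (pverts G) (sl (parcs G)) k) / fact k) sums slee G"
proof -
  interpret pair_graph G by fact
  obtain vs where vs: "set vs = pverts G" "distinct vs"
    using finite_distinct_list[OF finite_verts] by auto
  define n where "n = length vs"
  let ?A = "signless_laplacian vs G"
  have A: "?A \<in> carrier_mat n n" by (simp add: n_def)
  have deg: "out_degree (with_proj G) v = card (parcs G `` {v})" for v
  proof -
    have "out_arcs (with_proj G) v = Pair v ` (parcs G `` {v})"
      by (auto simp: out_arcs_def)
    then show ?thesis unfolding out_degree_def by (simp add: card_image inj_on_def)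
  qed
  have ent: "?A $$ (i,j) = sl (parcs G) (vs ! i) (vs ! j)" if "i < n" "j < n" for i j
    using that vs(2) deg nth_eq_iff_index_eq[OF vs(2), of i j]
    by (auto simp: signless_laplacian_def degree_mat_def adjacency_mat_def sl_def n_def)
  have symE: "(x,y) \<in> parcs G \<longleftrightarrow> (y,x) \<in> parcs G" for x y
    using arcs_symmetric by blast
  have sym: "?A $$ (i,j) = ?A $$ (j,i)" if "i < n" "j < n" for i j
    using that symE by (auto simp: ent sl_def)
  have reidx: "(\<Sum>i<n. f (vs ! i)) = (\<Sum>x\<in>pverts G. f x)" for f :: "'a \<Rightarrow> real"
    by (rule sum.reindex_bij_betw) (simp add: bij_betw_nth[OF vs(2)] n_def vs(1))
  have pw: "(?A ^\<^sub>m k) $$ (i,j) = mpow (pverts G) (sl (parcs G)) k (vs ! i) (vs ! j)" if "i < n" "j < n" for i j k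
    using that
  proof (induction k arbitrary: j)
    case 0
    then show ?case using nth_eq_iff_index_eq[OF vs(2), of i j] carrier_matD(1)[OF A] by (simp add: n_def)
  next
    case (Suc k)
    have C: "?A ^\<^sub>m k \<in> carrier_mat n n" using A by simp
    have "(?A ^\<^sub>m Suc k) $$ (i,j) = (\<Sum>l<n. (?A ^\<^sub>m k) $$ (i,l) * ?A $$ (l,j))"
      using index_mult_mat_sum[OF C A Suc.prems] by simp
    also have "\<dots> = (\<Sum>l<n. mpow (pverts G) (sl (parcs G)) k (vs ! i) (vs ! l) * sl (parcs G) (vs ! l) (vs ! j))"
      using Suc by (intro sum.cong refl) (auto simp: ent)
    finally show ?case by (simp add: reidx[of "\<lambda>z. mpow (pverts G) (sl (parcs G)) k (vs ! i) z * sl (parcs G) z (vs ! j)"])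
  qed
  have "(\<Sum>i<n. (?A ^\<^sub>m k) $$ (i,i)) = tr (pverts G) (mpow (pverts G) (sl (parcs G)) k)" for k
    unfolding tr_def reidx[symmetric] by (intro sum.cong) (auto simp: pw)
  then show ?thesis
    using sum_exp_roots_eq_trace_series[OF A sym] unfolding slee_eq[OF vs(2,1)] by simp
qed

lemma slee_mono:
  assumes "pair_graph G" "pair_graph H"
    and le: "\<And>k. tr (pverts G) (mpow (pverts G) (sl (parcs G)) k) \<le> tr (pverts H) (mpow (pverts H) (sl (parcs H)) k)"
  shows "slee G \<le> slee H"
  by (rule sums_le[OF _ slee_sums[OF assms(1)] slee_sums[OF assms(2)]]) (auto intro: divide_right_mono le)

lemma slee_strict_mono:
  assumes "pair_graph G" "pair_graph H"
    and le: "\<And>k. tr (pverts G) (mpow (pverts G) (sl (parcs G)) k) \<le> tr (pverts H) (mpow (pverts H) (sl (parcs H)) k)"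
    and less: "tr (pverts G) (mpow (pverts G) (sl (parcs G)) k) < tr (pverts H) (mpow (pverts H) (sl (parcs H)) k)"
  shows "slee G < slee H"
proof -
  let ?f = "\<lambda>k. tr (pverts H) (mpow (pverts H) (sl (parcs H)) k) / fact k - tr (pverts G) (mpow (pverts G) (sl (parcs G)) k) / fact k"
  have s: "?f sums (slee H - slee G)"
    by (intro sums_diff slee_sums assms)
  have nn: "0 \<le> ?f k" for k using le[of k] by (simp add: divide_right_mono)
  have "0 < ?f k" using less by (simp add: divide_strict_right_mono)
  then have "0 < suminf ?f"
    using suminf_pos2[OF sums_summable[OF s], of k] nn by blast
  then show ?thesis using sums_unique[OF s] by simp
qed

section \<open>Reflections\<close>

lemma mpow_abs_le:
  assumes le: "\<And>x y. x \<in> V \<Longrightarrow> y \<in> V \<Longrightarrow> \<bar>A x y\<bar> \<le> B x y" and "x \<in> V" "y \<in> V"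
  shows "\<bar>mpow V A k x y\<bar> \<le> mpow V B k x y"
  using \<open>y \<in> V\<close>
proof (induction k arbitrary: y)
  case (Suc k)
  have "\<bar>\<Sum>z\<in>V. mpow V A k x z * A z y\<bar> \<le> (\<Sum>z\<in>V. \<bar>mpow V A k x z * A z y\<bar>)"
    by (rule sum_abs)
  also have "\<dots> \<le> (\<Sum>z\<in>V. mpow V B k x z * B z y)"
    unfolding abs_mult using Suc le \<open>x \<in> V\<close>
    by (intro sum_mono mult_mono) (auto intro: order_trans[OF abs_ge_zero])
  finally show ?case by simp
qed simp

lemma tr_mpow_abs_le:
  assumes "\<And>x y. x \<in> V \<Longrightarrow> y \<in> V \<Longrightarrow> \<bar>A x y\<bar> \<le> B x y"
  shows "tr V (mpow V A k) \<le> tr V (mpow V B k)"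
  unfolding tr_def by (intro sum_mono) (use mpow_abs_le[of V A B, OF assms] in \<open>force simp: abs_le_iff\<close>)

text \<open>A strict inequality at (i, j) is carried along a walk from \<open>j\<close> back to
  \<open>i\<close> and arrives at the diagonal entry (i, i) of some power. Steps need a positive
  entry of \<open>B\<close>, and a nonnegative one of \<open>A\<close> so that no two negative signs
  cancel.\<close>

lemma tr_mpow_less:
  assumes V: "finite V" and le: "\<And>x y. x \<in> V \<Longrightarrow> y \<in> V \<Longrightarrow> \<bar>A x y\<bar> \<le> B x y"
    and ij: "i \<in> V" "j \<in> V" "A i j < B i j"
    and reach: "(j, i) \<in> {(x, y). x \<in> V \<and> y \<in> V \<and> 0 \<le> A x y \<and> 0 < B x y}\<^sup>*"
  shows "\<exists>k. tr V (mpow V A k) < tr V (mpow V B k)"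
proof -
  have mle: "\<bar>mpow V A k x y\<bar> \<le> mpow V B k x y" if "x \<in> V" "y \<in> V" for k x y
    by (rule mpow_abs_le[OF le that])
  have "\<exists>k. mpow V A k i y < mpow V B k i y"
    if "(j, y) \<in> {(x, y). x \<in> V \<and> y \<in> V \<and> 0 \<le> A x y \<and> 0 < B x y}\<^sup>*" for y
    using that
  proof (induction rule: rtrancl_induct)
    case base
    have d: "mpow V C (Suc 0) i j = C i j" for C
      using V ij by (simp add: if_distrib[of "\<lambda>u. u * _"] sum.delta cong: if_cong)
    show ?case using ij(3) d by metis
  next
    case (step y z)
    then obtain k where k: "mpow V A k i y < mpow V B k i y" by blast
    from step have yz: "y \<in> V" "z \<in> V" "0 \<le> A y z" "0 < B y z" by auto
    have t: "mpow V A k i w * A w z \<le> mpow V B k i w * B w z" if "w \<in> V" for w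
    proof -
      have "mpow V A k i w * A w z \<le> \<bar>mpow V A k i w\<bar> * \<bar>A w z\<bar>" by (metis abs_ge_self abs_mult)
      also have "\<dots> \<le> mpow V B k i w * B w z"
        using that ij(1) yz(2) mle le by (intro mult_mono) (auto intro: order_trans[OF abs_ge_zero])
      finally show ?thesis .
    qed
    have "mpow V A k i y * A y z < mpow V B k i y * B y z"
    proof (cases "0 \<le> mpow V A k i y")
      case True
      have "mpow V A k i y * A y z \<le> mpow V A k i y * B y z"
        using True le[OF yz(1,2)] by (intro mult_left_mono) auto
      also have "\<dots> < mpow V B k i y * B y z" using k yz by simp
      finally show ?thesis .
    next
      \<comment> \<open>A negative entry of the power of \<open>A\<close> becomes at most 0 after
        this step, while the entry for \<open>B\<close> dominates its absolute value and so stays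
        positive.\<close>
      case False
      then have "mpow V A k i y * A y z \<le> 0" using yz by (intro mult_nonpos_nonneg) auto
      also have "0 < mpow V B k i y * B y z" using False mle[OF ij(1) yz(1), of k] yz(4) by simp
      finally show ?thesis .
    qed
    then have "mpow V A (Suc k) i z < mpow V B (Suc k) i z"
      using t yz V by (auto intro!: sum_strict_mono_ex1)
    then show ?case by blast
  qed
  from this[OF reach] obtain k where "mpow V A k i i < mpow V B k i i" ..
  then have "tr V (mpow V A k) < tr V (mpow V B k)"
    unfolding tr_def using V ij(1) mle by (intro sum_strict_mono_ex1) (force simp: abs_le_iff)+
  then show ?thesis ..
qed

lemma sl_nonneg: "0 \<le> sl E x y"
  by (simp add: sl_def)

lemma sl_sym: "sym E \<Longrightarrow> sl E x y = sl E y x"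
  by (auto simp: sl_def dest: symD)

lemma sl_Un:
  assumes "finite E" "finite F" "E \<inter> F = {}"
  shows "sl (E \<union> F) x y = sl E x y + sl F x y"
proof -
  have "card ((E \<union> F) `` {x}) = card (E `` {x}) + card (F `` {x})"
    unfolding Un_Image by (rule card_Un_disjoint) (use assms in \<open>auto simp: finite_Image\<close>)
  then show ?thesis using assms by (auto simp: sl_def)
qed

text \<open>An additional edge raises a degree. Degrees are the diagonal entries, so the trivial
  walk from a vertex to itself already witnesses strictness.\<close>

lemma slee_subgraph_less:
  assumes "pair_graph G" "pair_graph H" "pverts G = pverts H" "parcs G \<subset> parcs H"
  shows "slee G < slee H"
proof -
  interpret G: pair_graph G by fact
  interpret H: pair_graph H by fact
  let ?V = "pverts H"
  have fin: "finite (parcs H)" "finite (parcs G)" "finite ?V" by auto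
  have card: "card (parcs G `` {x}) \<le> card (parcs H `` {x})" for x
    using assms(4) fin by (intro card_mono) (auto simp: finite_Image)
  then have le: "\<bar>sl (parcs G) x y\<bar> \<le> sl (parcs H) x y" for x y
    using assms(4) card[of x] by (auto simp: sl_def intro: order_trans[OF _ less_imp_le[OF less_add_one]])
  from assms(4) obtain x y where xy: "(x,y) \<in> parcs H" "(x,y) \<notin> parcs G" by auto
  then have "x \<in> ?V" by (meson H.in_arcsD1)
  have "(parcs G `` {x}) \<subset> (parcs H `` {x})" using assms(4) xy by auto
  then have "card (parcs G `` {x}) < card (parcs H `` {x})"
    using fin by (intro psubset_card_mono) (auto simp: finite_Image)
  then have less: "sl (parcs G) x x < sl (parcs H) x x"
    using assms(4) by (auto simp: sl_def)
  have "\<exists>k. tr ?V (mpow ?V (sl (parcs G)) k) < tr ?V (mpow ?V (sl (parcs H)) k)"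
    by (rule tr_mpow_less[where A = "sl (parcs G)" and B = "sl (parcs H)", OF fin(3) le \<open>x \<in> ?V\<close> \<open>x \<in> ?V\<close> less])
      (rule rtrancl.rtrancl_refl)
  then obtain k where "tr ?V (mpow ?V (sl (parcs G)) k) < tr ?V (mpow ?V (sl (parcs H)) k)" ..
  moreover have "tr ?V (mpow ?V (sl (parcs G)) k) \<le> tr ?V (mpow ?V (sl (parcs H)) k)" for k
    by (rule tr_mpow_abs_le[OF le])
  ultimately show ?thesis
    using slee_strict_mono[OF assms(1,2), of k] unfolding assms(3) by blast
qed

section \<open>Change of basis by a reflection\<close>

text \<open>\<open>L\<close> is one half, its image under \<open>\<tau>\<close> the other, and all
  remaining vertices are fixed. \<open>\<tau>\<close> is an involution of the whole type, so that
  reindexing needs no membership conditions.\<close>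

locale reflection =
  fixes V L :: "'a set" and \<tau> :: "'a \<Rightarrow> 'a"
  assumes finite_V: "finite V" and L_V: "L \<subseteq> V" and \<tau>_V [simp]: "\<tau> x \<in> V \<longleftrightarrow> x \<in> V"
    and \<tau>_L: "x \<in> L \<Longrightarrow> \<tau> x \<notin> L" and \<tau>\<tau> [simp]: "\<tau> (\<tau> x) = x"
    and \<tau>_fix: "x \<notin> L \<Longrightarrow> \<tau> x \<notin> L \<Longrightarrow> \<tau> x = x"
begin

lemma \<tau>_L': "\<tau> x \<in> L \<Longrightarrow> x \<notin> L"
  using \<tau>_L[of x] by blast

lemma \<tau>_eq_iff [simp]: "\<tau> x = \<tau> y \<longleftrightarrow> x = y"
  by (metis \<tau>\<tau>)

text \<open>
  Antisymmetric and symmetric parts under the reflection: \<open>rowop\<close> takes the coordinates with respect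
  to the vectors \<open>e (\<tau> a) - e a\<close> and \<open>e (\<tau> a) + e a\<close> for \<open>a \<in> L\<close>, stored at the
  indices \<open>a\<close> and \<open>\<tau> a\<close>, and \<open>colop\<close> is the dual operation.
\<close>

definition rowop :: "('a \<Rightarrow> real) \<Rightarrow> 'a \<Rightarrow> real" where
  "rowop f a = (if a \<in> L then f (\<tau> a) - f a else if \<tau> a \<in> L then f a + f (\<tau> a) else f a)"

definition colop :: "('a \<Rightarrow> real) \<Rightarrow> 'a \<Rightarrow> real" where
  "colop f a = (if a \<in> L then (f (\<tau> a) - f a) / 2 else if \<tau> a \<in> L then (f a + f (\<tau> a)) / 2 else f a)"

text \<open>Conjugation by the change of basis: \<open>rowop\<close> multiplies by it from the left
  and \<open>colop\<close> by its inverse from the right. The factor 1/2 is put into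
  \<open>colop\<close> alone.\<close>

definition rfl :: "('a \<Rightarrow> 'a \<Rightarrow> real) \<Rightarrow> 'a \<Rightarrow> 'a \<Rightarrow> real" where
  "rfl A a b = rowop (\<lambda>x. colop (A x) b) a"

lemma rfl_simps:
  "a \<in> L \<Longrightarrow> b \<in> L \<Longrightarrow> rfl A a b = (A (\<tau> a) (\<tau> b) - A (\<tau> a) b - A a (\<tau> b) + A a b) / 2"
  "a \<in> L \<Longrightarrow> \<tau> b \<in> L \<Longrightarrow> rfl A a b = (A (\<tau> a) b + A (\<tau> a) (\<tau> b) - A a b - A a (\<tau> b)) / 2"
  "a \<in> L \<Longrightarrow> b \<notin> L \<Longrightarrow> \<tau> b \<notin> L \<Longrightarrow> rfl A a b = A (\<tau> a) b - A a b"
  "\<tau> a \<in> L \<Longrightarrow> b \<in> L \<Longrightarrow> rfl A a b = (A a (\<tau> b) - A a b + A (\<tau> a) (\<tau> b) - A (\<tau> a) b) / 2"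
  "\<tau> a \<in> L \<Longrightarrow> \<tau> b \<in> L \<Longrightarrow> rfl A a b = (A a b + A a (\<tau> b) + A (\<tau> a) b + A (\<tau> a) (\<tau> b)) / 2"
  "\<tau> a \<in> L \<Longrightarrow> b \<notin> L \<Longrightarrow> \<tau> b \<notin> L \<Longrightarrow> rfl A a b = A a b + A (\<tau> a) b"
  "a \<notin> L \<Longrightarrow> \<tau> a \<notin> L \<Longrightarrow> b \<in> L \<Longrightarrow> rfl A a b = (A a (\<tau> b) - A a b) / 2"
  "a \<notin> L \<Longrightarrow> \<tau> a \<notin> L \<Longrightarrow> \<tau> b \<in> L \<Longrightarrow> rfl A a b = (A a b + A a (\<tau> b)) / 2"
  "a \<notin> L \<Longrightarrow> \<tau> a \<notin> L \<Longrightarrow> b \<notin> L \<Longrightarrow> \<tau> b \<notin> L \<Longrightarrow> rfl A a b = A a b"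
  using \<tau>_L'[of a] \<tau>_L'[of b]
  by (simp_all add: rfl_def rowop_def colop_def add_divide_distrib diff_divide_distrib)

lemma position_cases:
  obtains "a \<in> L" "b \<in> L" | "a \<in> L" "\<tau> b \<in> L" | "a \<in> L" "b \<notin> L" "\<tau> b \<notin> L"
  | "\<tau> a \<in> L" "b \<in> L" | "\<tau> a \<in> L" "\<tau> b \<in> L" | "\<tau> a \<in> L" "b \<notin> L" "\<tau> b \<notin> L"
  | "a \<notin> L" "\<tau> a \<notin> L" "b \<in> L" | "a \<notin> L" "\<tau> a \<notin> L" "\<tau> b \<in> L"
  | "a \<notin> L" "\<tau> a \<notin> L" "b \<notin> L" "\<tau> b \<notin> L"
  by (cases "a \<in> L"; cases "\<tau> a \<in> L"; cases "b \<in> L"; cases "\<tau> b \<in> L") auto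

lemma sum_split: "(\<Sum>x\<in>V. f x) = (\<Sum>x\<in>L. f x + f (\<tau> x)) + (\<Sum>x\<in>{x \<in> V. x \<notin> L \<and> \<tau> x \<notin> L}. f x :: real)"
proof -
  have fL: "finite L" by (rule finite_subset[OF L_V finite_V])
  have V: "V = (L \<union> \<tau> ` L) \<union> {x \<in> V. x \<notin> L \<and> \<tau> x \<notin> L}"
  proof (intro equalityI subsetI)
    fix x assume "x \<in> V"
    then show "x \<in> (L \<union> \<tau> ` L) \<union> {x \<in> V. x \<notin> L \<and> \<tau> x \<notin> L}"
      by (cases "\<tau> x \<in> L") (auto intro: image_eqI[of x \<tau> "\<tau> x"])
  next
    fix x assume "x \<in> (L \<union> \<tau> ` L) \<union> {x \<in> V. x \<notin> L \<and> \<tau> x \<notin> L}"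
    then show "x \<in> V" using L_V by auto
  qed
  have "(\<Sum>x\<in>V. f x) = (\<Sum>x\<in>L \<union> \<tau> ` L. f x) + (\<Sum>x\<in>{x \<in> V. x \<notin> L \<and> \<tau> x \<notin> L}. f x)"
    by (subst V, rule sum.union_disjoint) (use fL finite_V in auto)
  also have "(\<Sum>x\<in>L \<union> \<tau> ` L. f x) = (\<Sum>x\<in>L. f x) + (\<Sum>x\<in>\<tau> ` L. f x)"
    using fL \<tau>_L by (intro sum.union_disjoint) auto
  also have "(\<Sum>x\<in>\<tau> ` L. f x) = (\<Sum>x\<in>L. f (\<tau> x))"
    by (subst sum.reindex) (auto intro!: inj_onI)
  finally show ?thesis by (simp only: sum.distrib)
qed

text \<open>The two operations are inverse to each other. On a mirror pair this is the identity (u'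
  - u)(v' - v)/2 + (u' + u)(v' + v)/2 = u v + u' v'.\<close>

lemma sum_colop_rowop: "(\<Sum>c\<in>V. colop f c * rowop g c) = (\<Sum>c\<in>V. f c * g c)"
  unfolding sum_split
proof (rule arg_cong2[where f = "(+)"]; rule sum.cong[OF refl])
  fix x assume x: "x \<in> L"
  then show "colop f x * rowop g x + colop f (\<tau> x) * rowop g (\<tau> x) = f x * g x + f (\<tau> x) * g (\<tau> x)"
    using \<tau>_L[OF x] by (simp add: colop_def rowop_def) (simp add: field_simps)
qed (simp add: colop_def rowop_def)

lemma rowop_sum: "rowop (\<lambda>x. \<Sum>z\<in>Z. f x z * c z) a = (\<Sum>z\<in>Z. rowop (\<lambda>x. f x z) a * c z)"
  by (simp add: rowop_def sum.distrib sum_subtractf left_diff_distrib distrib_right)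

lemma colop_sum: "colop (\<lambda>x. \<Sum>z\<in>Z. c z * f z x) b = (\<Sum>z\<in>Z. c z * colop (f z) b)"
proof -
  have "c z * ((u - v) / 2) = (c z * u - c z * v) / 2" "c z * ((u + v) / 2) = (c z * u + c z * v) / 2" for z u v
    by (simp_all add: right_diff_distrib distrib_left)
  then show ?thesis
    unfolding colop_def
    by (cases "b \<in> L"; cases "\<tau> b \<in> L")
      (simp_all only: if_True if_False sum_divide_distrib[symmetric] sum_subtractf sum.distrib)
qed

lemma rfl_mult: "rfl (\<lambda>x y. \<Sum>z\<in>V. A x z * B z y) a b = (\<Sum>c\<in>V. rfl A a c * rfl B c b)"
proof -
  have "rfl (\<lambda>x y. \<Sum>z\<in>V. A x z * B z y) a b = rowop (\<lambda>x. \<Sum>z\<in>V. A x z * colop (B z) b) a"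
    unfolding rfl_def by (rule arg_cong[of _ _ "\<lambda>f. rowop f a"], rule ext, rule colop_sum)
  also have "\<dots> = rowop (\<lambda>x. \<Sum>c\<in>V. colop (A x) c * rowop (\<lambda>z. colop (B z) b) c) a"
    by (rule arg_cong[of _ _ "\<lambda>f. rowop f a"], rule ext, rule sum_colop_rowop[symmetric])
  also have "\<dots> = (\<Sum>c\<in>V. rowop (\<lambda>x. colop (A x) c) a * rowop (\<lambda>z. colop (B z) b) c)"
    by (rule rowop_sum)
  finally show ?thesis unfolding rfl_def .
qed

lemma rfl_id: "rfl (\<lambda>x y. if x = y then 1 else 0) a b = (if a = b then 1 else 0)"
proof -
  have ne: "\<tau> x \<noteq> x" "x \<noteq> \<tau> x" if "x \<in> L \<or> \<tau> x \<in> L" for x using that \<tau>_L[of x] by auto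
  have e: "a = \<tau> b \<longleftrightarrow> \<tau> a = b" by auto
  have eq: ?thesis if "a = b"
  proof -
    consider "a \<in> L" | "\<tau> a \<in> L" | "a \<notin> L" "\<tau> a \<notin> L" by blast
    then show ?thesis using ne[of a] that by cases (simp_all add: rfl_simps)
  qed
  have img: ?thesis if "b = \<tau> a"
  proof -
    consider "a \<in> L" | "\<tau> a \<in> L" | "a \<notin> L" "\<tau> a \<notin> L" by blast
    then show ?thesis using ne[of a] that \<tau>_fix[of a] by cases (simp_all add: rfl_simps)
  qed
  have ?thesis if "a \<noteq> b" "b \<noteq> \<tau> a" "\<tau> a \<noteq> b" "a \<noteq> \<tau> b"
    using that by (simp add: rfl_def rowop_def colop_def)
  then show ?thesis using eq img e by metis
qed

lemma mpow_rfl: "mpow V (rfl A) k a b = rfl (mpow V A k) a b"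
proof (induction k arbitrary: b)
  case 0
  show ?case unfolding mpow.simps rfl_id ..
next
  case (Suc k)
  show ?case unfolding mpow.simps Suc rfl_mult ..
qed

lemma tr_rfl: "tr V (rfl A) = tr V A"
  unfolding tr_def sum_split
proof (rule arg_cong2[where f = "(+)"]; rule sum.cong[OF refl])
  fix x assume x: "x \<in> L"
  then show "rfl A x x + rfl A (\<tau> x) (\<tau> x) = A x x + A (\<tau> x) (\<tau> x)"
    by (simp add: rfl_simps field_simps)
qed (simp add: rfl_simps)

lemma tr_mpow_rfl: "tr V (mpow V (rfl A) k) = tr V (mpow V A k)"
  using tr_rfl[of "mpow V A k"] unfolding tr_def mpow_rfl .

lemma rfl_add: "rfl (\<lambda>x y. A x y + B x y) a b = rfl A a b + rfl B a b"
  by (simp add: rfl_def rowop_def colop_def field_simps)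

text \<open>\<open>A\<close> vanishes on the mirror half, so at most one summand of each reflected
  entry survives. Moving \<open>A\<close> to the mirror half makes every sign positive; the negative
  ones occurred between an antisymmetric coordinate and a symmetric or fixed one.\<close>

lemma rfl_moved:
  assumes nn: "\<And>x y. 0 \<le> A x y" and supp: "\<And>x y. \<tau> x \<in> L \<Longrightarrow> A x y = 0" "\<And>x y. \<tau> y \<in> L \<Longrightarrow> A x y = 0"
  shows "\<bar>rfl A a b\<bar> \<le> rfl (\<lambda>x y. A (\<tau> x) (\<tau> y)) a b"
proof -
  note nn = nn[of a b] nn[of "\<tau> a" b] nn[of a "\<tau> b"] nn[of "\<tau> a" "\<tau> b"]
  have sa: "A (\<tau> a) y = 0" if "a \<in> L" for y using supp(1)[of "\<tau> a"] that by simp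
  have sb: "A x (\<tau> b) = 0" if "b \<in> L" for x using supp(2)[of "\<tau> b"] that by simp
  note s = supp(1)[of a] supp(2)[of b] sa sb
  show ?thesis
    by (rule position_cases[of a b])
      (simp_all only: rfl_simps \<tau>_fix[of a] \<tau>_fix[of b] \<tau>\<tau> s simp_thms, use nn in simp_all)
qed

end

text \<open>
  Reflecting at the middle of a path: the half \<open>L\<close> is embedded into the half \<open>\<tau> ` L\<close>, and the edges
  \<open>F\<close> hanging at \<open>L\<close> are moved to their mirror images. In the coordinates of the
  reflection this at most replaces entries by their absolute values.
\<close>

locale graph_reflection = reflection +
  fixes E F F' :: "('a \<times> 'a) set"
  assumes E_V: "E \<subseteq> V \<times> V" and sym_E: "sym E"
    and mirror: "\<And>b x. b \<in> L \<Longrightarrow> (b, x) \<in> E \<Longrightarrow> (\<tau> b, \<tau> x) \<in> E"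
    and cross: "\<And>a b. a \<in> L \<Longrightarrow> b \<in> L \<Longrightarrow> (a, \<tau> b) \<in> E \<Longrightarrow> a = b"
    and F_V: "F \<subseteq> V \<times> V" and F_R: "\<And>x y. (x, y) \<in> F \<Longrightarrow> \<tau> x \<notin> L \<and> \<tau> y \<notin> L"
    and F': "\<And>x y. (x, y) \<in> F' \<longleftrightarrow> (\<tau> x, \<tau> y) \<in> F"
    and disj: "E \<inter> F = {}" "E \<inter> F' = {}"
begin

lemma finite_EF [simp]: "finite E" "finite F" "finite F'"
proof -
  show "finite E" "finite F" using E_V F_V finite_V by (meson finite_SigmaI finite_subset)+
  have "F' \<subseteq> map_prod \<tau> \<tau> ` F"
  proof (safe)
    fix x y assume "(x, y) \<in> F'"
    then show "(x, y) \<in> map_prod \<tau> \<tau> ` F"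
      using F' by (intro image_eqI[of _ _ "(\<tau> x, \<tau> y)"]) auto
  qed
  then show "finite F'" using \<open>finite F\<close> finite_surj by blast
qed

lemma sl_F': "sl F' x y = sl F (\<tau> x) (\<tau> y)"
proof -
  have "F' `` {x} = \<tau> ` (F `` {\<tau> x})"
  proof (safe)
    fix y assume "(x, y) \<in> F'"
    then show "y \<in> \<tau> ` (F `` {\<tau> x})"
      using F' by (intro image_eqI[of _ _ "\<tau> y"]) auto
  qed (simp add: F')
  then have "card (F' `` {x}) = card (F `` {\<tau> x})"
    by (simp add: card_image inj_on_def)
  then show ?thesis unfolding sl_def F' by auto
qed

lemma sl_mirror: "b \<in> L \<Longrightarrow> sl E b x \<le> sl E (\<tau> b) (\<tau> x)"
proof -
  assume b: "b \<in> L"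
  have "card (E `` {b}) = card (\<tau> ` (E `` {b}))" by (simp add: card_image inj_on_def)
  also have "\<dots> \<le> card (E `` {\<tau> b})"
    using mirror[OF b] by (intro card_mono) (auto simp: finite_Image)
  finally show ?thesis using mirror[OF b, of x] by (auto simp: sl_def)
qed

text \<open>Negative summands belong to entries at \<open>L\<close>, and their mirror images
  dominate them by \<open>sl_mirror\<close>. Between two antisymmetric coordinates the negative
  summands are entries across the middle, which by \<open>cross\<close> vanish unless a = b.\<close>

lemma rfl_sl_nonneg: "0 \<le> rfl (sl E) a b"
proof -
  note s = sl_sym[OF sym_E]
  have both: "sl E (\<tau> a) b + sl E a (\<tau> b) \<le> sl E (\<tau> a) (\<tau> b) + sl E a b" if "a \<in> L" "b \<in> L"
  proof (cases "a = b")
    case False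
    then have "(a, \<tau> b) \<notin> E" "(b, \<tau> a) \<notin> E" using cross that by blast+
    moreover have "a \<noteq> \<tau> b" "\<tau> a \<noteq> b" using that \<tau>_L[of a] \<tau>_L[of b] by auto
    ultimately have "sl E a (\<tau> b) = 0" "sl E (\<tau> a) b = 0"
      using symD[OF sym_E, of "\<tau> a" b] by (auto simp: sl_def)
    then show ?thesis by (simp add: sl_nonneg)
  next
    case True
    have ne: "\<tau> a \<noteq> a" "a \<noteq> \<tau> a" using that \<tau>_L[of a] by auto
    have e: "(\<tau> a, a) \<in> E \<longleftrightarrow> (a, \<tau> a) \<in> E" using sym_E by (auto dest: symD)
    \<comment> \<open>An edge between \<open>a\<close> and its mirror image counts negatively twice,
      but it also contributes to the degrees of both of its ends.\<close>
    have "(a, \<tau> a) \<in> E \<Longrightarrow> card (E `` {\<tau> a}) \<ge> 1 \<and> card (E `` {a}) \<ge> 1"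
      using e by (auto simp: Suc_le_eq card_gt_0_iff finite_Image)
    then show ?thesis using ne e True by (auto simp: sl_def)
  qed
  have fix_b: "sl E x (\<tau> b) = sl E x b" if "b \<notin> L" "\<tau> b \<notin> L" for x
    using \<tau>_fix[OF that] by simp
  have fix_a: "sl E (\<tau> a) y = sl E a y" if "a \<notin> L" "\<tau> a \<notin> L" for y
    using \<tau>_fix[OF that] by simp
  show ?thesis
    by (rule position_cases[of a b])
      (use both sl_mirror[of a b] sl_mirror[of a "\<tau> b"] sl_mirror[of b a] sl_mirror[of b "\<tau> a"]
        s[of b a] s[of b "\<tau> a"] s[of "\<tau> b" a] s[of "\<tau> b" "\<tau> a"] in \<open>simp_all add: rfl_simps sl_nonneg fix_a fix_b\<close>)
qed

lemma sl_F_R: "\<tau> x \<in> L \<Longrightarrow> sl F x y = 0" "\<tau> y \<in> L \<Longrightarrow> sl F x y = 0"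
proof -
  have e: "F `` {x} = {}" if "\<tau> x \<in> L" for x using F_R that by auto
  then show "\<tau> x \<in> L \<Longrightarrow> sl F x y = 0" using F_R by (auto simp: sl_def)
  show "\<tau> y \<in> L \<Longrightarrow> sl F x y = 0" using F_R e[of y] by (auto simp: sl_def)
qed

lemma rfl_EF: "rfl (sl (E \<union> F)) a b = rfl (sl E) a b + rfl (sl F) a b"
  "rfl (sl (E \<union> F')) a b = rfl (sl E) a b + rfl (\<lambda>x y. sl F (\<tau> x) (\<tau> y)) a b"
proof -
  have *: "sl (E \<union> F) = (\<lambda>x y. sl E x y + sl F x y)"
    "sl (E \<union> F') = (\<lambda>x y. sl E x y + sl F (\<tau> x) (\<tau> y))"
    using disj by (auto simp: fun_eq_iff sl_Un sl_F')
  show "rfl (sl (E \<union> F)) a b = rfl (sl E) a b + rfl (sl F) a b"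
    "rfl (sl (E \<union> F')) a b = rfl (sl E) a b + rfl (\<lambda>x y. sl F (\<tau> x) (\<tau> y)) a b"
    unfolding * rfl_add by auto
qed

lemma rfl_F_abs_le: "\<bar>rfl (sl F) a b\<bar> \<le> rfl (\<lambda>x y. sl F (\<tau> x) (\<tau> y)) a b"
  by (rule rfl_moved) (simp_all add: sl_F_R sl_nonneg)

text \<open>The contribution of \<open>E\<close> is nonnegative and common to both sides, so the
  bound for \<open>F\<close> carries over by the triangle inequality.\<close>

lemma rfl_abs_le: "\<bar>rfl (sl (E \<union> F)) a b\<bar> \<le> rfl (sl (E \<union> F')) a b"
  using rfl_F_abs_le[of a b] rfl_sl_nonneg[of a b] unfolding rfl_EF by linarith

lemma tr_le: "tr V (mpow V (sl (E \<union> F)) k) \<le> tr V (mpow V (sl (E \<union> F')) k)"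
  using tr_mpow_abs_le[of V "rfl (sl (E \<union> F))" "rfl (sl (E \<union> F'))" k] rfl_abs_le
  unfolding tr_mpow_rfl by blast

text \<open>
  The weights of the closed walk \<open>s, v, \<dots>, c, \<tau> c, \<dots>, \<tau> v, s\<close> in the reflected coordinates
  have different signs before and after the move.
\<close>

lemma tr_less:
  assumes s: "s \<in> V" "s \<notin> L" and v: "v \<in> L" and vs: "(s, v) \<in> F" "(v, s) \<in> F"
    and chain: "(v, c) \<in> (E \<inter> L \<times> L)\<^sup>*" and irr: "irrefl E"
    and deg: "card ((E \<union> F) `` {c}) \<le> card ((E \<union> F) `` {\<tau> c})"
      "card ((E \<union> F') `` {c}) < card ((E \<union> F') `` {\<tau> c})"
    and FL: "F \<inter> L \<times> L = {}" and symF: "sym F"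
  shows "\<exists>k. tr V (mpow V (sl (E \<union> F)) k) < tr V (mpow V (sl (E \<union> F')) k)"
proof -
  let ?A = "rfl (sl (E \<union> F))" and ?B = "rfl (sl (E \<union> F'))"
  define P where "P = {(x, y). x \<in> V \<and> y \<in> V \<and> 0 \<le> ?A x y \<and> 0 < ?B x y}"
  have sR: "\<tau> s \<notin> L" using vs F_R by blast
  have sfix: "\<tau> s = s" by (rule \<tau>_fix[OF s(2) sR])
  have vV: "v \<in> V" "\<tau> v \<in> V" using v L_V by auto
  have nLR: "\<tau> x \<notin> L" if "x \<in> L" for x using that \<tau>_L by blast
  have sn: "s \<noteq> v" "s \<noteq> \<tau> v" "v \<noteq> s" "\<tau> v \<noteq> s" using s v sR by auto
  \<comment> \<open>The vertex \<open>s\<close> is fixed and \<open>v\<close> is antisymmetric: the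
    move flips the sign of this entry.\<close>
  have "rfl (sl F) s v = - 1 / 2" "rfl (\<lambda>x y. sl F (\<tau> x) (\<tau> y)) s v = 1 / 2"
    using s sR v sfix sl_F_R(2)[of "\<tau> v" s]
    by (simp_all add: rfl_simps) (use sn vs in \<open>simp_all add: sl_def\<close>)
  then have start: "?A s v < ?B s v"
    unfolding rfl_EF by simp
  have cL: "c \<in> L" using chain v by (induction rule: rtrancl_induct) auto
  \<comment> \<open>An edge inside \<open>L\<close> also exists in the mirror half, so it gives a
    positive entry both between antisymmetric and between symmetric coordinates; \<open>F\<close>
    does not meet it.\<close>
  have inL: "(x, y) \<in> P" "(\<tau> y, \<tau> x) \<in> P" if "(x, y) \<in> E \<inter> L \<times> L" for x y
  proof -
    from that have xy: "(x, y) \<in> E" "x \<in> L" "y \<in> L" by auto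
    have ne: "x \<noteq> y" "y \<noteq> x" using xy irr by (auto simp: irrefl_def)
    have E': "(y, x) \<in> E" "(\<tau> x, \<tau> y) \<in> E" "(\<tau> y, \<tau> x) \<in> E"
      using xy mirror sym_E by (auto dest: symD)
    have nc: "(x, \<tau> y) \<notin> E" "(y, \<tau> x) \<notin> E"
      using cross[of x y] cross[of y x] xy ne by auto
    then have nc': "(\<tau> x, y) \<notin> E" "(\<tau> y, x) \<notin> E"
      using sym_E by (auto dest: symD)
    have ne2: "x \<noteq> \<tau> y" "\<tau> x \<noteq> y" "y \<noteq> \<tau> x" "\<tau> y \<noteq> x" using nLR[OF xy(2)] nLR[OF xy(3)] xy by auto
    have nF: "sl F x y = 0" "sl F y x = 0" using ne FL xy by (auto simp: sl_def)
    have "0 < rfl (sl E) x y" "0 < rfl (sl E) (\<tau> y) (\<tau> x)"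
      using xy ne ne2 E' nc nc' by (simp_all add: rfl_simps sl_def)
    moreover have "rfl (sl F) x y = 0" "rfl (sl F) (\<tau> y) (\<tau> x) = 0"
      using xy nF by (simp_all add: rfl_simps sl_F_R)
    ultimately have "0 \<le> ?A x y" "0 < ?B x y" "0 \<le> ?A (\<tau> y) (\<tau> x)" "0 < ?B (\<tau> y) (\<tau> x)"
      unfolding rfl_EF using rfl_F_abs_le[of x y] rfl_F_abs_le[of "\<tau> y" "\<tau> x"] by linarith+
    moreover have "x \<in> V" "y \<in> V" using xy L_V by auto
    ultimately show "(x, y) \<in> P" "(\<tau> y, \<tau> x) \<in> P" by (auto simp: P_def)
  qed
  have "(v, c) \<in> P\<^sup>* \<and> (\<tau> c, \<tau> v) \<in> P\<^sup>*"
    using chain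
  proof (induction rule: rtrancl_induct)
    case (step y z)
    then show ?case using inL[OF step(2)]
      by (meson converse_rtrancl_into_rtrancl rtrancl.rtrancl_into_rtrancl)
  qed auto
  then have fwd: "(v, c) \<in> P\<^sup>*" and bwd: "(\<tau> c, \<tau> v) \<in> P\<^sup>*" by auto
  have symEF: "sym (E \<union> F)" "sym (E \<union> F')"
    using sym_E symF unfolding sym_def Un_iff F' by blast+
  have mid: "(c, \<tau> c) \<in> P"
  proof -
    \<comment> \<open>By symmetry the mixed terms cancel, and the entry is half the difference of
      the degrees of \<open>\<tau> c\<close> and \<open>c\<close>. This is where the assumptions on
      degrees enter.\<close>
    have e: "rfl (sl G) c (\<tau> c) = (sl G (\<tau> c) (\<tau> c) - sl G c c + (sl G (\<tau> c) c - sl G c (\<tau> c))) / 2" for G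
      using cL by (simp add: rfl_simps)
    have nE: "(c, c) \<notin> E" "(\<tau> c, \<tau> c) \<notin> E" using irr by (auto simp: irrefl_def)
    moreover have "(c, c) \<notin> F" "(\<tau> c, \<tau> c) \<notin> F" using FL F_R[of "\<tau> c" "\<tau> c"] cL by auto
    moreover from this have "(c, c) \<notin> F'" "(\<tau> c, \<tau> c) \<notin> F'" by (auto simp: F')
    ultimately have "0 \<le> ?A c (\<tau> c)" "0 < ?B c (\<tau> c)"
      unfolding e using deg sl_sym[OF symEF(1), of c "\<tau> c"] sl_sym[OF symEF(2), of c "\<tau> c"]
      by (simp_all add: sl_def)
    then show ?thesis using cL L_V by (auto simp: P_def)
  qed
  have last: "(\<tau> v, s) \<in> P"
  proof -
    \<comment> \<open>From a symmetric coordinate to a fixed vertex the edge counts positively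
      before and after the move, so the walk closes without another sign.\<close>
    have "rfl (sl F) (\<tau> v) s = 1" using v s sR sn sl_F_R(1)[of "\<tau> v" s] vs
      by (simp add: rfl_simps) (simp add: sl_def)
    then have "0 \<le> ?A (\<tau> v) s" "0 < ?B (\<tau> v) s"
      unfolding rfl_EF using rfl_F_abs_le[of "\<tau> v" s] rfl_sl_nonneg[of "\<tau> v" s] by linarith+
    then show ?thesis using s vV by (simp add: P_def)
  qed
  have "(v, s) \<in> P\<^sup>*"
    using fwd mid bwd last by (meson rtrancl.rtrancl_into_rtrancl rtrancl_trans)
  from tr_mpow_less[where A = ?A and B = ?B, OF finite_V rfl_abs_le s(1) vV(1) start this[unfolded P_def]]
  show ?thesis unfolding tr_mpow_rfl .
qed

end

section \<open>Reflections at the middle of a path\<close>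

definition path_flip :: "(nat \<Rightarrow> 'a) \<Rightarrow> nat \<Rightarrow> 'a \<Rightarrow> 'a" where
  "path_flip z N x = (if x \<in> z ` {..N} then z (N - the_inv_into {..N} z x) else x)"

lemma path_flip_on [simp]: "inj_on z {..N} \<Longrightarrow> i \<le> N \<Longrightarrow> path_flip z N (z i) = z (N - i)"
  by (simp add: path_flip_def the_inv_into_f_f)

lemma path_flip_off: "x \<notin> z ` {..N} \<Longrightarrow> path_flip z N x = x"
  by (simp add: path_flip_def)

text \<open>\<open>half\<close> says that \<open>E\<close> meets the first half only in path edges,
  whose mirror images are path edges again. \<open>I\<close> marks the positions whose edges to
  \<open>S\<close> are moved. The strict bound \<open>2 * i < N\<close> leaves the middle vertex
  fixed when \<open>N\<close> is even.\<close>

lemma path_reflection: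
  fixes z :: "nat \<Rightarrow> 'a"
  assumes V: "finite V" and E: "E \<subseteq> V \<times> V" "sym E"
    and inj: "inj_on z {..N}" and zV: "z ` {..N} \<subseteq> V"
    and path: "\<And>i. i < N \<Longrightarrow> (z i, z (Suc i)) \<in> E"
    and half: "\<And>i x. 2 * i < N \<Longrightarrow> (z i, x) \<in> E \<Longrightarrow> x = z (Suc i) \<or> 0 < i \<and> x = z (i - 1)"
    and I: "\<And>i. i \<in> I \<Longrightarrow> 2 * i < N" and S: "S \<subseteq> V" "S \<inter> z ` {..N} = {}"
    and new: "\<And>i s. i \<in> I \<Longrightarrow> s \<in> S \<Longrightarrow> (z (N - i), s) \<notin> E"
  shows "graph_reflection V (z ` {i. 2 * i < N}) (path_flip z N) E
    (z ` I \<times> S \<union> S \<times> z ` I) ((\<lambda>i. z (N - i)) ` I \<times> S \<union> S \<times> (\<lambda>i. z (N - i)) ` I)"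
proof -
  let ?L = "z ` {i. 2 * i < N}" and ?f = "path_flip z N"
  note fz = path_flip_on[OF inj]
  have inj': "z i = z j \<longleftrightarrow> i = j" if "i \<le> N" "j \<le> N" for i j
    using inj_on_eq_iff[OF inj, of i j] that by simp
  have zin: "z i \<in> V" if "i \<le> N" for i using zV that by auto
  have ff: "?f (?f x) = x" for x
    by (cases "x \<in> z ` {..N}") (auto simp: fz path_flip_off)
  have fV': "?f x \<in> V" if "x \<in> V" for x
    using that by (cases "x \<in> z ` {..N}") (auto simp: fz path_flip_off zin)
  have fV: "?f x \<in> V \<longleftrightarrow> x \<in> V" for x using fV'[of x] fV'[of "?f x"] ff by auto
  have zL: "z i \<in> ?L \<longleftrightarrow> 2 * i < N" if "i \<le> N" for i
  proof
    assume "z i \<in> ?L"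
    then obtain j where j: "2 * j < N" "z i = z j" by auto
    then have "i = j" using inj'[of i j] that by simp
    then show "2 * i < N" using j by simp
  qed auto
  have fL: "?f x \<notin> ?L" if "x \<in> ?L" for x
  proof -
    from that obtain i where i: "x = z i" "2 * i < N" by auto
    then have "?f x = z (N - i)" by (simp add: fz)
    then show ?thesis using zL[of "N - i"] i by simp
  qed
  have offL: "x \<notin> ?L" if "x \<notin> z ` {..N}" for x using that by fastforce
  have ffix: "?f x = x" if "x \<notin> ?L" "?f x \<notin> ?L" for x
  proof (cases "x \<in> z ` {..N}")
    case True
    then obtain i where i: "x = z i" "i \<le> N" by auto
    then have "\<not> 2 * i < N" "\<not> 2 * (N - i) < N" using that zL[of i] zL[of "N - i"] by (auto simp: fz)
    then have "N - i = i" using i(2) by linarith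
    then show ?thesis using i fz[of i] by simp
  qed (simp add: path_flip_off)
  have sS: "s \<notin> z ` {..N}" "?f s = s" if "s \<in> S" for s
  proof -
    show "s \<notin> z ` {..N}" using S(2) that by blast
    then show "?f s = s" by (rule path_flip_off)
  qed
  have fS: "?f x \<in> S \<longleftrightarrow> x \<in> S" for x using sS[of x] sS[of "?f x"] ff[of x] by metis
  have fI: "?f x \<in> z ` I \<longleftrightarrow> x \<in> (\<lambda>i. z (N - i)) ` I" for x
  proof
    assume "?f x \<in> z ` I"
    then obtain i where i: "i \<in> I" "?f x = z i" by auto
    then have "x = z (N - i)" using ff[of x] fz[of i] I[of i] by simp
    then show "x \<in> (\<lambda>i. z (N - i)) ` I" using i by blast
  next
    assume "x \<in> (\<lambda>i. z (N - i)) ` I"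
    then obtain i where i: "i \<in> I" "x = z (N - i)" by auto
    then have "?f x = z i" using fz[of "N - i"] I[of i] by simp
    then show "?f x \<in> z ` I" using i by blast
  qed
  have zIS: "(z i, s) \<notin> E" if "2 * i < N" "s \<in> S" for i s
  proof
    assume "(z i, s) \<in> E"
    then have "s = z (Suc i) \<or> s = z (i - 1)" using half that by blast
    then have "s \<in> z ` {..N}" using that(1) by auto
    then show False using sS that by blast
  qed
  have symE: "(x, y) \<in> E \<Longrightarrow> (y, x) \<in> E" for x y using E(2) by (auto dest: symD)
  show ?thesis
  proof (unfold_locales, goal_cases)
    case 1 show ?case by (rule V)
  next
    case 2 show ?case using zin by auto
  next
    case (3 x) show ?case by (rule fV)
  next
    case (4 x) then show ?case by (rule fL)
  next
    case (5 x) show ?case by (rule ff)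
  next
    case (6 x) then show ?case by (rule ffix)
  next
    case 7 show ?case by (rule E)
  next
    case 8 show ?case by (rule E)
  next
    case (9 b x)
    then obtain i where i: "b = z i" "2 * i < N" by auto
    from half[of i x] 9 i have "x = z (Suc i) \<or> 0 < i \<and> x = z (i - 1)" by simp
    then show ?case
    proof
      assume x: "x = z (Suc i)"
      have "(z (N - Suc i), z (Suc (N - Suc i))) \<in> E" using path[of "N - Suc i"] i by simp
      moreover have "Suc (N - Suc i) = N - i" using i by simp
      ultimately show ?thesis using x i symE by (simp add: fz)
    next
      assume x: "0 < i \<and> x = z (i - 1)"
      have "(z (N - i), z (Suc (N - i))) \<in> E" using path[of "N - i"] i x by simp
      moreover have "Suc (N - i) = N - (i - 1)" using i x by simp
      ultimately show ?thesis using x i by (simp add: fz)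
    qed
  next
    case (10 a b)
    then obtain i j where ij: "a = z i" "2 * i < N" "b = z j" "2 * j < N" by auto
    then have e: "?f b = z (N - j)" by (simp add: fz)
    with half[of i "?f b"] 10 ij have "z (N - j) = z (Suc i) \<or> 0 < i \<and> z (N - j) = z (i - 1)" by simp
    \<comment> \<open>The second alternative would leave the upper half. The first gives i + j = N -
      1, which for two positions in the lower half forces i = j: only the middle edge
      crosses.\<close>
    then have "N - j = Suc i \<or> N - j = i - 1" using inj'[of "N - j" "Suc i"] inj'[of "N - j" "i - 1"] ij by auto
    then have "i = j" using ij by auto
    then show ?case using ij by simp
  next
    case 11 show ?case using S(1) zin I by fastforce
  next
    case (12 x y)
    have "?f (z i) \<notin> ?L" if "i \<in> I" for i using fL[of "z i"] I[OF that] by blast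
    moreover have "?f s \<notin> ?L" if "s \<in> S" for s using sS[OF that] offL by simp
    ultimately show ?case using 12 by blast
  next
    case (13 x y) show ?case using fS fI by auto
  next
    case 14 show ?case using zIS I symE by fastforce
  next
    case 15 show ?case using new symE by fastforce
  qed
qed

section \<open>Isomorphisms\<close>

text \<open>Heads and tails of both graphs are the projections of pairs, so the map on arcs is
  determined by the map on vertices.\<close>

lemma digraph_iso_with_proj_iff:
  assumes "pair_graph G"
  shows "digraph_iso (with_proj G) (with_proj H) \<longleftrightarrow>
    (\<exists>f. inj_on f (pverts G) \<and> pverts H = f ` pverts G \<and> parcs H = map_prod f f ` parcs G)"
proof
  interpret pair_graph G by fact
  assume "digraph_iso (with_proj G) (with_proj H)"
  then obtain h where h: "digraph_isomorphism h" "with_proj H = app_iso h (with_proj G)"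
    unfolding digraph_iso_def by blast
  from h(1) have inj: "inj_on (iso_verts h) (pverts G)"
    and arcs: "\<And>a. a \<in> parcs G \<Longrightarrow> iso_verts h (fst a) = iso_tail h (iso_arcs h a) \<and>
      iso_verts h (snd a) = iso_head h (iso_arcs h a)"
    unfolding digraph_isomorphism_def by auto
  from h(2) have H: "pverts H = iso_verts h ` pverts G" "parcs H = iso_arcs h ` parcs G"
    "fst = iso_tail h" "snd = iso_head h"
    by (auto simp: app_iso_def with_proj_def)
  have "iso_arcs h a = map_prod (iso_verts h) (iso_verts h) a" if "a \<in> parcs G" for a
    using arcs[OF that] unfolding H(3,4)[symmetric] by (cases a, cases "iso_arcs h a") auto
  then have "parcs H = map_prod (iso_verts h) (iso_verts h) ` parcs G"
    unfolding H(2) by (rule image_cong[OF refl])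
  then show "\<exists>f. inj_on f (pverts G) \<and> pverts H = f ` pverts G \<and> parcs H = map_prod f f ` parcs G"
    using inj H(1) by blast
next
  interpret pair_graph G by fact
  assume "\<exists>f. inj_on f (pverts G) \<and> pverts H = f ` pverts G \<and> parcs H = map_prod f f ` parcs G"
  then obtain f where f: "inj_on f (pverts G)" "pverts H = f ` pverts G" "parcs H = map_prod f f ` parcs G"
    by blast
  let ?h = "\<lparr>iso_verts = f, iso_arcs = map_prod f f, iso_head = snd, iso_tail = fst\<rparr>"
  have "parcs G \<subseteq> pverts G \<times> pverts G" by (auto dest: in_arcsD1 in_arcsD2)
  then have "inj_on (map_prod f f) (parcs G)"
    using map_prod_inj_on[OF f(1) f(1)] inj_on_subset by blast
  then have "digraph_isomorphism ?h"
    using f(1) wf_digraph_axioms unfolding digraph_isomorphism_def by simp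
  moreover have "with_proj H = app_iso ?h (with_proj G)"
    by (simp add: app_iso_def f with_proj_def)
  ultimately show "digraph_iso (with_proj G) (with_proj H)"
    unfolding digraph_iso_def by blast
qed

lemma digraph_isoI:
  assumes "pair_graph G" "pair_graph H" and f: "bij_betw f (pverts G) (pverts H)"
    and arcs: "\<And>x y. x \<in> pverts G \<Longrightarrow> y \<in> pverts G \<Longrightarrow> (f x, f y) \<in> parcs H \<longleftrightarrow> (x, y) \<in> parcs G"
  shows "digraph_iso (with_proj G) (with_proj H)"
proof -
  interpret G: pair_graph G by fact
  interpret H: pair_graph H by fact
  have "parcs H = map_prod f f ` parcs G"
  proof (intro equalityI subrelI)
    fix x y assume "(x, y) \<in> parcs H"
    moreover from this have "x \<in> pverts H" "y \<in> pverts H" by (auto dest: H.in_arcsD1 H.in_arcsD2)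
    moreover from this f obtain a b where "a \<in> pverts G" "b \<in> pverts G" "x = f a" "y = f b"
      unfolding bij_betw_def by blast
    ultimately show "(x, y) \<in> map_prod f f ` parcs G"
      using arcs by (intro image_eqI[of _ _ "(a, b)"]) auto
  next
    fix x y assume "(x, y) \<in> map_prod f f ` parcs G"
    then obtain a b where "(a, b) \<in> parcs G" "x = f a" "y = f b" by auto
    then show "(x, y) \<in> parcs H"
      using arcs G.in_arcsD1[of a b] G.in_arcsD2[of a b] by auto
  qed
  then show ?thesis
    unfolding digraph_iso_with_proj_iff[OF assms(1)] using f unfolding bij_betw_def by blast
qed

lemma slee_digraph_iso:
  assumes "pair_graph G" "pair_graph H" "digraph_iso (with_proj G) (with_proj H)"
  shows "slee G = slee H"
proof -
  interpret G: pair_graph G by fact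
  from assms obtain f where f: "inj_on f (pverts G)" "pverts H = f ` pverts G" "parcs H = map_prod f f ` parcs G"
    unfolding digraph_iso_with_proj_iff[OF assms(1)] by blast
  have sub: "x \<in> pverts G" "y \<in> pverts G" if "(x, y) \<in> parcs G" for x y
    using that by (auto dest: G.in_arcsD1 G.in_arcsD2)
  have e: "(f x, f y) \<in> parcs H \<longleftrightarrow> (x, y) \<in> parcs G" if "x \<in> pverts G" "y \<in> pverts G" for x y
  proof
    assume "(f x, f y) \<in> parcs H"
    then obtain a b where ab: "(a, b) \<in> parcs G" "f x = f a" "f y = f b" unfolding f(3) by auto
    then have "x = a" "y = b" using inj_onD[OF f(1)] sub[OF ab(1)] that by auto
    then show "(x, y) \<in> parcs G" using ab by simp
  qed (auto simp: f(3) intro: rev_image_eqI)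
  have im: "parcs H `` {f x} = f ` (parcs G `` {x})" if x: "x \<in> pverts G" for x
  proof (intro equalityI subsetI)
    fix u assume "u \<in> parcs H `` {f x}"
    then obtain a b where ab: "(a, b) \<in> parcs G" "f x = f a" "u = f b" unfolding f(3) by auto
    then have "x = a" using inj_onD[OF f(1)] sub[OF ab(1)] x by auto
    then show "u \<in> f ` (parcs G `` {x})" using ab by auto
  next
    fix u assume "u \<in> f ` (parcs G `` {x})"
    then obtain b where "(x, b) \<in> parcs G" "u = f b" by auto
    then show "u \<in> parcs H `` {f x}" unfolding f(3) by (auto intro: rev_image_eqI)
  qed
  have "card (parcs H `` {f x}) = card (parcs G `` {x})" if "x \<in> pverts G" for x
    unfolding im[OF that] by (intro card_image inj_on_subset[OF f(1)]) (auto dest: sub)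
  then have s: "sl (parcs H) (f x) (f y) = sl (parcs G) x y" if "x \<in> pverts G" "y \<in> pverts G" for x y
    using that e f(1) by (auto simp: sl_def inj_on_eq_iff)
  have m: "mpow (pverts H) (sl (parcs H)) k (f x) (f y) = mpow (pverts G) (sl (parcs G)) k x y"
    if "x \<in> pverts G" "y \<in> pverts G" for x y k
    using that(2)
  proof (induction k arbitrary: y)
    case 0
    then show ?case using that(1) f(1) by (simp add: inj_on_eq_iff)
  next
    case (Suc k)
    then show ?case unfolding mpow.simps f(2) sum.reindex[OF f(1)] o_def
      using s by (intro sum.cong) (auto simp: f(2))
  qed
  have "(\<Sum>x\<in>f ` pverts G. mpow (pverts H) (sl (parcs H)) k x x) = (\<Sum>x\<in>pverts G. mpow (pverts G) (sl (parcs G)) k x x)" for k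
    unfolding sum.reindex[OF f(1)] o_def by (intro sum.cong refl m)
  then have "(\<Sum>x\<in>pverts H. mpow (pverts H) (sl (parcs H)) k x x) = (\<Sum>x\<in>pverts G. mpow (pverts G) (sl (parcs G)) k x x)" for k
    by (simp only: f(2))
  then have "tr (pverts H) (mpow (pverts H) (sl (parcs H)) k) = tr (pverts G) (mpow (pverts G) (sl (parcs G)) k)" for k
    unfolding tr_def .
  note eq = this
  show ?thesis
  proof (rule antisym)
    show "slee G \<le> slee H" by (rule slee_mono[OF assms(1,2)]) (simp only: eq order_refl)
    show "slee H \<le> slee G" by (rule slee_mono[OF assms(2,1)]) (simp only: eq order_refl)
  qed
qed

section \<open>Forests with joined siblings\<close>

definition prel :: "'a set \<Rightarrow> ('a \<Rightarrow> 'a option) \<Rightarrow> ('a \<times> 'a) set" where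
  "prel V par = {(u, v). v \<in> V \<and> par v = Some u}"

definition kids :: "'a set \<Rightarrow> ('a \<Rightarrow> 'a option) \<Rightarrow> 'a \<Rightarrow> 'a set" where
  "kids V par u = {v \<in> V. par v = Some u}"

definition roots :: "'a set \<Rightarrow> ('a \<Rightarrow> 'a option) \<Rightarrow> 'a set" where
  "roots V par = {v \<in> V. par v = None}"

text \<open>These are the inner edges of the tree; in the dominator forest they are the cut
  vertices.\<close>

definition internal :: "'a set \<Rightarrow> ('a \<Rightarrow> 'a option) \<Rightarrow> 'a set" where
  "internal V par = {u. kids V par u \<noteq> {}}"

definition forest :: "'a set \<Rightarrow> ('a \<Rightarrow> 'a option) \<Rightarrow> bool" where
  "forest V par \<longleftrightarrow> finite V \<and> acyclic (prel V par) \<and> (\<forall>v\<in>V. \<forall>u. par v = Some u \<longrightarrow> u \<in> V)"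

text \<open>
  The line graph of the tree that arises from the forest by adding a common root: the vertices of
  the forest are the edges to the parents, and each family of siblings together with its parent is a
  clique.
\<close>

definition sgraph :: "'a set \<Rightarrow> ('a \<Rightarrow> 'a option) \<Rightarrow> 'a pair_pre_digraph" where
  "sgraph V par = \<lparr>pverts = V, parcs = {(x, y). x \<in> V \<and> y \<in> V \<and> x \<noteq> y \<and>
     (par x = par y \<or> par x = Some y \<or> par y = Some x)}\<rparr>"

lemma sgraph_simps [simp]:
  "pverts (sgraph V par) = V"
  "(x, y) \<in> parcs (sgraph V par) \<longleftrightarrow> x \<in> V \<and> y \<in> V \<and> x \<noteq> y \<and>
     (par x = par y \<or> par x = Some y \<or> par y = Some x)"
  by (auto simp: sgraph_def)

lemma pair_graphI:
  assumes "finite V" "E \<subseteq> V \<times> V" "sym E" "irrefl E"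
  shows "pair_graph \<lparr>pverts = V, parcs = E\<rparr>"
proof unfold_locales
  show "finite (parcs \<lparr>pverts = V, parcs = E\<rparr>)"
    using assms(1,2) by (auto intro: finite_subset)
  show "symmetric (with_proj \<lparr>pverts = V, parcs = E\<rparr>)"
    using assms(3) by (simp add: symmetric_def)
qed (use assms in \<open>auto simp: irrefl_def\<close>)

lemma pair_graph_sgraph: "finite V \<Longrightarrow> pair_graph (sgraph V par)"
  unfolding sgraph_def by (rule pair_graphI) (auto simp: sym_def irrefl_def)

section \<open>Descending chains and legs in a forest\<close>

definition dchain :: "'a set \<Rightarrow> ('a \<Rightarrow> 'a option) \<Rightarrow> 'a list \<Rightarrow> bool" where
  "dchain V par xs \<longleftrightarrow> xs \<noteq> [] \<and> set xs \<subseteq> V \<and> (\<forall>i. Suc i < length xs \<longrightarrow> par (xs ! Suc i) = Some (xs ! i))"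

text \<open>Every vertex but the last has exactly one child. So a chain of this kind offers no edges
  to other children, as the first half of a reflected path must.\<close>

definition ochain :: "'a set \<Rightarrow> ('a \<Rightarrow> 'a option) \<Rightarrow> 'a list \<Rightarrow> bool" where
  "ochain V par xs \<longleftrightarrow> xs \<noteq> [] \<and> hd xs \<in> V \<and> (\<forall>i. Suc i < length xs \<longrightarrow> kids V par (xs ! i) = {xs ! Suc i})"

lemma ochain_dchain: "ochain V par xs \<Longrightarrow> dchain V par xs"
proof -
  assume o: "ochain V par xs"
  then have s: "xs ! Suc i \<in> V \<and> par (xs ! Suc i) = Some (xs ! i)" if "Suc i < length xs" for i
    using that unfolding ochain_def kids_def by blast
  have "xs ! i \<in> V" if "i < length xs" for i
    using that s o by (cases i) (auto simp: ochain_def hd_conv_nth)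
  then show ?thesis using o s by (auto simp: dchain_def ochain_def set_conv_nth)
qed

lemma dchain_Cons:
  "dchain V par (x # xs) \<longleftrightarrow> x \<in> V \<and> (xs = [] \<or> dchain V par xs \<and> par (hd xs) = Some x)"
proof (cases xs)
  case (Cons y ys)
  have "(\<forall>i. Suc i < length (x # xs) \<longrightarrow> par ((x # xs) ! Suc i) = Some ((x # xs) ! i)) \<longleftrightarrow>
    par y = Some x \<and> (\<forall>i. Suc i < length xs \<longrightarrow> par (xs ! Suc i) = Some (xs ! i))"
    unfolding Cons by (auto simp: nth_Cons split: nat.splits)
  then show ?thesis by (auto simp: dchain_def Cons)
qed (auto simp: dchain_def)

lemma ochain_Cons:
  "ochain V par (x # xs) \<longleftrightarrow> x \<in> V \<and> (xs = [] \<or> ochain V par xs \<and> kids V par x = {hd xs})"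
proof (cases xs)
  case (Cons y ys)
  have "(\<forall>i. Suc i < length (x # xs) \<longrightarrow> kids V par ((x # xs) ! i) = {(x # xs) ! Suc i}) \<longleftrightarrow>
    kids V par x = {y} \<and> (\<forall>i. Suc i < length xs \<longrightarrow> kids V par (xs ! i) = {xs ! Suc i})"
    unfolding Cons by (auto simp: nth_Cons split: nat.splits)
  then show ?thesis by (auto simp: ochain_def Cons kids_def)
qed (auto simp: ochain_def)

lemma prel_kids: "(u, v) \<in> prel V par \<longleftrightarrow> v \<in> kids V par u"
  by (simp add: prel_def kids_def)

lemma forest_finite: "forest V par \<Longrightarrow> finite V"
  by (simp add: forest_def)

lemma finite_kids: "forest V par \<Longrightarrow> finite (kids V par u)"
  by (simp add: forest_def kids_def)

lemma kids_V: "v \<in> kids V par u \<Longrightarrow> v \<in> V"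
  by (simp add: kids_def)

lemma parent_V: "forest V par \<Longrightarrow> v \<in> kids V par u \<Longrightarrow> u \<in> V"
  by (auto simp: forest_def kids_def)

lemma finite_prel: "forest V par \<Longrightarrow> finite (prel V par)"
  by (rule finite_subset[of _ "V \<times> V"]) (auto simp: forest_def prel_def)

lemma forest_irrefl: "forest V par \<Longrightarrow> (x, x) \<notin> (prel V par)\<^sup>+"
  by (simp add: forest_def acyclic_def)

text \<open>The hypothesis covers all proper descendants and not only children, because a later
  recursion jumps over a whole chain at once.\<close>

lemma forest_down_induct:
  assumes "forest V par" and step: "\<And>v. (\<And>u. (v, u) \<in> (prel V par)\<^sup>+ \<Longrightarrow> P u) \<Longrightarrow> P v"
  shows "P v"
proof -
  have "wf ((prel V par)\<inverse>)"
    using assms(1) by (intro finite_acyclic_wf_converse finite_prel) (auto simp: forest_def)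
  then have "wf (((prel V par)\<inverse>)\<^sup>+)" by (rule wf_trancl)
  then show ?thesis
    by (induction v rule: wf_induct_rule) (auto simp: trancl_converse intro: step)
qed

lemma forest_up_induct:
  assumes "forest V par" and step: "\<And>v. (\<And>u. (u, v) \<in> prel V par \<Longrightarrow> P u) \<Longrightarrow> P v"
  shows "P v"
proof -
  have "wf (prel V par)"
    using assms(1) by (intro finite_acyclic_wf finite_prel) (auto simp: forest_def)
  then show ?thesis
    by (induction v rule: wf_induct_rule) (auto intro: step)
qed

lemma root_above:
  assumes "forest V par" "v \<in> V"
  shows "\<exists>y\<in>roots V par. (y, v) \<in> (prel V par)\<^sup>*"
  using assms(2)
proof (induction v rule: forest_up_induct[OF assms(1)])
  case (1 v)
  show ?case
  proof (cases "par v")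
    case None
    then show ?thesis using 1 by (auto simp: roots_def)
  next
    case (Some u)
    then have "u \<in> V" "(u, v) \<in> prel V par" using assms(1) 1 by (auto simp: forest_def prel_def)
    then show ?thesis using 1 by (meson rtrancl.rtrancl_into_rtrancl)
  qed
qed

lemma ochain_nth_kids: "ochain V par xs \<Longrightarrow> Suc i < length xs \<Longrightarrow> kids V par (xs ! i) = {xs ! Suc i}"
  by (simp add: ochain_def)

lemma dchain_nth: "dchain V par xs \<Longrightarrow> Suc i < length xs \<Longrightarrow> par (xs ! Suc i) = Some (xs ! i)"
  by (simp add: dchain_def)

lemma dchain_V: "dchain V par xs \<Longrightarrow> i < length xs \<Longrightarrow> xs ! i \<in> V"
  by (auto simp: dchain_def)

lemma dchain_rtrancl: "dchain V par xs \<Longrightarrow> i \<le> j \<Longrightarrow> j < length xs \<Longrightarrow> (xs ! i, xs ! j) \<in> (prel V par)\<^sup>*"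
proof (induction j)
  case (Suc j)
  show ?case
  proof (cases "i = Suc j")
    case False
    then have "(xs ! i, xs ! j) \<in> (prel V par)\<^sup>*" using Suc by simp
    moreover have "(xs ! j, xs ! Suc j) \<in> prel V par"
      using Suc.prems by (simp add: prel_def dchain_nth dchain_V)
    ultimately show ?thesis by (rule rtrancl.rtrancl_into_rtrancl)
  qed simp
qed simp

lemma dchain_hd_last: "dchain V par xs \<Longrightarrow> (hd xs, last xs) \<in> (prel V par)\<^sup>*"
  using dchain_rtrancl[of V par xs 0 "length xs - 1"]
  by (simp add: hd_conv_nth last_conv_nth dchain_def)

lemma dchain_take: "dchain V par xs \<Longrightarrow> 0 < h \<Longrightarrow> h \<le> length xs \<Longrightarrow>
  dchain V par (take h xs) \<and> hd (take h xs) = hd xs \<and> length (take h xs) = h"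
  by (auto simp: dchain_def dest: in_set_takeD)

lemma dchain_append:
  "dchain V par xs \<Longrightarrow> dchain V par ys \<Longrightarrow> par (hd ys) = Some (last xs) \<Longrightarrow> dchain V par (xs @ ys)"
proof (induction xs)
  case (Cons x xs)
  then show ?case by (cases xs) (auto simp: dchain_Cons)
qed (simp add: dchain_def)

lemma dchain_distinct:
  assumes "forest V par" "dchain V par xs"
  shows "distinct xs"
proof -
  have "xs ! i \<noteq> xs ! j" if ij: "i < j" "j < length xs" for i j
  proof -
    have "(xs ! i, xs ! Suc i) \<in> prel V par"
      using assms(2) ij by (simp add: prel_def dchain_nth dchain_V)
    moreover have "(xs ! Suc i, xs ! j) \<in> (prel V par)\<^sup>*"
      using dchain_rtrancl[OF assms(2), of "Suc i" j] ij by simp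
    ultimately have "(xs ! i, xs ! j) \<in> (prel V par)\<^sup>+" by (rule rtrancl_into_trancl2)
    then show ?thesis using forest_irrefl[OF assms(1)] by metis
  qed
  then show ?thesis unfolding distinct_conv_nth by (metis nat_neq_iff)
qed

lemma dchain_length_le: "forest V par \<Longrightarrow> dchain V par xs \<Longrightarrow> length xs \<le> card V"
  using dchain_distinct[of V par xs] distinct_card[of xs] card_mono[of V "set xs"]
  by (simp add: dchain_def forest_def)

text \<open>Parents are unique, so from a common vertex both chains climb through the same vertices
  and reach their roots simultaneously.\<close>

lemma dchain_roots_meet:
  assumes "dchain V par xs" "dchain V par ys" "par (hd xs) = None" "par (hd ys) = None"
    and "i < length xs" "j < length ys" "xs ! i = ys ! j"
  shows "i = j \<and> hd xs = hd ys"
  using assms(5-)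
proof (induction i arbitrary: j)
  case 0
  have "xs \<noteq> []" "ys \<noteq> []" using assms(1,2) by (auto simp: dchain_def)
  then have *: "par (ys ! j) = None" "hd xs = ys ! j" using 0 assms(3) by (auto simp: hd_conv_nth)
  then have "j = 0" using 0 dchain_nth[OF assms(2)] by (cases j) auto
  then show ?case using * \<open>ys \<noteq> []\<close> by (simp add: hd_conv_nth)
next
  case (Suc i)
  have p: "par (xs ! Suc i) = Some (xs ! i)" using Suc.prems(1) dchain_nth[OF assms(1), of i] by blast
  have "ys \<noteq> []" using assms(2) by (auto simp: dchain_def)
  then obtain k where k: "j = Suc k" using p Suc.prems assms(4) by (cases j) (auto simp: hd_conv_nth)
  then have "par (ys ! j) = Some (ys ! k)" using Suc.prems dchain_nth[OF assms(2)] by simp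
  then have "xs ! i = ys ! k" using p Suc.prems(3) by simp
  then show ?case using Suc.IH[of k] Suc.prems k by simp
qed

lemma ochain_down:
  assumes "forest V par" "v \<in> V"
  shows "\<exists>xs. ochain V par xs \<and> hd xs = v \<and> (kids V par (last xs) = {} \<or> 2 \<le> card (kids V par (last xs)))"
  using assms(2)
proof (induction v rule: forest_down_induct[OF assms(1)])
  case (1 v)
  consider "kids V par v = {} \<or> 2 \<le> card (kids V par v)" | "card (kids V par v) = 1"
    using finite_kids[OF assms(1), of v] by (metis One_nat_def Suc_1 card_0_eq le_0_eq not_less_eq_eq le_antisym)
  then show ?case
  proof cases
    case 1
    then show ?thesis using \<open>v \<in> V\<close> by (intro exI[of _ "[v]"]) (simp add: ochain_def)
  next
    case 2
    then obtain c where c: "kids V par v = {c}" by (auto simp: card_1_singleton_iff)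
    then have "(v, c) \<in> (prel V par)\<^sup>+" "c \<in> V" using prel_kids[of v c V par] kids_V[of c V par v] by auto
    from "1.IH"[OF this] obtain xs where xs: "ochain V par xs" "hd xs = c"
      "kids V par (last xs) = {} \<or> 2 \<le> card (kids V par (last xs))" by blast
    then have "xs \<noteq> []" by (auto simp: ochain_def)
    then show ?thesis using xs c \<open>v \<in> V\<close> by (intro exI[of _ "v # xs"]) (auto simp: ochain_Cons)
  qed
qed

lemma ochain_below:
  assumes "ochain V par xs" "(hd xs, b) \<in> (prel V par)\<^sup>*"
  shows "b \<in> set xs \<or> (last xs, b) \<in> (prel V par)\<^sup>*"
  using assms(2)
proof (induction rule: rtrancl_induct)
  case base
  then show ?case using assms(1) by (simp add: ochain_def)
next
  case (step u v)
  from step(3) show ?case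
  proof
    assume "u \<in> set xs"
    then obtain i where i: "i < length xs" "u = xs ! i" by (auto simp: in_set_conv_nth)
    show ?thesis
    proof (cases "Suc i < length xs")
      case True
      then have "v = xs ! Suc i" using ochain_nth_kids[OF assms(1) True] step(2) i by (auto simp: prel_kids)
      then show ?thesis using True by simp
    next
      case False
      then have "i = length xs - 1" "xs \<noteq> []" using i by auto
      then have "u = last xs" using i by (simp add: last_conv_nth)
      then show ?thesis using step(2) by blast
    qed
  next
    assume "(last xs, u) \<in> (prel V par)\<^sup>*"
    then show ?thesis using step(2) by (meson rtrancl.rtrancl_into_rtrancl)
  qed
qed

definition leg :: "'a set \<Rightarrow> ('a \<Rightarrow> 'a option) \<Rightarrow> 'a list \<Rightarrow> bool" where
  "leg V par cs \<longleftrightarrow> ochain V par cs \<and> kids V par (last cs) = {}"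

lemma leg_no_branch:
  assumes "leg V par cs" "(hd cs, b) \<in> (prel V par)\<^sup>*"
  shows "card (kids V par b) \<le> 1"
proof -
  have cs: "ochain V par cs" "kids V par (last cs) = {}" using assms(1) by (auto simp: leg_def)
  have "b \<in> set cs"
  proof (rule ccontr)
    assume "b \<notin> set cs"
    then have "(last cs, b) \<in> (prel V par)\<^sup>*" "b \<noteq> last cs"
      using ochain_below[OF cs(1) assms(2)] cs(1) by (auto simp: ochain_def)
    then show False using cs(2) by (auto elim: converse_rtranclE simp: prel_kids)
  qed
  then obtain i where i: "i < length cs" "b = cs ! i" by (auto simp: in_set_conv_nth)
  show ?thesis
  proof (cases "Suc i < length cs")
    case True
    then show ?thesis using ochain_nth_kids[OF cs(1) True] i by simp
  next
    case False
    then have "i = length cs - 1" "cs \<noteq> []" using i by auto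
    then show ?thesis using cs(2) i by (simp add: last_conv_nth)
  qed
qed

text \<open>Only children are followed down from \<open>s\<close> to a leaf or a branching. This
  part has fewer than \<open>h\<close> vertices, as its beginning would otherwise be a forbidden
  chain. A leaf makes it the desired leg. At a branching the argument recurs, since a chain of
  length \<open>h\<close> below could be prolonged upwards to start at \<open>s\<close>.\<close>

lemma short_leg_below_branch:
  assumes "forest V par" "s \<in> kids V par b" "2 \<le> card (kids V par b)" "0 < h"
    and "\<nexists>xs. dchain V par xs \<and> hd xs = s \<and> length xs = h"
  shows "\<exists>b' cs. 2 \<le> card (kids V par b') \<and> hd cs \<in> kids V par b' \<and> leg V par cs \<and> length cs < h"
  using assms(2,3,5)
proof (induction s arbitrary: b rule: forest_down_induct[OF assms(1)])
  case (1 v)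
  have "v \<in> V" using 1 by (auto intro: kids_V)
  then obtain xs where xs: "ochain V par xs" "hd xs = v"
    "kids V par (last xs) = {} \<or> 2 \<le> card (kids V par (last xs))"
    using ochain_down[OF assms(1)] by blast
  note d = ochain_dchain[OF xs(1)]
  have len: "length xs < h"
  proof (rule ccontr)
    assume "\<not> ?thesis"
    then show False using dchain_take[OF d assms(4)] "1.prems" xs(2) by fastforce
  qed
  from xs(3) show ?case
  proof
    assume "kids V par (last xs) = {}"
    then show ?thesis using len xs 1 by (auto simp: leg_def)
  next
    assume br: "2 \<le> card (kids V par (last xs))"
    then obtain w where w: "w \<in> kids V par (last xs)" by fastforce
    have vw: "(v, w) \<in> (prel V par)\<^sup>+"
      using dchain_hd_last[OF d] w xs(2) by (auto simp: prel_kids intro: rtrancl_into_trancl1)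
    have "\<nexists>ys. dchain V par ys \<and> hd ys = w \<and> length ys = h"
    proof
      assume "\<exists>ys. dchain V par ys \<and> hd ys = w \<and> length ys = h"
      then obtain ys where ys: "dchain V par ys" "hd ys = w" "length ys = h" by blast
      have "dchain V par (xs @ ys)"
        using w ys by (intro dchain_append d) (auto simp: kids_def)
      then have "dchain V par (take h (xs @ ys)) \<and> hd (take h (xs @ ys)) = v \<and> length (take h (xs @ ys)) = h"
        using dchain_take[of V par "xs @ ys" h] assms(4) ys(3) xs by (simp add: ochain_def)
      then show False using "1.prems" by blast
    qed
    then show ?thesis using "1.IH"[OF vw w br] by blast
  qed
qed

text \<open>The common root of the tree is moved to the lower end of its edge \<open>b\<close>, which leaves the line graph unchanged.\<close>

definition reroot :: "'a set \<Rightarrow> ('a \<Rightarrow> 'a option) \<Rightarrow> 'a \<Rightarrow> 'a \<Rightarrow> 'a option" where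
  "reroot V par b = (\<lambda>x. if par x = Some b then None else if par x = None \<and> x \<noteq> b then Some b else par x)"

text \<open>Two roots make the common root an inner node of the tree, so that
  \<open>internal\<close> counts exactly the inner edges. A sole root would be the edge at a leaf
  even if it had children.\<close>

definition forests :: "'a set \<Rightarrow> nat \<Rightarrow> ('a \<Rightarrow> 'a option) set" where
  "forests V r = {par. forest V par \<and> card (internal V par) = r \<and> 2 \<le> card (roots V par)}"

lemma forestsD:
  assumes "par \<in> forests V r"
  shows "forest V par" "card (internal V par) = r" "2 \<le> card (roots V par)" "finite V"
  using assms by (auto simp: forests_def forest_def)

lemma finite_roots: "forest V par \<Longrightarrow> finite (roots V par)"
  by (simp add: forest_def roots_def)

context
  fixes V :: "'a set" and par b
  assumes F: "forest V par" and b: "b \<in> roots V par"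
begin

lemma root_b: "b \<in> V" "par b = None" "par b \<noteq> Some b"
  using b by (auto simp: roots_def)

lemma reroot_kids: "kids V (reroot V par b) u = (if u = b then roots V par - {b} else kids V par u)"
  using root_b by (auto simp: kids_def reroot_def roots_def)

lemma reroot_roots: "roots V (reroot V par b) = insert b (kids V par b)"
  using root_b by (auto simp: kids_def reroot_def roots_def)

lemma reroot_sgraph: "sgraph V (reroot V par b) = sgraph V par"
proof -
  let ?q = "reroot V par b"
  have "(?q x = ?q y \<or> ?q x = Some y \<or> ?q y = Some x) \<longleftrightarrow> (par x = par y \<or> par x = Some y \<or> par y = Some x)"
    if "x \<noteq> y" for x y
  proof -
    have main: "(?q x = ?q y \<or> ?q x = Some y \<or> ?q y = Some x) \<longleftrightarrow> (par x = par y \<or> par x = Some y \<or> par y = Some x)"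
      if xy: "x \<noteq> y" "y \<noteq> b" for x y
    proof (cases "x = b")
      case True
      then show ?thesis using root_b(2) xy
        by (cases "par y"; cases "par y = Some b") (simp_all add: reroot_def)
    next
      case False
      then show ?thesis using xy
        by (cases "par x"; cases "par x = Some b"; cases "par y"; cases "par y = Some b") (simp_all add: reroot_def)
    qed
    show ?thesis
    proof (cases "y = b")
      case True
      then show ?thesis using main[of y x] that by metis
    qed (use main that in blast)
  qed
  then show ?thesis unfolding sgraph_def by auto
qed

lemma reroot_forest: "forest V (reroot V par b)"
proof -
  let ?q = "{(u, v) \<in> prel V par. u \<noteq> b}" and ?n = "{b} \<times> (roots V par - {b})"
  have eq: "prel V (reroot V par b) = ?q \<union> ?n"
    using root_b by (auto simp: prel_def reroot_def roots_def)
  have nob: "(x, b) \<in> (?q \<union> ?n)\<^sup>+ \<Longrightarrow> False" for x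
    by (erule tranclE) (use root_b in \<open>auto simp: prel_def\<close>)
  \<comment> \<open>No arc enters \<open>b\<close> any more, so a path that starts elsewhere never
    visits \<open>b\<close> and uses old arcs only.\<close>
  have q: "(x, y) \<in> ?q\<^sup>+" if "(x, y) \<in> (?q \<union> ?n)\<^sup>+" "x \<noteq> b" for x y
    using that
  proof (induction rule: trancl_induct)
    case (step y z)
    have "y \<noteq> b" using nob[of x] step by blast
    then have "(y, z) \<in> ?q" using step by auto
    then show ?case using step by (meson trancl.trancl_into_trancl)
  qed auto
  have "(x, x) \<notin> (?q \<union> ?n)\<^sup>+" for x
  proof
    assume x: "(x, x) \<in> (?q \<union> ?n)\<^sup>+"
    then have "x \<noteq> b" using nob by blast
    then have "(x, x) \<in> ?q\<^sup>+" using q x by blast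
    then have "(x, x) \<in> (prel V par)\<^sup>+" by (rule trancl_mono) auto
    then show False using forest_irrefl[OF F] by blast
  qed
  then have "acyclic (prel V (reroot V par b))" unfolding eq acyclic_def by blast
  then show ?thesis using F root_b by (auto simp: forest_def reroot_def)
qed

text \<open>The other roots become children of \<open>b\<close>, which thus stays internal, and its
  former children join it as roots. Hence \<open>b\<close> must have a child, for else it would be
  the only root.\<close>

lemma reroot_forests:
  assumes "par \<in> forests V r" "kids V par b \<noteq> {}"
  shows "reroot V par b \<in> forests V r"
proof -
  have "roots V par - {b} \<noteq> {}"
  proof
    assume "roots V par - {b} = {}"
    then have "roots V par \<subseteq> {b}" by blast
    then have "card (roots V par) \<le> 1" using card_mono[of "{b}"] by auto
    then show False using forestsD(3)[OF assms(1)] by simp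
  qed
  then have "internal V (reroot V par b) = internal V par"
    using assms(2) by (auto simp: internal_def reroot_kids)
  moreover have "2 \<le> card (insert b (kids V par b))"
  proof -
    have "b \<notin> kids V par b" using root_b by (simp add: kids_def)
    moreover have "0 < card (kids V par b)" using assms(2) finite_kids[OF F] by (simp add: card_gt_0_iff)
    ultimately show ?thesis using finite_kids[OF F] by simp
  qed
  ultimately show ?thesis using assms(1) reroot_forest by (simp add: forests_def reroot_roots)
qed

end

lemma leg_reroot:
  assumes "forest V par" "y \<in> roots V par" "leg V par cs" "y \<notin> set cs"
  shows "leg V (reroot V par y) cs"
  using assms(3,4) nth_mem[of _ cs] unfolding leg_def ochain_def reroot_kids[OF assms(1,2)]
  by (metis Suc_lessD last_in_set)

lemma leg_not_root:
  assumes "forest V par" "leg V par cs" "hd cs \<in> kids V par b" "y \<in> roots V par"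
  shows "y \<notin> set cs"
proof
  assume "y \<in> set cs"
  then obtain i where i: "i < length cs" "y = cs ! i" by (auto simp: in_set_conv_nth)
  have d: "dchain V par cs" using assms(2) by (simp add: leg_def ochain_dchain)
  then have "par (cs ! i) \<noteq> None"
    using i assms(3) dchain_nth[OF d] by (cases i) (auto simp: kids_def hd_conv_nth dchain_def)
  then show False using i assms(4) by (simp add: roots_def)
qed

text \<open>Each rerooting moves the common root by one edge, so it is repeated down the path from
  \<open>y\<close> to \<open>b\<close>. After the last one, at \<open>b\<close> itself, the roots
  are \<open>b\<close> and its children: at least three, among them the start of the leg.\<close>

lemma reroot_to_leg:
  assumes "par \<in> forests V r" "y \<in> roots V par" "(y, b) \<in> prel V par ^^ k"
    and "2 \<le> card (kids V par b)" "hd cs \<in> kids V par b" "leg V par cs"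
  shows "\<exists>par'. par' \<in> forests V r \<and> sgraph V par' = sgraph V par \<and> 3 \<le> card (roots V par') \<and>
    hd cs \<in> roots V par' \<and> leg V par' cs"
  using assms
proof (induction k arbitrary: par y)
  case 0
  note F = forestsD(1)[OF 0(1)]
  have y: "y = b" using 0 by simp
  have "y \<notin> set cs" by (rule leg_not_root[OF F 0(6,5,2)])
  then have "leg V (reroot V par b) cs" using leg_reroot[OF F 0(2) 0(6)] y by simp
  moreover have "kids V par b \<noteq> {}" using 0 by auto
  then have "reroot V par b \<in> forests V r" using reroot_forests[OF F] 0 y by simp
  moreover have "b \<notin> kids V par b" using 0(2) y by (simp add: kids_def roots_def)
  then have "3 \<le> card (insert b (kids V par b))" using 0(4) finite_kids[OF F, of b] by simp
  ultimately show ?case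
    using reroot_roots[OF F] reroot_sgraph[OF F] 0(2,5) y by (intro exI[of _ "reroot V par b"]) simp
next
  case (Suc k)
  note F = forestsD(1)[OF Suc.prems(1)]
  from Suc.prems(3) obtain c where c: "(y, c) \<in> prel V par" "(c, b) \<in> prel V par ^^ k"
    by (meson relpow_Suc_D2)
  let ?p = "reroot V par y"
  have keep: "(u, v) \<in> prel V ?p" if "(u, v) \<in> prel V par" "u \<noteq> y" for u v
    using that by (auto simp: prel_kids reroot_kids[OF F Suc.prems(2)])
  have noty: "v \<noteq> y" if "(u, v) \<in> prel V par" for u v
    using that Suc.prems(2) by (auto simp: prel_def roots_def)
  \<comment> \<open>Rerooting changes the children of \<open>y\<close> alone, and the rest of the
    path never returns to \<open>y\<close>.\<close>
  have path: "(c, b) \<in> prel V ?p ^^ k \<and> b \<noteq> y"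
    using c(2)
  proof (induction k arbitrary: b)
    case 0
    then show ?case using noty[OF c(1)] by simp
  next
    case (Suc k)
    then obtain u where u: "(c, u) \<in> prel V par ^^ k" "(u, b) \<in> prel V par" by auto
    then have "(c, u) \<in> prel V ?p ^^ k \<and> u \<noteq> y" using Suc.IH by blast
    then show ?case using keep[OF u(2)] noty[OF u(2)] by auto
  qed
  have yk: "kids V par y \<noteq> {}" using c(1) by (auto simp: prel_kids)
  have "c \<in> roots V ?p" using c(1) by (simp add: reroot_roots[OF F Suc.prems(2)] prel_kids)
  moreover have "y \<notin> set cs" by (rule leg_not_root[OF F Suc.prems(6,5,2)])
  then have "leg V ?p cs" by (rule leg_reroot[OF F Suc.prems(2,6)])
  moreover have "kids V ?p b = kids V par b" using path by (simp add: reroot_kids[OF F Suc.prems(2)])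
  moreover have "?p \<in> forests V r" by (rule reroot_forests[OF F Suc.prems(2,1) yk])
  ultimately show ?case
    using Suc.IH[of ?p c] path Suc.prems reroot_sgraph[OF F Suc.prems(2)] by simp
qed

text \<open>
  All roots except for those of the leg \<open>cs\<close> and of the chain \<open>xs\<close> are moved below the branching
  \<open>last xs\<close>. Up to additional edges, this is the reflection at the middle of the path that runs up
  the leg \<open>cs\<close> and down the chain \<open>xs @ ss\<close>.
\<close>

lemma attach_siblings_less:
  assumes par: "par \<in> forests V r" and three: "3 \<le> card (roots V par)"
    and cs: "leg V par cs" "hd cs \<in> roots V par"
    and xs: "ochain V par xs" "hd xs \<in> roots V par" "hd xs \<noteq> hd cs"
    and br: "2 \<le> card (kids V par (last xs))"
    and ss: "dchain V par ss" "hd ss \<in> kids V par (last xs)" "length ss = length cs"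
  shows "\<exists>par'\<in>forests V r. slee (sgraph V par) < slee (sgraph V par')"
proof -
  note F = forestsD(1)[OF par] and V = forestsD(4)[OF par]
  define S where "S = roots V par - {hd cs, hd xs}"
  define h where "h = length cs"
  define d where "d = length xs"
  define N where "N = 2 * h + d - 1"
  \<comment> \<open>\<open>z 0\<close> is the leaf of the leg, \<open>z (h - 1)\<close> and
    \<open>z h\<close> are the roots \<open>hd cs\<close> and \<open>hd xs\<close>,
    \<open>z (h + d - 1)\<close> is the branching \<open>last xs\<close> and
    \<open>z (h + d)\<close> its child \<open>hd ss\<close>. As \<open>ss\<close> is as long as the
    leg, \<open>hd cs\<close> and \<open>hd ss\<close> are mirror images.\<close>
  define z where "z = (\<lambda>i. (rev cs @ xs @ ss) ! i)"
  \<comment> \<open>Both roots on the path are adjacent to all of \<open>S\<close>. For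
    \<open>d = 1\<close> the root \<open>hd xs\<close> is the branching itself and the midpoint of
    the path; the condition \<open>2 * i < N\<close> then drops it, and its edges to
    \<open>S\<close> stay.\<close>
  define I where "I = {i. (i = h - 1 \<or> i = h) \<and> 2 * i < N}"
  define FF where "FF = z ` I \<times> S \<union> S \<times> z ` I"
  define FF' where "FF' = (\<lambda>i. z (N - i)) ` I \<times> S \<union> S \<times> (\<lambda>i. z (N - i)) ` I"
  define E where "E = parcs (sgraph V par) - FF"
  define par' where "par' = (\<lambda>x. if x \<in> S then Some (last xs) else par x)"
  have csd: "dchain V par cs" and cso: "ochain V par cs" and csl: "kids V par (last cs) = {}"
    using cs(1) by (auto simp: leg_def ochain_dchain)
  have xsd: "dchain V par xs" using xs(1) by (rule ochain_dchain)
  have hd0: "0 < h" "0 < d" "cs \<noteq> []" "xs \<noteq> []" using csd xsd by (auto simp: dchain_def h_def d_def)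
  have ssh: "length ss = h" "ss \<noteq> []" using ss hd0 by (auto simp: h_def)
  have r0: "par (hd cs) = None" "par (hd xs) = None" "hd cs \<in> V" "hd xs \<in> V"
    using cs(2) xs(2) by (auto simp: roots_def)
  have wd: "dchain V par (xs @ ss)"
    using ss by (intro dchain_append xsd) (auto simp: kids_def)
  have zc: "z i = cs ! (h - 1 - i)" if "i < h" for i
    using that by (simp add: z_def h_def nth_append rev_nth)
  have zw: "z i = (xs @ ss) ! (i - h)" if "h \<le> i" for i
    using that by (simp add: z_def h_def nth_append)
  have zx: "z i = xs ! (i - h)" if "h \<le> i" "i < h + d" for i
    using that zw by (simp add: d_def nth_append less_diff_conv2)
  have zs: "z i = ss ! (i - h - d)" if "h + d \<le> i" for i
  proof -
    have "\<not> i - h < length xs" "h \<le> i" using that unfolding d_def by linarith+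
    then show ?thesis using zw[of i] by (simp add: d_def nth_append)
  qed
  have N: "Suc N = 2 * h + d" "length (rev cs @ xs @ ss) = Suc N"
    using hd0 ssh by (auto simp: N_def h_def d_def)
  have dist: "distinct (rev cs @ xs @ ss)"
  proof -
    have "set cs \<inter> set (xs @ ss) = {}"
    proof (rule ccontr)
      assume "\<not> ?thesis"
      then obtain u where "u \<in> set cs" "u \<in> set (xs @ ss)" by blast
      then obtain i j where "i < length cs" "cs ! i = u" "j < length (xs @ ss)" "(xs @ ss) ! j = u"
        unfolding in_set_conv_nth by blast
      then have "hd cs = hd (xs @ ss)"
        using dchain_roots_meet[OF csd wd, of i j] r0 hd0 by simp
      then show False using xs(3) hd0 by simp
    qed
    then show ?thesis using dchain_distinct[OF F csd] dchain_distinct[OF F wd] by auto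
  qed
  have inj: "inj_on z {..N}"
    unfolding z_def inj_on_def using nth_eq_iff_index_eq[OF dist] N(2) by (simp add: less_Suc_eq_le)
  have zimg: "z ` {..N} = set cs \<union> set xs \<union> set ss"
  proof -
    have "{..N} = {..<length (rev cs @ xs @ ss)}" unfolding N(2) by auto
    then have "z ` {..N} = set (rev cs @ xs @ ss)" unfolding z_def set_conv_nth by blast
    then show ?thesis by auto
  qed
  have zV: "z ` {..N} \<subseteq> V" unfolding zimg using csd wd by (auto simp: dchain_def)
  have rootz: "z i = hd cs \<or> z i = hd xs" if "i \<le> N" "par (z i) = None" for i
  proof (cases "i < h")
    case True
    define j where "j = h - 1 - i"
    have j: "j < length cs" "z i = cs ! j" using True zc by (auto simp: j_def h_def)
    show ?thesis
    proof (cases j)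
      case 0
      then show ?thesis using j hd0(3) by (simp add: hd_conv_nth)
    next
      case (Suc k)
      then show ?thesis using j dchain_nth[OF csd, of k] that(2) by simp
    qed
  next
    case False
    define j where "j = i - h"
    have j: "j < length (xs @ ss)" "z i = (xs @ ss) ! j"
      using False that(1) N(1) ssh zw by (auto simp: j_def d_def)
    show ?thesis
    proof (cases j)
      case 0
      then show ?thesis using j hd0(4) by (simp add: hd_conv_nth nth_append)
    next
      case (Suc k)
      then show ?thesis using j dchain_nth[OF wd, of k] that(2) by auto
    qed
  qed
  have SV: "S \<subseteq> V" and Sr: "\<And>s. s \<in> S \<Longrightarrow> par s = None"
    by (auto simp: S_def roots_def)
  have Sz: "S \<inter> z ` {..N} = {}" using rootz Sr by (auto simp: S_def)
  have b1: "last xs = z (h + d - 1)" 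
  proof -
    have "h \<le> h + d - 1" "h + d - 1 < h + d" "h + d - 1 - h = d - 1" using hd0 by linarith+
    then show ?thesis using zx[of "h + d - 1"] hd0 by (simp add: last_conv_nth d_def)
  qed
  have b1V: "last xs \<in> V" "last xs \<notin> S"
  proof -
    have "h + d - 1 \<le> N" using hd0 unfolding N_def by linarith
    then show "last xs \<in> V" "last xs \<notin> S" unfolding b1 using zV Sz by blast+
  qed
  have s0: "hd ss = z (h + d)" using zs[of "h + d"] ssh by (simp add: hd_conv_nth)
  have x0: "hd cs = z (h - 1)" using zc[of "h - 1"] hd0 by (simp add: hd_conv_nth)
  have y0: "hd xs = z h" using zx[of h] hd0 by (simp add: hd_conv_nth)
  have zI: "z ` I \<subseteq> {hd cs, hd xs}" "hd cs \<in> z ` I" "2 \<le> d \<Longrightarrow> hd xs \<in> z ` I"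
    using hd0 by (auto simp: I_def x0 y0 N_def)
  have zI': "(\<lambda>i. z (N - i)) ` I \<subseteq> {last xs, hd ss}"
  proof -
    have "N - (h - 1) = h + d" "N - h = h + d - 1" using hd0 by (auto simp: N_def)
    then show ?thesis unfolding b1 s0 I_def by auto
  qed
  have hss: "par (hd ss) = Some (last xs)" "hd ss \<in> V" "hd ss \<notin> S"
    using ss(2) Sr by (auto simp: kids_def)
  have FFsub: "FF \<subseteq> parcs (sgraph V par)"
  proof -
    have "s \<noteq> hd cs" "s \<noteq> hd xs" if "s \<in> S" for s using that by (auto simp: S_def)
    then have "(u, s) \<in> parcs (sgraph V par)" "(s, u) \<in> parcs (sgraph V par)" if "u \<in> {hd cs, hd xs}" "s \<in> S" for u s
      using that r0 SV Sr[OF that(2)] by auto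
    then show ?thesis using zI(1) unfolding FF_def by blast
  qed
  have EF: "E \<union> FF = parcs (sgraph V par)" using FFsub by (auto simp: E_def)
  have symE: "sym E" by (auto simp: E_def FF_def sym_def)
  have inE: "(u, v) \<in> E" if "u \<in> V" "v \<in> V" "u \<notin> S" "v \<notin> S" "u \<noteq> v" "par u = par v \<or> par u = Some v \<or> par v = Some u" for u v
    using that by (auto simp: E_def FF_def)
  have refl: "graph_reflection V (z ` {i. 2 * i < N}) (path_flip z N) E FF FF'"
    unfolding FF_def FF'_def
  proof (rule path_reflection)
    show "finite V" "E \<subseteq> V \<times> V" "sym E" "inj_on z {..N}" "z ` {..N} \<subseteq> V" "S \<subseteq> V" "S \<inter> z ` {..N} = {}"
      using V symE inj zV SV Sz by (auto simp: E_def)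
    show "2 * i < N" if "i \<in> I" for i using that by (simp add: I_def)
    show "(z i, z (Suc i)) \<in> E" if "i < N" for i
    proof (rule inE)
      show "z i \<in> V" "z (Suc i) \<in> V" "z i \<notin> S" "z (Suc i) \<notin> S" using that zV Sz by auto
      show "z i \<noteq> z (Suc i)" using inj_onD[OF inj, of i "Suc i"] that by auto
      consider "Suc i < h" | "Suc i = h" | "h \<le> i" by linarith
      then show "par (z i) = par (z (Suc i)) \<or> par (z i) = Some (z (Suc i)) \<or> par (z (Suc i)) = Some (z i)"
      proof cases
        case 1
        then have "Suc (h - 1 - Suc i) = h - 1 - i" by simp
        then have "par (cs ! (h - 1 - i)) = Some (cs ! (h - 1 - Suc i))"
          using dchain_nth[OF csd, of "h - 1 - Suc i"] 1 by (simp add: h_def)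
        then show ?thesis using 1 zc[of i] zc[of "Suc i"] by simp
      next
        case 2
        then have "i = h - 1" by simp
        then show ?thesis using 2 x0 y0 r0 by simp
      next
        case 3
        then have "par ((xs @ ss) ! Suc (i - h)) = Some ((xs @ ss) ! (i - h))"
          using that N ssh by (intro dchain_nth[OF wd]) (auto simp: d_def)
        then show ?thesis using 3 zw[of i] zw[of "Suc i"] by (simp add: Suc_diff_le)
      qed
    qed
    \<comment> \<open>A vertex of the first half is an only child, or one of the two roots, whose
      edges to \<open>S\<close> were removed with \<open>FF\<close>. Downwards it has at most one
      child, its neighbour on the path.\<close>
    show "x = z (Suc i) \<or> 0 < i \<and> x = z (i - 1)" if i: "2 * i < N" and x: "(z i, x) \<in> E" for i x
    proof -
      from x have xV: "x \<in> V" "x \<noteq> z i" and rel: "par (z i) = par x \<or> x \<in> kids V par (z i) \<or> par (z i) = Some x"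
        and nFF: "(z i, x) \<notin> FF" by (auto simp: E_def kids_def)
      have nS: "x \<notin> S" if "i \<in> I" using that nFF by (auto simp: FF_def)
      have sib: "x \<in> kids V par u" if "par (z i) = Some u" "par (z i) = par x" for u
        using that xV by (simp add: kids_def)
      show ?thesis
      proof (cases "i < h")
        case True
        define j where "j = h - 1 - i"
        have j: "j < length cs" "z i = cs ! j" using True zc by (auto simp: j_def h_def)
        have kid: "x \<in> kids V par (z i) \<Longrightarrow> 0 < i \<and> x = z (i - 1)"
        proof -
          assume k: "x \<in> kids V par (z i)"
          have "i \<noteq> 0"
          proof
            assume "i = 0"
            then have "z i = last cs" using j hd0 by (simp add: j_def last_conv_nth h_def)
            then show False using k csl by simp
          qed
          then have "Suc j < length cs" using True by (simp add: j_def h_def)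
          then have "x = cs ! Suc j" using ochain_nth_kids[OF cso] j k by auto
          moreover have "h - 1 - (i - 1) = Suc j" using \<open>i \<noteq> 0\<close> True by (simp add: j_def)
          ultimately show ?thesis using zc[of "i - 1"] \<open>i \<noteq> 0\<close> True by simp
        qed
        show ?thesis
        proof (cases "j = 0")
          case True
          then have ih: "i = h - 1" using \<open>i < h\<close> by (simp add: j_def)
          then have "i \<in> I" using i by (simp add: I_def)
          have p: "par (z i) = None" using ih x0 r0 by simp
          have "x = hd xs" if "par x = None"
            using that nS[OF \<open>i \<in> I\<close>] xV ih x0 by (auto simp: S_def roots_def)
          then show ?thesis using rel kid p y0 ih hd0 by auto
        next
          case False
          then have p: "par (z i) = Some (cs ! (j - 1))" using dchain_nth[OF csd, of "j - 1"] j by simp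
          have "kids V par (cs ! (j - 1)) = {z i}" using ochain_nth_kids[OF cso, of "j - 1"] j False by simp
          then have "par (z i) \<noteq> par x" using sib[OF p] xV by auto
          moreover have "x = z (Suc i)" if "par (z i) = Some x"
          proof -
            have "x = cs ! (j - 1)" using that p by simp
            moreover have "h - 1 - Suc i = j - 1" "Suc i < h" using False by (auto simp: j_def)
            ultimately show ?thesis using zc[of "Suc i"] by simp
          qed
          ultimately show ?thesis using rel kid by blast
        qed
      next
        case False
        define j where "j = i - h"
        have jd: "Suc j < length xs" using i False by (simp add: j_def N_def d_def)
        have zj: "z i = xs ! j" using zx[of i] False jd by (simp add: j_def d_def)
        have zsj: "z (Suc i) = xs ! Suc j" using zx[of "Suc i"] False jd by (simp add: j_def d_def Suc_diff_le)
        have kid: "x \<in> kids V par (z i) \<Longrightarrow> x = z (Suc i)"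
          using ochain_nth_kids[OF xs(1) jd] zj zsj by auto
        show ?thesis
        proof (cases "j = 0")
          case True
          then have ih: "i = h" using False by (simp add: j_def)
          then have "i \<in> I" using i by (simp add: I_def)
          have p: "par (z i) = None" using ih y0 r0 by simp
          have "x = hd cs" if "par x = None"
            using that nS[OF \<open>i \<in> I\<close>] xV ih y0 by (auto simp: S_def roots_def)
          then show ?thesis using rel kid p x0 ih hd0 by auto
        next
          case False
          then have p: "par (z i) = Some (xs ! (j - 1))" using dchain_nth[OF xsd, of "j - 1"] jd zj by simp
          have "kids V par (xs ! (j - 1)) = {z i}" using ochain_nth_kids[OF xs(1), of "j - 1"] jd False zj by simp
          then have "par (z i) \<noteq> par x" using sib[OF p] xV by auto
          moreover have "x = z (i - 1)" if "par (z i) = Some x"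
          proof -
            have "x = xs ! (j - 1)" using that p by simp
            then show ?thesis using zx[of "i - 1"] False jd by (simp add: j_def d_def)
          qed
          moreover have "0 < i" using False by (simp add: j_def)
          ultimately show ?thesis using rel kid by blast
        qed
      qed
    qed
    show "(z (N - i), s) \<notin> E" if i: "i \<in> I" and s: "s \<in> S" for i s
    proof
      assume "(z (N - i), s) \<in> E"
      then have rel: "par (z (N - i)) = par s \<or> par (z (N - i)) = Some s \<or> par s = Some (z (N - i))" by (simp add: E_def)
      from i consider "i = h - 1" | "i = h" "2 \<le> d" using hd0 by (auto simp: I_def N_def)
      then show False
      proof cases
        case 1
        then have "N - i = h + d" using hd0 by (simp add: N_def)
        then have "z (N - i) = hd ss" using s0 by simp
        then show False using rel hss Sr[OF s] b1V s by auto
      next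
        case 2
        then have "N - i = h + d - 1" using hd0 by (simp add: N_def)
        then have zl: "z (N - i) = last xs" using b1 by simp
        have "par (last xs) = Some (xs ! (d - 2))"
          using dchain_nth[OF xsd, of "d - 2"] 2 hd0 by (simp add: last_conv_nth d_def numeral_2_eq_2 Suc_diff_Suc)
        moreover have "xs ! (d - 2) \<notin> S"
        proof -
          have "xs ! (d - 2) = z (h + (d - 2))" using zx[of "h + (d - 2)"] 2 by simp
          then show ?thesis using Sz N 2 by auto
        qed
        ultimately show False using rel zl Sr[OF s] s by auto
      qed
    qed
  qed
  interpret R: graph_reflection V "z ` {i. 2 * i < N}" "path_flip z N" E FF FF' by (rule refl)
  have FF'sub: "FF' \<subseteq> {last xs, hd ss} \<times> S \<union> S \<times> {last xs, hd ss}"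
    using zI' unfolding FF'_def by blast
  have pG1: "pair_graph \<lparr>pverts = V, parcs = E \<union> FF'\<rparr>"
  proof (rule pair_graphI[OF V])
    show "E \<union> FF' \<subseteq> V \<times> V" using R.E_V FF'sub SV b1V hss by blast
    show "sym (E \<union> FF')" using symE by (auto simp: sym_def FF'_def)
    show "irrefl (E \<union> FF')" using FF'sub b1V hss by (auto simp: irrefl_def E_def)
  qed
  have le: "slee (sgraph V par) \<le> slee \<lparr>pverts = V, parcs = E \<union> FF'\<rparr>"
    by (rule slee_mono[OF pair_graph_sgraph[OF V] pG1]) (use R.tr_le in \<open>simp add: EF\<close>)
  have pn: "par' x = par x" if "x \<notin> S" for x using that by (simp add: par'_def)
  have ps: "par' x = Some (last xs)" if "x \<in> S" for x using that by (simp add: par'_def)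
  have sub: "E \<union> FF' \<subseteq> parcs (sgraph V par')"
  proof (rule subrelI)
    fix u v assume uv: "(u, v) \<in> E \<union> FF'"
    \<comment> \<open>Such an edge goes to a child of \<open>p\<close>, or to \<open>hd xs\<close>
      in the case \<open>d = 1\<close>, where \<open>hd xs\<close> is the new parent of
      \<open>p\<close>.\<close>
    have key: "(p, q) \<in> parcs (sgraph V par')" if e: "(p, q) \<in> E" and p: "p \<in> S" and q: "q \<notin> S" for p q
    proof -
      from e have pq: "p \<in> V" "q \<in> V" "p \<noteq> q" "par p = par q \<or> par p = Some q \<or> par q = Some p" "(p, q) \<notin> FF"
        by (auto simp: E_def)
      have "par p = None" by (rule Sr[OF p])
      show ?thesis
      proof (cases "par q = None")
        case True
        then have "q \<in> {hd cs, hd xs}" using q pq(2) by (auto simp: S_def roots_def)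
        moreover have "q \<notin> z ` I" using pq(5) p by (auto simp: FF_def)
        ultimately have "q = hd xs" "\<not> 2 \<le> d" using zI by auto
        then have "d = 1" using hd0 by simp
        then have "last xs = hd xs" by (simp add: d_def length_Suc_conv) auto
        then show ?thesis using pq ps[OF p] \<open>q = hd xs\<close> by simp
      next
        case False
        then have "par q = Some p" using pq(4) \<open>par p = None\<close> by auto
        then show ?thesis using pq pn[OF q] by simp
      qed
    qed
    show "(u, v) \<in> parcs (sgraph V par')"
    proof (cases "(u, v) \<in> E")
      case True
      have vu: "(v, u) \<in> E" using True symE by (auto dest: symD)
      from True have uvE: "u \<in> V" "v \<in> V" "u \<noteq> v" "par u = par v \<or> par u = Some v \<or> par v = Some u"
        by (auto simp: E_def)
      show ?thesis
      proof (cases "u \<in> S"; cases "v \<in> S")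
        assume "u \<in> S" "v \<notin> S" then show ?thesis using key[OF True] by simp
      next
        assume "u \<notin> S" "v \<in> S" then show ?thesis using key[OF vu] by auto
      next
        assume "u \<in> S" "v \<in> S" then show ?thesis using uvE ps by simp
      next
        assume "u \<notin> S" "v \<notin> S" then show ?thesis using uvE pn by simp
      qed
    next
      case False
      then have "(u, v) \<in> {last xs, hd ss} \<times> S \<union> S \<times> {last xs, hd ss}" using uv FF'sub by blast
      then show ?thesis using SV b1V hss ps pn by auto
    qed
  qed
  obtain s where s: "s \<in> S"
  proof -
    have "card {hd cs, hd xs} \<le> 2" by (simp add: card_insert_if)
    then have "\<not> roots V par \<subseteq> {hd cs, hd xs}" using three card_mono[of "{hd cs, hd xs}" "roots V par"] by auto
    then show ?thesis using that by (auto simp: S_def)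
  qed
  \<comment> \<open>The branching has a child besides \<open>hd ss\<close>. Its edge to a vertex of
    \<open>S\<close> is not produced by the reflection, so adding it makes the increase
    strict.\<close>
  obtain v where v: "v \<in> kids V par (last xs)" "v \<noteq> hd ss"
  proof -
    have "\<not> kids V par (last xs) \<subseteq> {hd ss}" using br card_mono[of "{hd ss}" "kids V par (last xs)"] by auto
    then show ?thesis using that by blast
  qed
  have vp: "par v = Some (last xs)" "v \<in> V" using v by (auto simp: kids_def)
  have vS: "v \<notin> S" using vp Sr by auto
  have "(s, v) \<in> parcs (sgraph V par')" using s SV vp vS ps[OF s] pn[OF vS] by auto
  moreover have "(s, v) \<notin> E \<union> FF'"
  proof
    assume "(s, v) \<in> E \<union> FF'"
    moreover have "v \<noteq> last xs" using vp F forest_irrefl[OF F, of "last xs"] by (auto simp: prel_def intro: r_into_trancl)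
    ultimately have "(s, v) \<in> E" using FF'sub v vS by auto
    then have "par s = par v \<or> par s = Some v \<or> par v = Some s" by (simp add: E_def)
    then show False using Sr[OF s] vp b1V s by auto
  qed
  ultimately have "E \<union> FF' \<subset> parcs (sgraph V par')" using sub by blast
  then have less: "slee \<lparr>pverts = V, parcs = E \<union> FF'\<rparr> < slee (sgraph V par')"
    by (intro slee_subgraph_less[OF pG1 pair_graph_sgraph[OF V]]) auto
  have "forest V par'"
  proof -
    have eq: "prel V par' = prel V par \<union> {last xs} \<times> S"
      using SV Sr by (auto simp: prel_def par'_def split: if_splits)
    \<comment> \<open>A path is old or passes a new arc from \<open>last xs\<close> into
      \<open>S\<close>. A cycle of the second kind would put a vertex of \<open>S\<close> above
      \<open>last xs\<close>, where only the chain \<open>xs\<close> lies.\<close>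
    have cyc: "(x, y) \<in> (prel V par)\<^sup>+ \<or> (\<exists>s\<in>S. (s, y) \<in> (prel V par)\<^sup>* \<and> (x, last xs) \<in> (prel V par)\<^sup>*)"
      if "(x, y) \<in> (prel V par')\<^sup>+" for x y
      using that
    proof (induction rule: trancl_induct)
      case (base y)
      then show ?case unfolding eq by auto
    next
      case (step y w)
      show ?case
      proof (cases "(y, w) \<in> prel V par")
        case True
        then show ?thesis using step(3) by (meson rtrancl.rtrancl_into_rtrancl trancl.trancl_into_trancl)
      next
        case False
        then have yw: "y = last xs" "w \<in> S" using step(2) unfolding eq by auto
        from step(3) show ?thesis
        proof
          assume "(x, y) \<in> (prel V par)\<^sup>+"
          then show ?thesis using yw by (auto dest: trancl_into_rtrancl)
        next
          assume "\<exists>s\<in>S. (s, y) \<in> (prel V par)\<^sup>* \<and> (x, last xs) \<in> (prel V par)\<^sup>*"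
          then show ?thesis using yw by auto
        qed
      qed
    qed
    have above: "u \<notin> S" if "(u, last xs) \<in> (prel V par)\<^sup>*" for u
    proof
      assume u: "u \<in> S"
      have "u \<in> set xs"
      proof -
        have "\<forall>v\<in>set xs. (u, v) \<in> (prel V par)\<^sup>* \<longrightarrow> u \<in> set xs"
        proof (intro ballI impI)
          fix v assume "v \<in> set xs" "(u, v) \<in> (prel V par)\<^sup>*"
          then obtain i where "i < length xs" "v = xs ! i" by (auto simp: in_set_conv_nth)
          then show "u \<in> set xs" using \<open>(u, v) \<in> (prel V par)\<^sup>*\<close>
          proof (induction i arbitrary: v)
            case 0
            then have "par v = None" using r0 hd0 by (simp add: hd_conv_nth)
            then have "u = v" using 0(3) by (auto elim: rtranclE simp: prel_def)
            then show ?case using 0 by simp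
          next
            case (Suc i)
            from Suc(4) show ?case
            proof (cases rule: rtranclE)
              case base
              then show ?thesis using Suc by simp
            next
              case (step y)
              have "y = xs ! i" using step(2) Suc.prems dchain_nth[OF xsd, of i] by (simp add: prel_def)
              then show ?thesis using Suc step by simp
            qed
          qed
        qed
        then show ?thesis using that hd0 by auto
      qed
      then show False using Sz u zimg by blast
    qed
    have "(x, x) \<notin> (prel V par')\<^sup>+" for x
    proof
      assume "(x, x) \<in> (prel V par')\<^sup>+"
      from cyc[OF this] show False
      proof
        assume "(x, x) \<in> (prel V par)\<^sup>+"
        then show False using forest_irrefl[OF F] by blast
      next
        assume "\<exists>s\<in>S. (s, x) \<in> (prel V par)\<^sup>* \<and> (x, last xs) \<in> (prel V par)\<^sup>*"
        then obtain s where "s \<in> S" "(s, last xs) \<in> (prel V par)\<^sup>*" by (meson rtrancl_trans)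
        then show False using above by blast
      qed
    qed
    then show ?thesis using F b1V by (auto simp: forest_def acyclic_def par'_def)
  qed
  moreover have "roots V par' = {hd cs, hd xs}"
    using cs(2) xs(2) by (auto simp: roots_def par'_def S_def)
  moreover have "kids V par' u = (if u = last xs then kids V par u \<union> S else kids V par u)" for u
    using SV Sr by (auto simp: kids_def par'_def)
  then have "internal V par' = internal V par"
    using v(1) by (auto simp: internal_def)
  ultimately have "par' \<in> forests V r"
    using par xs(3) by (simp add: forests_def)
  then show ?thesis using le less by force
qed

text \<open>
  After rerooting, a shortest leg hangs at the common root. Below any branching there is then a chain
  that is long enough for the reflection.
\<close>

lemma branch_improve:
  assumes par: "par \<in> forests V r" and b: "2 \<le> card (kids V par b)"
    and none: "\<And>par'. par' \<in> forests V r \<Longrightarrow> sgraph V par' = sgraph V par \<Longrightarrow> 2 \<le> card (roots V par') \<Longrightarrow>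
      (\<exists>b. 2 \<le> card (kids V par' b))"
  shows "\<exists>par'\<in>forests V r. slee (sgraph V par) < slee (sgraph V par')"
proof -
  define good where "good = (\<lambda>h. \<exists>par' cs. par' \<in> forests V r \<and> sgraph V par' = sgraph V par \<and> 3 \<le> card (roots V par') \<and>
    hd cs \<in> roots V par' \<and> leg V par' cs \<and> length cs = h)"
  have to_good: "good (length cs)" if p: "p \<in> forests V r" "sgraph V p = sgraph V par"
    and c: "2 \<le> card (kids V p b)" "hd cs \<in> kids V p b" "leg V p cs" for p b cs
  proof -
    note F = forestsD(1)[OF p(1)]
    have "b \<in> V" using parent_V[OF F c(2)] .
    then obtain y where y: "y \<in> roots V p" "(y, b) \<in> (prel V p)\<^sup>*" using root_above[OF F] by blast
    then obtain k where "(y, b) \<in> prel V p ^^ k" using rtrancl_imp_relpow by blast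
    from reroot_to_leg[OF p(1) y(1) this c] show ?thesis using p(2) unfolding good_def by metis
  qed
  have ex: "\<exists>h. good h"
  proof -
    note F = forestsD(1)[OF par]
    obtain s where s: "s \<in> kids V par b" using b by fastforce
    \<comment> \<open>No chain has more than \<open>card V\<close> vertices, so for this length a
      leg below the branching is guaranteed.\<close>
    have "\<nexists>xs. dchain V par xs \<and> hd xs = s \<and> length xs = Suc (card V)"
      using dchain_length_le[OF F] by fastforce
    from short_leg_below_branch[OF F s b _ this] show ?thesis using to_good[OF par refl] by blast
  qed
  define h where "h = (LEAST h. good h)"
  have "good h" unfolding h_def using ex by (rule LeastI_ex)
  then obtain p cs where p: "p \<in> forests V r" "sgraph V p = sgraph V par" "3 \<le> card (roots V p)"
    "hd cs \<in> roots V p" "leg V p cs" "length cs = h" unfolding good_def by blast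
  note F = forestsD(1)[OF p(1)]
  \<comment> \<open>Besides the common root, which now has degree at least three, a second branching
    must exist by \<open>none\<close>.\<close>
  obtain b where b: "2 \<le> card (kids V p b)" using none[OF p(1,2)] p(3) by auto
  obtain s where "s \<in> kids V p b" using b by fastforce
  then have "b \<in> V" by (rule parent_V[OF F])
  then obtain y where y: "y \<in> roots V p" "(y, b) \<in> (prel V p)\<^sup>*" using root_above[OF F] by blast
  then have yV: "y \<in> V" by (simp add: roots_def)
  \<comment> \<open>A leg from \<open>y\<close> has no branching below \<open>y\<close>, but
    \<open>b\<close> lies there. Hence the chain of only children from \<open>y\<close> ends in a
    branching, and \<open>y\<close> is not the start of \<open>cs\<close>.\<close>
  have ny: "\<not> leg V p xs" if "hd xs = y" for xs
    using leg_no_branch[of V p xs b] y(2) b that by auto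
  obtain xs where xs: "ochain V p xs" "hd xs = y" "2 \<le> card (kids V p (last xs))"
    using ochain_down[OF F yV] ny unfolding leg_def by blast
  have "y \<noteq> hd cs" using ny[of cs] p(5) by auto
  obtain t where t: "t \<in> kids V p (last xs)" using xs(3) by fastforce
  have h0: "0 < h" using p(5,6) by (auto simp: leg_def ochain_def)
  have "\<exists>ss. dchain V p ss \<and> hd ss = t \<and> length ss = h"
  proof (rule ccontr)
    assume "\<not> ?thesis"
    \<comment> \<open>Otherwise a leg shorter than \<open>h\<close> hangs below a branching, and
      rerooting to it contradicts the minimality of \<open>h\<close>.\<close>
    from short_leg_below_branch[OF F t xs(3) h0 this] obtain b' cs' where
      "2 \<le> card (kids V p b')" "hd cs' \<in> kids V p b'" "leg V p cs'" "length cs' < h" by blast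
    moreover from this(1-3) have "good (length cs')" by (rule to_good[OF p(1,2)])
    ultimately show False using not_less_Least[of "length cs'" good] by (simp add: h_def)
  qed
  then obtain ss where "dchain V p ss" "hd ss = t" "length ss = h" by (elim exE conjE)
  then have "dchain V p ss" "hd ss \<in> kids V p (last xs)" "length ss = length cs" using t p(6) by simp_all
  moreover have "hd xs \<in> roots V p" "hd xs \<noteq> hd cs" using xs(2) y(1) \<open>y \<noteq> hd cs\<close> by simp_all
  ultimately have "\<exists>par'\<in>forests V r. slee (sgraph V p) < slee (sgraph V par')"
    using attach_siblings_less[OF p(1,3,5,4) xs(1) _ _ xs(3)] by blast
  then show ?thesis unfolding p(2) .
qed

text \<open>There are finitely many graphs on \<open>V\<close>, so a maximum exists, and
  \<open>branch_improve\<close> leaves only graphs with some unbranched forest there. A maximal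
  graph may also have branched forests, by another choice of root; hence \<open>p\<close> is only
  required to have the same graph. The clause on equality serves uniqueness.\<close>

lemma maximal_forest:
  assumes "finite V" "forests V r \<noteq> {}"
  shows "\<exists>par\<in>forests V r. (\<forall>u. card (kids V par u) \<le> 1) \<and>
    (\<forall>par'\<in>forests V r. slee (sgraph V par') \<le> slee (sgraph V par) \<and>
      (slee (sgraph V par') = slee (sgraph V par) \<longrightarrow>
        (\<exists>p\<in>forests V r. sgraph V p = sgraph V par' \<and> (\<forall>u. card (kids V p u) \<le> 1))))"
proof -
  let ?X = "sgraph V ` forests V r"
  have "?X \<subseteq> (\<lambda>E. \<lparr>pverts = V, parcs = E\<rparr>) ` Pow (V \<times> V)"
    unfolding sgraph_def by auto
  then have fin: "finite ?X" using assms(1) by (meson finite_Pow_iff finite_SigmaI finite_imageI finite_subset)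
  have nb: "\<exists>p\<in>forests V r. sgraph V p = sgraph V q \<and> (\<forall>u. card (kids V p u) \<le> 1)"
    if q: "q \<in> forests V r" and mx: "\<And>p. p \<in> forests V r \<Longrightarrow> slee (sgraph V p) \<le> slee (sgraph V q)" for q
  proof (rule ccontr)
    assume c: "\<not> ?thesis"
    have br: "\<exists>b. 2 \<le> card (kids V p b)" if "p \<in> forests V r" "sgraph V p = sgraph V q" for p
      using c that by (metis One_nat_def Suc_1 not_less_eq_eq)
    obtain b where "2 \<le> card (kids V q b)" using br[OF q refl] by blast
    from branch_improve[OF q this br] obtain p where "p \<in> forests V r" "slee (sgraph V q) < slee (sgraph V p)" by blast
    then show False using mx[of p] by simp
  qed
  let ?m = "Max (slee ` ?X)"
  have "?m \<in> slee ` ?X" using fin assms(2) by (intro Max_in) auto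
  then obtain q where q: "q \<in> forests V r" "slee (sgraph V q) = ?m" by auto
  have mx: "slee (sgraph V p) \<le> ?m" if "p \<in> forests V r" for p
    using fin that by (intro Max_ge) auto
  have *: "\<exists>p\<in>forests V r. sgraph V p = sgraph V q' \<and> (\<forall>u. card (kids V p u) \<le> 1)"
    if "q' \<in> forests V r" "slee (sgraph V q') = ?m" for q'
    using nb[OF that(1)] mx unfolding that(2) by blast
  from *[OF q] obtain p where p: "p \<in> forests V r" "sgraph V p = sgraph V q" "\<forall>u. card (kids V p u) \<le> 1" by blast
  show ?thesis
    by (rule bexI[OF _ p(1)]) (use p q mx * in auto)
qed

section \<open>Unbranched forests as complete graphs with pendent paths\<close>

lemma clique_with_paths_arcs:
  "((i, j), (i', j')) \<in> parcs (clique_with_paths m p) \<longleftrightarrow> i < m \<and> i' < m \<and>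
    (j = 0 \<and> j' = 0 \<and> i \<noteq> i' \<or> i = i' \<and> (j' = Suc j \<and> j < p i \<or> j = Suc j' \<and> j' < p i))"
  by (auto simp: clique_with_paths_def)

lemma clique_with_paths_verts: "(i, j) \<in> pverts (clique_with_paths m p) \<longleftrightarrow> i < m \<and> j \<le> p i"
  by (auto simp: clique_with_paths_def)

text \<open>Each root starts a leg, the legs exhaust the forest, and the roots form the clique. All
  vertices of a leg but the last are internal, so the path lengths add up to \<open>r\<close> and
  there are \<open>card V - r\<close> roots.\<close>

lemma forest_clique_with_paths:
  assumes par: "par \<in> forests V r" and nb: "\<forall>u. card (kids V par u) \<le> 1"
  shows "\<exists>p. (\<Sum>i<card V - r. p i) = r \<and>
    digraph_iso (with_proj (clique_with_paths (card V - r) p)) (with_proj (sgraph V par))"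
proof -
  note F = forestsD(1)[OF par]
  let ?m = "card (roots V par)"
  obtain u where "bij_betw u {0..<?m} (roots V par)"
    using ex_bij_betw_nat_finite[OF finite_roots[OF F]] by blast
  then have u: "inj_on u {..<?m}" "u ` {..<?m} = roots V par" by (auto simp: bij_betw_def lessThan_atLeast0)
  have "\<exists>xs. ochain V par xs \<and> hd xs = u i \<and> kids V par (last xs) = {}" if "i < ?m" for i
  proof -
    have "u i \<in> V" using that u(2) by (auto simp: roots_def)
    then obtain xs where "ochain V par xs" "hd xs = u i"
      "kids V par (last xs) = {} \<or> 2 \<le> card (kids V par (last xs))"
      using ochain_down[OF F] by blast
    moreover have "\<not> 2 \<le> card (kids V par (last xs))" using nb[rule_format, of "last xs"] by simp
    ultimately show ?thesis by blast
  qed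
  then obtain L where L: "\<And>i. i < ?m \<Longrightarrow> ochain V par (L i) \<and> hd (L i) = u i \<and> kids V par (last (L i)) = {}"
    by metis
  define p where "p = (\<lambda>i. length (L i) - 1)"
  let ?C = "clique_with_paths ?m p"
  define g where "g = (\<lambda>(i, j). L i ! j)"
  have Ld: "dchain V par (L i)" if "i < ?m" for i using L[OF that] ochain_dchain by blast
  have Lne: "L i \<noteq> []" if "i < ?m" for i using Ld[OF that] by (simp add: dchain_def)
  have len: "length (L i) = Suc (p i)" if "i < ?m" for i using Lne[OF that] by (simp add: p_def)
  have ui: "par (u i) = None" "u i \<in> V" if "i < ?m" for i
    using u(2) that by (auto simp: roots_def)
  have par0: "par (L i ! 0) = None" if "i < ?m" for i
    using L[OF that] ui[OF that] Lne[OF that] by (simp add: hd_conv_nth)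
  have parS: "par (L i ! Suc j) = Some (L i ! j)" if "i < ?m" "Suc j \<le> p i" for i j
    using dchain_nth[OF Ld[OF that(1)], of j] len[OF that(1)] that by simp
  have LV: "L i ! j \<in> V" if "i < ?m" "j \<le> p i" for i j
    using dchain_V[OF Ld[OF that(1)], of j] len[OF that(1)] that by simp
  have Linj: "i = i' \<and> j = j'" if "i < ?m" "i' < ?m" "j \<le> p i" "j' \<le> p i'" "L i ! j = L i' ! j'" for i i' j j'
  proof -
    have "j = j' \<and> hd (L i) = hd (L i')"
      using dchain_roots_meet[OF Ld[OF that(1)] Ld[OF that(2)], of j j'] ui L that len by simp
    then have "j = j'" "u i = u i'" using L that by auto
    then show ?thesis using inj_onD[OF u(1)] that by auto
  qed
  have kids_in: "kids V par (L i ! j) = (if j < p i then {L i ! Suc j} else {})" if "i < ?m" "j \<le> p i" for i j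
  proof (cases "j < p i")
    case True
    then show ?thesis using ochain_nth_kids[of V par "L i" j] L[OF that(1)] len[OF that(1)] by simp
  next
    case False
    then have "L i ! j = last (L i)" using that len[OF that(1)] Lne[OF that(1)] by (simp add: last_conv_nth)
    then show ?thesis using L[OF that(1)] False by simp
  qed
  have surj: "\<exists>i j. i < ?m \<and> j \<le> p i \<and> v = L i ! j" if "v \<in> V" for v
    using that
  proof (induction v rule: forest_up_induct[OF F])
    case (1 v)
    show ?case
    proof (cases "par v")
      case None
      then have "v \<in> u ` {..<?m}" unfolding u(2) using 1 by (simp add: roots_def)
      then obtain i where "i < ?m" "v = u i" by blast
      then have "v = L i ! 0" using L[of i] Lne[of i] by (simp add: hd_conv_nth)
      then show ?thesis using \<open>i < ?m\<close> by blast
    next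
      case (Some w)
      then have vk: "v \<in> kids V par w" using 1 by (simp add: kids_def)
      then obtain i j where ij: "i < ?m" "j \<le> p i" "w = L i ! j"
        using "1.IH"[of w] parent_V[OF F vk] prel_kids[of w v V par] by blast
      then have "j < p i" "v = L i ! Suc j" using vk kids_in[OF ij(1,2)] by (auto split: if_splits)
      then show ?thesis using ij(1) Suc_leI by blast
    qed
  qed
  have pv: "pverts ?C = (SIGMA i:{..<?m}. {..p i})" by (simp add: clique_with_paths_def)
  have inj: "inj_on g (pverts ?C)"
  proof (rule inj_onI)
    fix a b assume a: "a \<in> pverts ?C" and b: "b \<in> pverts ?C" and e: "g a = g b"
    obtain i j i' j' where ab: "a = (i, j)" "b = (i', j')" by fastforce
    then show "a = b" using Linj[of i i' j j'] a b e unfolding pv by (simp add: g_def)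
  qed
  have im: "g ` pverts ?C = V"
  proof (intro equalityI subsetI)
    fix x assume "x \<in> g ` pverts ?C"
    then show "x \<in> V" unfolding pv using LV by (auto simp: g_def)
  next
    fix v assume "v \<in> V"
    then obtain i j where "i < ?m" "j \<le> p i" "v = L i ! j" using surj by blast
    then show "v \<in> g ` pverts ?C" unfolding pv by (intro image_eqI[of _ _ "(i, j)"]) (auto simp: g_def)
  qed
  have bij: "bij_betw g (pverts ?C) (pverts (sgraph V par))" using inj im by (simp add: bij_betw_def)
  have arcs: "(g a, g b) \<in> parcs (sgraph V par) \<longleftrightarrow> (a, b) \<in> parcs ?C" if a: "a \<in> pverts ?C" and b: "b \<in> pverts ?C" for a b
  proof -
    obtain i j i' j' where ab: "a = (i, j)" "b = (i', j')" by fastforce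
    have i: "i < ?m" "j \<le> p i" and i': "i' < ?m" "j' \<le> p i'" using a b unfolding ab pv by auto
    have ne: "g a \<noteq> g b \<longleftrightarrow> (i, j) \<noteq> (i', j')" using inj_on_eq_iff[OF inj a b] ab by simp
    have some: "par (L i ! j) = Some (L i' ! j') \<longleftrightarrow> i = i' \<and> j = Suc j'"
      if "i < ?m" "j \<le> p i" "i' < ?m" "j' \<le> p i'" for i j i' j'
    proof (cases j)
      case 0
      then show ?thesis using par0[OF that(1)] by simp
    next
      case (Suc k)
      then have "par (L i ! j) = Some (L i ! k)" using parS[OF that(1), of k] that(2) by simp
      then show ?thesis using Linj[of i i' k j'] that Suc by auto
    qed
    have eq: "par (L i ! j) = par (L i' ! j') \<longleftrightarrow> (j = 0 \<and> j' = 0) \<or> (i = i' \<and> j = j')"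
    proof (cases j)
      case 0
      then show ?thesis using par0[OF i(1)] par0[OF i'(1)] parS[OF i'(1)] i' by (cases j') auto
    next
      case (Suc k)
      then have *: "par (L i ! j) = Some (L i ! k)" using parS[OF i(1), of k] i(2) by simp
      have "par (L i' ! j') = Some (L i ! k) \<longleftrightarrow> i' = i \<and> j' = Suc k"
        using some[OF i' i(1), of k] Suc i(2) by simp
      then show ?thesis using * Suc by auto
    qed
    have gg: "g a = L i ! j" "g b = L i' ! j'" by (auto simp: g_def ab)
    have "(g a, g b) \<in> parcs (sgraph V par) \<longleftrightarrow> (i, j) \<noteq> (i', j') \<and>
      ((j = 0 \<and> j' = 0) \<or> (i = i' \<and> j = j') \<or> (i = i' \<and> j = Suc j') \<or> (i' = i \<and> j' = Suc j))"
      unfolding sgraph_simps ne unfolding gg eq some[OF i i'] some[OF i' i] using LV[OF i] LV[OF i'] by blast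
    also have "\<dots> \<longleftrightarrow> (a, b) \<in> parcs ?C"
      unfolding ab clique_with_paths_arcs using i i' by auto
    finally show ?thesis .
  qed
  have iso: "digraph_iso (with_proj ?C) (with_proj (sgraph V par))"
    by (rule digraph_isoI[OF pair_graph_clique_with_paths pair_graph_sgraph[OF forest_finite[OF F]] bij arcs])
  have "internal V par = g ` (SIGMA i:{..<?m}. {..<p i})"
  proof (intro equalityI subsetI)
    fix w assume w: "w \<in> internal V par"
    then obtain v where "v \<in> kids V par w" by (auto simp: internal_def)
    then have "w \<in> V" by (rule parent_V[OF F])
    then obtain i j where ij: "i < ?m" "j \<le> p i" "w = L i ! j" using surj by blast
    then have "j < p i" using w kids_in[OF ij(1,2)] by (auto simp: internal_def split: if_splits)
    then show "w \<in> g ` (SIGMA i:{..<?m}. {..<p i})" using ij by (intro image_eqI[of _ _ "(i, j)"]) (auto simp: g_def)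
  next
    fix w assume "w \<in> g ` (SIGMA i:{..<?m}. {..<p i})"
    then obtain i j where ij: "i < ?m" "j < p i" "w = L i ! j" by (auto simp: g_def)
    then show "w \<in> internal V par" using kids_in[OF ij(1), of j] by (simp add: internal_def)
  qed
  then have "r = card (SIGMA i:{..<?m}. {..<p i})"
    using forestsD(2)[OF par] card_image[OF inj_on_subset[OF inj, of "SIGMA i:{..<?m}. {..<p i}"]] unfolding pv by fastforce
  then have r: "(\<Sum>i<?m. p i) = r" by simp
  have "card V = card (pverts ?C)" using card_image[OF inj] im by simp
  then have "card V = (\<Sum>i<?m. Suc (p i))" unfolding pv by simp
  then have "card V = ?m + r" using r by (simp add: sum_Suc)
  then have "card V - r = ?m" by simp
  then show ?thesis using r iso by auto
qed

section \<open>Balancing the path lengths\<close>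

text \<open>
  The last vertex of the longer path moves to the end of the shorter one: a reflection of the path
  that joins both ends through the clique.
\<close>

lemma shift_path_less:
  assumes m: "3 \<le> m" and ij: "i < m" "j < m" "i \<noteq> j" and ab: "p j + 2 \<le> p i"
  shows "slee (clique_with_paths m p) < slee (clique_with_paths m (p(i := p i - 1, j := p j + 1)))"
proof -
  define a where "a = p i"
  define b where "b = p j"
  define V where "V = pverts (clique_with_paths m p)"
  define A where "A = parcs (clique_with_paths m p)"
  define N where "N = a + b"
  \<comment> \<open>The path runs from (i, a - 1) to (i, 0), over the clique edge to (j, 0) and on
    to (j, b). The end vertex (i, a) is not on it; its only edge is the one that moves.\<close>
  define z where "z = (\<lambda>k. if k < a then (i, a - 1 - k) else (j, k - a))"
  define S where "S = {(i, a)}"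
  define I where "I = {0::nat}"
  define FF where "FF = z ` I \<times> S \<union> S \<times> z ` I"
  define FF' where "FF' = (\<lambda>k. z (N - k)) ` I \<times> S \<union> S \<times> (\<lambda>k. z (N - k)) ` I"
  define E where "E = A - FF"
  let ?p = "p(i := p i - 1, j := p j + 1)"
  have ba: "b + 2 \<le> a" using ab by (simp add: a_def b_def)
  interpret P: pair_graph "clique_with_paths m p" by (rule pair_graph_clique_with_paths)
  have fV: "finite V" unfolding V_def by simp
  have AV: "A \<subseteq> V \<times> V" unfolding A_def V_def by (auto dest: P.in_arcsD1 P.in_arcsD2)
  have arcs: "((k, l), (k', l')) \<in> A \<longleftrightarrow> k < m \<and> k' < m \<and>
    (l = 0 \<and> l' = 0 \<and> k \<noteq> k' \<or> k = k' \<and> (l' = Suc l \<and> l < p k \<or> l = Suc l' \<and> l' < p k))" for k l k' l'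
    unfolding A_def by (rule clique_with_paths_arcs)
  have verts: "(k, l) \<in> V \<longleftrightarrow> k < m \<and> l \<le> p k" for k l
    unfolding V_def by (rule clique_with_paths_verts)
  have z0: "z 0 = (i, a - 1)" and zN: "z N = (j, b)" using ba by (auto simp: z_def N_def)
  have FF: "FF = {((i, a - 1), (i, a)), ((i, a), (i, a - 1))}"
    unfolding FF_def I_def S_def using z0 by auto
  have FF': "FF' = {((j, b), (i, a)), ((i, a), (j, b))}"
    unfolding FF'_def I_def S_def using zN by auto
  have symA: "sym A" unfolding sym_def by (auto simp: arcs)
  have symE: "sym E" using symA unfolding E_def FF sym_def by blast
  have "FF \<subseteq> A" unfolding FF using ij ba by (auto simp: arcs a_def)
  then have EF: "E \<union> FF = A" by (auto simp: E_def)
  have refl: "graph_reflection V (z ` {k. 2 * k < N}) (path_flip z N) E FF FF'"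
    unfolding FF_def FF'_def
  proof (rule path_reflection)
    show "finite V" "sym E" by fact+
    show "E \<subseteq> V \<times> V" using AV by (auto simp: E_def)
    show "inj_on z {..N}" using ij ba by (auto simp: inj_on_def z_def split: if_splits)
    show "z ` {..N} \<subseteq> V" using ij ba by (auto simp: z_def N_def verts a_def b_def)
    show "S \<subseteq> V" using ij by (simp add: S_def verts a_def)
    show "S \<inter> z ` {..N} = {}" using ij ba by (auto simp: S_def z_def split: if_splits)
    show "2 * k < N" if "k \<in> I" for k using that ba by (simp add: I_def N_def)
    show "(z k, z (Suc k)) \<in> E" if "k < N" for k
      using that ij ba unfolding E_def FF by (auto simp: z_def N_def arcs a_def b_def)
    show "x = z (Suc k) \<or> 0 < k \<and> x = z (k - 1)" if k: "2 * k < N" and x: "(z k, x) \<in> E" for k x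
    proof -
      obtain x1 x2 where xx: "x = (x1, x2)" by fastforce
      have ka: "k + 2 \<le> a" using k ba by (simp add: N_def)
      have zk: "z k = (i, a - 1 - k)" using ka by (simp add: z_def)
      have "x1 = i" "x2 = a - k \<or> x2 = a - 2 - k" and "k = 0 \<Longrightarrow> x2 \<noteq> a"
        using x ka unfolding E_def FF xx zk by (auto simp: arcs)
      moreover have "z (Suc k) = (i, a - 2 - k)" using ka by (simp add: z_def)
      moreover have "z (k - 1) = (i, a - k)" if "0 < k"
      proof -
        have "k - 1 < a" "a - 1 - (k - 1) = a - k" using ka that by linarith+
        then show ?thesis by (simp add: z_def)
      qed
      ultimately show ?thesis unfolding xx by (cases "k = 0") auto
    qed
    show "(z (N - k), s) \<notin> E" if "k \<in> I" "s \<in> S" for k s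
      using that ij ba zN unfolding E_def by (simp add: I_def S_def arcs)
  qed
  interpret R: graph_reflection V "z ` {k. 2 * k < N}" "path_flip z N" E FF FF' by (rule refl)
  let ?L = "z ` {k. 2 * k < N}"
  have injz: "inj_on z {..N}" using ij ba by (auto simp: inj_on_def z_def split: if_splits)
  \<comment> \<open>\<open>z b\<close> is the mirror image of the clique vertex (j, 0). As a - 1 - b
    \<ge> 1 it lies inside the longer path and has at most two neighbours: this pair supplies the
    difference of degrees.\<close>
  have zb: "z b = (i, a - 1 - b)" and za: "z a = (j, 0)" using ba by (simp_all add: z_def)
  have flip: "path_flip z N (z b) = (j, 0)" 
  proof -
    have "b \<le> N" "N - b = a" by (simp_all add: N_def)
    then show ?thesis using path_flip_on[OF injz, of b] za by simp
  qed
  have sL: "(i, a) \<notin> ?L" using ba ij by (auto simp: z_def split: if_splits)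
  have chain: "k \<le> b \<Longrightarrow> (z 0, z k) \<in> (E \<inter> ?L \<times> ?L)\<^sup>*" for k
  proof (induction k)
    case (Suc k)
    have "(z k, z (Suc k)) \<in> E"
    proof -
      have "k < a" "Suc k < a" "a - 1 - k = Suc (a - 1 - Suc k)" "a - 1 - k < a" using Suc.prems ba by linarith+
      then show ?thesis using ij unfolding E_def FF by (auto simp: z_def arcs a_def)
    qed
    moreover have "z k \<in> ?L" "z (Suc k) \<in> ?L" using Suc.prems ba by (auto simp: N_def)
    ultimately show ?case using Suc by (auto intro: rtrancl.rtrancl_into_rtrancl)
  qed simp
  have irrE: "irrefl E" by (auto simp: irrefl_def E_def arcs)
  have finE: "finite (E \<union> FF)" "finite (E \<union> FF')" by auto
  let ?Q = "(\<lambda>l. (l, 0::nat)) ` ({..<m} - {j})"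
  have cQ: "card ?Q = m - 1" "finite ?Q" using ij by (auto simp: card_image inj_on_def)
  have Qsub: "?Q \<subseteq> (E \<union> FF) `` {(j, 0)}" "?Q \<subseteq> (E \<union> FF') `` {(j, 0)}"
    using ij ba unfolding E_def FF by (auto simp: arcs)
  have two: "A `` {(i, a - 1 - b)} \<subseteq> {(i, a - b), (i, a - 2 - b)}"
  proof
    fix x assume "x \<in> A `` {(i, a - 1 - b)}"
    then show "x \<in> {(i, a - b), (i, a - 2 - b)}" using ba by (cases x) (auto simp: arcs)
  qed
  have c2: "card {(i, a - b), (i, a - 2 - b)} \<le> 2" by (simp add: card_insert_if)
  have deg1: "card ((E \<union> FF) `` {z b}) \<le> card ((E \<union> FF) `` {path_flip z N (z b)})"
  proof -
    have "card ((E \<union> FF) `` {z b}) \<le> 2"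
      unfolding EF zb using card_mono[OF _ two] c2 by simp
    also have "2 \<le> card ?Q" using cQ m by simp
    also have "card ?Q \<le> card ((E \<union> FF) `` {path_flip z N (z b)})"
      unfolding flip by (rule card_mono[OF _ Qsub(1)]) (use finE in \<open>simp add: finite_Image\<close>)
    finally show ?thesis .
  qed
  have sub1: "(E \<union> FF') `` {z b} \<subseteq> {(i, a - b), (i, a - 2 - b)}"
    and sub0: "b = 0 \<Longrightarrow> (i, a - b) \<notin> (E \<union> FF') `` {z b}"
  proof -
    have e: "(E \<union> FF') `` {z b} = E `` {(i, a - 1 - b)}" using ij ba unfolding FF' zb by auto
    then show "(E \<union> FF') `` {z b} \<subseteq> {(i, a - b), (i, a - 2 - b)}" using two unfolding E_def by blast
    show "b = 0 \<Longrightarrow> (i, a - b) \<notin> (E \<union> FF') `` {z b}" unfolding e unfolding E_def FF by auto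
  qed
  \<comment> \<open>For b = 0 the vertex \<open>z b\<close> is \<open>z 0\<close>, which has lost
    its edge to (i, a). For b > 0 the vertex (j, 0) has the neighbour (j, 1) besides the m - 1 in
    the clique.\<close>
  have deg2: "card ((E \<union> FF') `` {z b}) < card ((E \<union> FF') `` {path_flip z N (z b)})"
  proof (cases "b = 0")
    case True
    have "card ((E \<union> FF') `` {z b}) \<le> card {(i, a - 2 - b)}"
      using sub1 sub0[OF True] by (intro card_mono) blast+
    also have "\<dots> < card ?Q" using cQ m by simp
    also have "card ?Q \<le> card ((E \<union> FF') `` {path_flip z N (z b)})"
      unfolding flip by (rule card_mono[OF _ Qsub(2)]) (use finE in \<open>simp add: finite_Image\<close>)
    finally show ?thesis .
  next
    case False
    have "card ((E \<union> FF') `` {z b}) \<le> card {(i, a - b), (i, a - 2 - b)}"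
      by (rule card_mono[OF _ sub1]) simp
    also have "\<dots> \<le> 2" by (rule c2)
    also have "2 < card (insert (j, 1) ?Q)" using cQ m by (auto simp: card_insert_if)
    also have "card (insert (j, 1) ?Q) \<le> card ((E \<union> FF') `` {path_flip z N (z b)})"
      unfolding flip
    proof (rule card_mono)
      have "((j, 0), (j, 1)) \<in> E" using False ij ba unfolding E_def FF by (auto simp: arcs b_def)
      then show "insert (j, 1) ?Q \<subseteq> (E \<union> FF') `` {(j, 0)}" using Qsub(2) by auto
    qed (use finE in \<open>simp add: finite_Image\<close>)
    finally show ?thesis .
  qed
  have ex: "\<exists>k. tr V (mpow V (sl (E \<union> FF)) k) < tr V (mpow V (sl (E \<union> FF')) k)"
  proof (rule R.tr_less)
    show "(i, a) \<in> V" using ij by (simp add: verts a_def)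
    show "(i, a) \<notin> ?L" by (rule sL)
    show "z 0 \<in> ?L" using ba by (auto simp: N_def)
    show "((i, a), z 0) \<in> FF" "(z 0, (i, a)) \<in> FF" by (auto simp: FF z0)
    show "(z 0, z b) \<in> (E \<inter> ?L \<times> ?L)\<^sup>*" by (rule chain) simp
    show "FF \<inter> ?L \<times> ?L = {}" using sL by (auto simp: FF)
    show "sym FF" by (auto simp: FF sym_def)
  qed (fact irrE deg1 deg2)+
  define G where "G = \<lparr>pverts = V, parcs = E \<union> FF'\<rparr>"
  have pG: "pair_graph G" unfolding G_def
  proof (rule pair_graphI[OF fV])
    show "E \<union> FF' \<subseteq> V \<times> V" using R.E_V ij by (auto simp: FF' verts a_def b_def)
    show "sym (E \<union> FF')" using symE by (auto simp: sym_def FF')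
    show "irrefl (E \<union> FF')" using irrE ij by (auto simp: irrefl_def FF')
  qed
  have less: "slee (clique_with_paths m p) < slee G"
  proof -
    obtain k where k: "tr V (mpow V (sl (E \<union> FF)) k) < tr V (mpow V (sl (E \<union> FF')) k)" using ex by blast
    show ?thesis
    proof (rule slee_strict_mono[OF pair_graph_clique_with_paths pG, where k = k])
      show "tr (pverts (clique_with_paths m p)) (mpow (pverts (clique_with_paths m p)) (sl (parcs (clique_with_paths m p))) k)
        \<le> tr (pverts G) (mpow (pverts G) (sl (parcs G)) k)" for k
        using R.tr_le[of k] unfolding EF by (simp add: G_def V_def A_def)
      show "tr (pverts (clique_with_paths m p)) (mpow (pverts (clique_with_paths m p)) (sl (parcs (clique_with_paths m p))) k)
        < tr (pverts G) (mpow (pverts G) (sl (parcs G)) k)"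
        using k unfolding EF by (simp add: G_def V_def A_def)
    qed
  qed
  \<comment> \<open>Only the moved vertex needs a new name, as the new end of path
    \<open>j\<close>.\<close>
  define f where "f = (\<lambda>x. if x = (i, a) then (j, Suc b) else x)"
  have "digraph_iso (with_proj G) (with_proj (clique_with_paths m ?p))"
  proof (rule digraph_isoI[OF pG pair_graph_clique_with_paths])
    have "inj_on f V" using ij by (auto simp: inj_on_def f_def verts b_def)
    moreover have "f ` V = pverts (clique_with_paths m ?p)"
    proof (intro equalityI subsetI)
      fix x assume "x \<in> f ` V"
      then obtain y where "y \<in> V" "x = f y" by blast
      then show "x \<in> pverts (clique_with_paths m ?p)"
        using ij ba by (cases y) (auto simp: f_def verts clique_with_paths_verts a_def b_def split: if_splits)
    next
      fix x assume x: "x \<in> pverts (clique_with_paths m ?p)"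
      show "x \<in> f ` V"
      proof (cases "x = (j, Suc b)")
        case True
        then show ?thesis using ij by (intro image_eqI[of _ _ "(i, a)"]) (auto simp: f_def verts a_def)
      next
        case False
        then show ?thesis using x ij ba
          by (intro image_eqI[of _ _ x]; cases x)
            (auto simp: f_def verts clique_with_paths_verts a_def b_def split: if_splits)
      qed
    qed
    ultimately show "bij_betw f (pverts G) (pverts (clique_with_paths m ?p))"
      by (simp add: bij_betw_def G_def)
    fix x y assume "x \<in> pverts G" "y \<in> pverts G"
    then have xy: "x \<in> V" "y \<in> V" by (auto simp: G_def)
    obtain x1 x2 y1 y2 where e: "x = (x1, x2)" "y = (y1, y2)" by fastforce
    have v: "x1 < m" "x2 \<le> p x1" "y1 < m" "y2 \<le> p y1" using xy by (auto simp: e verts)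
    show "(f x, f y) \<in> parcs (clique_with_paths m ?p) \<longleftrightarrow> (x, y) \<in> parcs G"
      unfolding G_def E_def FF FF' e f_def using v ij ba
      by (auto simp: arcs clique_with_paths_arcs a_def b_def split: if_splits)
  qed
  then show ?thesis using less slee_digraph_iso[OF pG pair_graph_clique_with_paths] by metis
qed

section \<open>Comparison of path lengths\<close>

lemma clique_with_paths_permute:
  assumes h: "bij_betw h {..<m} {..<m}" and eq: "\<And>i. i < m \<Longrightarrow> q (h i) = p i"
  shows "digraph_iso (with_proj (clique_with_paths m p)) (with_proj (clique_with_paths m q))"
proof (rule digraph_isoI[OF pair_graph_clique_with_paths pair_graph_clique_with_paths])
  have hm: "h i < m" if "i < m" for i using h that by (auto simp: bij_betw_def)
  have hi: "h i = h i' \<longleftrightarrow> i = i'" if "i < m" "i' < m" for i i'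
    using h that by (auto simp: bij_betw_def inj_on_def)
  let ?f = "\<lambda>(i, j). (h i, j)"
  show "bij_betw ?f (pverts (clique_with_paths m p)) (pverts (clique_with_paths m q))"
  proof (rule bij_betw_imageI)
    show "inj_on ?f (pverts (clique_with_paths m p))"
      using hi by (auto simp: inj_on_def clique_with_paths_verts)
    show "?f ` pverts (clique_with_paths m p) = pverts (clique_with_paths m q)"
    proof (intro equalityI subsetI)
      fix x assume "x \<in> pverts (clique_with_paths m q)"
      then obtain i j where x: "x = (i, j)" "i < m" "j \<le> q i" by (cases x) (auto simp: clique_with_paths_verts)
      then have "i \<in> h ` {..<m}" using h by (simp add: bij_betw_def)
      then obtain k where "k < m" "h k = i" by blast
      then show "x \<in> ?f ` pverts (clique_with_paths m p)"
        using x eq[of k] by (intro image_eqI[of _ _ "(k, j)"]) (auto simp: clique_with_paths_verts)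
    next
      fix x assume "x \<in> ?f ` pverts (clique_with_paths m p)"
      then show "x \<in> pverts (clique_with_paths m q)"
        using hm eq by (auto simp: clique_with_paths_verts)
    qed
  qed
  fix x y assume "x \<in> pverts (clique_with_paths m p)" "y \<in> pverts (clique_with_paths m p)"
  then show "(?f x, ?f y) \<in> parcs (clique_with_paths m q) \<longleftrightarrow> (x, y) \<in> parcs (clique_with_paths m p)"
    using hm hi eq by (cases x; cases y) (auto simp: clique_with_paths_arcs clique_with_paths_verts)
qed

definition balanced :: "nat \<Rightarrow> (nat \<Rightarrow> nat) \<Rightarrow> bool" where
  "balanced m p \<longleftrightarrow> (\<forall>i<m. \<forall>j<m. p i \<le> Suc (p j))"

text \<open>All values are the minimum \<open>p k\<close> or one more. As \<open>k\<close> itself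
  has the smaller value, the larger one occurs fewer than \<open>m\<close> times, so minimum and
  number are quotient and remainder of the sum.\<close>

lemma balanced_values:
  assumes "0 < m" "balanced m p"
  defines "q \<equiv> (\<Sum>i<m. p i) div m"
  shows "card {i \<in> {..<m}. p i = Suc q} = (\<Sum>i<m. p i) mod m"
    and "\<And>i. i < m \<Longrightarrow> p i = q \<or> p i = Suc q"
proof -
  obtain k where k: "k < m" "\<And>i. i < m \<Longrightarrow> p k \<le> p i"
    using ex_min_if_finite[of "p ` {..<m}"] assms(1) by (auto simp: not_less Ball_def)
  have val: "p i = p k \<or> p i = Suc (p k)" if "i < m" for i
    using k that assms(2) unfolding balanced_def by (metis le_SucE le_antisym)
  let ?A = "{i \<in> {..<m}. p i = Suc (p k)}"
  have "(\<Sum>i<m. p i) = (\<Sum>i<m. p k + (if p i = Suc (p k) then 1 else 0))"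
    by (intro sum.cong refl) (use val in auto)
  also have "\<dots> = m * p k + card ?A"
    by (simp add: sum.distrib sum.If_cases Int_def)
  finally have s: "(\<Sum>i<m. p i) = m * p k + card ?A" .
  have "?A \<subseteq> {..<m} - {k}" by auto
  then have "card ?A \<le> card ({..<m} - {k})" by (intro card_mono) auto
  then have c: "card ?A < m" using k(1) by simp
  have "(\<Sum>i<m. p i) div m = p k" unfolding s using c assms(1) by simp
  then have q: "q = p k" by (simp add: q_def)
  show "card {i \<in> {..<m}. p i = Suc q} = (\<Sum>i<m. p i) mod m"
    unfolding q using s c by simp
  show "\<And>i. i < m \<Longrightarrow> p i = q \<or> p i = Suc q" using val q by simp
qed

text \<open>The sum fixes the numbers of long and of short paths, so a bijection of the long ones
  and one of the short ones combine to a permutation of the clique.\<close>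

lemma balanced_iso:
  assumes m: "0 < m" and b: "balanced m p" "balanced m p'" and s: "(\<Sum>i<m. p i) = (\<Sum>i<m. p' i)"
  shows "digraph_iso (with_proj (clique_with_paths m p)) (with_proj (clique_with_paths m p'))"
proof -
  define q where "q = (\<Sum>i<m. p i) div m"
  let ?A = "{i \<in> {..<m}. p i = Suc q}" and ?B = "{i \<in> {..<m}. p' i = Suc q}"
  have v: "p i = q \<or> p i = Suc q" "p' i = q \<or> p' i = Suc q" if "i < m" for i
    using balanced_values(2)[OF m b(1) that] balanced_values(2)[OF m b(2) that] s by (simp_all add: q_def)
  have c: "card ?A = card ?B"
    using balanced_values(1)[OF m b(1)] balanced_values(1)[OF m b(2)] s by (simp add: q_def)
  obtain f where f: "bij_betw f ?A ?B"
    using finite_same_card_bij[OF _ _ c] by auto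
  have "card ({..<m} - ?A) = card ({..<m} - ?B)"
  proof -
    have "card ({..<m} - ?A) = m - card ?A" "card ({..<m} - ?B) = m - card ?B"
      by (subst card_Diff_subset; auto)+
    then show ?thesis using c by simp
  qed
  then obtain g where g: "bij_betw g ({..<m} - ?A) ({..<m} - ?B)"
    using finite_same_card_bij[of "{..<m} - ?A" "{..<m} - ?B"] by auto
  define h where "h = (\<lambda>i. if i \<in> ?A then f i else g i)"
  have "bij_betw h (?A \<union> ({..<m} - ?A)) (?B \<union> ({..<m} - ?B))"
  proof (rule bij_betw_combine)
    have "bij_betw h ?A ?B \<longleftrightarrow> bij_betw f ?A ?B" by (rule bij_betw_cong) (simp add: h_def)
    then show "bij_betw h ?A ?B" using f by blast
    have "bij_betw h ({..<m} - ?A) ({..<m} - ?B) \<longleftrightarrow> bij_betw g ({..<m} - ?A) ({..<m} - ?B)"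
      by (rule bij_betw_cong) (simp add: h_def)
    then show "bij_betw h ({..<m} - ?A) ({..<m} - ?B)" using g by blast
  qed blast
  moreover have "?A \<union> ({..<m} - ?A) = {..<m}" "?B \<union> ({..<m} - ?B) = {..<m}" by auto
  ultimately have h: "bij_betw h {..<m} {..<m}" by metis
  show ?thesis
  proof (rule clique_with_paths_permute[OF h])
    fix i assume i: "i < m"
    show "p' (h i) = p i"
    proof (cases "i \<in> ?A")
      case True
      then have "f i \<in> ?B" using f by (auto simp: bij_betw_def)
      then show ?thesis using True by (simp add: h_def)
    next
      case False
      then have "g i \<in> {..<m} - ?B" using g i by (auto simp: bij_betw_def)
      then have "p' (g i) = q" using v(2)[of "g i"] by auto
      moreover have "p i = q" using False v(1)[OF i] i by auto
      ultimately show ?thesis using False by (simp add: h_def)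
    qed
  qed
qed

text \<open>The clique is a single edge here. The first pendent path is numbered backwards, so that
  this edge joins the positions \<open>p 0\<close> and \<open>Suc (p 0)\<close>.\<close>

lemma two_paths_iso_path:
  assumes "n = p 0 + p (1::nat)"
  shows "digraph_iso (with_proj (clique_with_paths 2 p))
    (with_proj \<lparr>pverts = {..Suc n}, parcs = {(s, t). s \<le> Suc n \<and> t \<le> Suc n \<and> (s = Suc t \<or> t = Suc s)}\<rparr>)"
    (is "digraph_iso _ (with_proj ?P)")
proof (rule digraph_isoI[OF pair_graph_clique_with_paths])
  show "pair_graph ?P"
    by (rule pair_graphI) (auto simp: sym_def irrefl_def)
  let ?f = "\<lambda>(i, j). if i = (0::nat) then p 0 - j else Suc (p 0 + j)"
  show "bij_betw ?f (pverts (clique_with_paths 2 p)) (pverts ?P)"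
  proof (rule bij_betw_imageI)
    show "inj_on ?f (pverts (clique_with_paths 2 p))"
      by (auto simp: inj_on_def clique_with_paths_verts less_2_cases_iff split: if_splits)
    show "?f ` pverts (clique_with_paths 2 p) = pverts ?P"
    proof (intro equalityI subsetI)
      fix x assume "x \<in> ?f ` pverts (clique_with_paths 2 p)"
      then show "x \<in> pverts ?P"
        using assms by (auto simp: clique_with_paths_verts less_2_cases_iff)
    next
      fix x assume x: "x \<in> pverts ?P"
      show "x \<in> ?f ` pverts (clique_with_paths 2 p)"
      proof (cases "x \<le> p 0")
        case True
        then show ?thesis by (intro image_eqI[of _ _ "(0, p 0 - x)"]) (auto simp: clique_with_paths_verts)
      next
        case False
        then show ?thesis using x assms
          by (intro image_eqI[of _ _ "(1, x - Suc (p 0))"]) (auto simp: clique_with_paths_verts)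
      qed
    qed
  qed
  fix x y assume xy: "x \<in> pverts (clique_with_paths 2 p)" "y \<in> pverts (clique_with_paths 2 p)"
  obtain i j i' j' where e: "x = (i, j)" "y = (i', j')" by fastforce
  have "i = 0 \<or> i = 1" "i' = 0 \<or> i' = 1" "j \<le> p i" "j' \<le> p i'"
    using xy by (auto simp: e clique_with_paths_verts less_2_cases_iff)
  then show "(?f x, ?f y) \<in> parcs ?P \<longleftrightarrow> (x, y) \<in> parcs (clique_with_paths 2 p)"
    using assms unfolding e by (auto simp: clique_with_paths_arcs)
qed

lemma two_paths_iso:
  assumes "p 0 + p (1::nat) = q 0 + q (1::nat)"
  shows "digraph_iso (with_proj (clique_with_paths 2 p)) (with_proj (clique_with_paths 2 q))"
proof -
  interpret pair_graph "clique_with_paths 2 q" by (rule pair_graph_clique_with_paths)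
  show ?thesis
    using two_paths_iso_path[OF refl, of p] digraph_iso_swap[OF wf_digraph_axioms two_paths_iso_path[OF refl, of q]]
    unfolding assms by (rule Digraph_Isomorphism.digraph_iso_trans)
qed

text \<open>For \<open>m = 2\<close> all lengths with the same sum give the same path. Otherwise
  every shift raises the index strictly and lowers the sum of squares, so shifting ends in balanced
  lengths, and equality holds only if no shift occurred.\<close>

lemma slee_le_balanced:
  assumes m: "2 \<le> m" and b: "balanced m p'" and s: "(\<Sum>i<m. p i) = (\<Sum>i<m. p' i)"
  shows "slee (clique_with_paths m p) \<le> slee (clique_with_paths m p') \<and>
    (slee (clique_with_paths m p) = slee (clique_with_paths m p') \<longrightarrow>
      digraph_iso (with_proj (clique_with_paths m p)) (with_proj (clique_with_paths m p')))"
proof (cases "m = 2")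
  case True
  have "{..<2::nat} = {0, 1}" by auto
  then have "p 0 + p 1 = p' 0 + p' 1" using s True by simp
  then have "digraph_iso (with_proj (clique_with_paths m p)) (with_proj (clique_with_paths m p'))"
    using two_paths_iso True by simp
  then show ?thesis
    using slee_digraph_iso[OF pair_graph_clique_with_paths pair_graph_clique_with_paths] by auto
next
  case False
  then have m3: "3 \<le> m" using m by simp
  show ?thesis using s
  proof (induction "\<Sum>i<m. (p i)\<^sup>2" arbitrary: p rule: less_induct)
    case less
    show ?case
    proof (cases "balanced m p")
      case True
      then have "digraph_iso (with_proj (clique_with_paths m p)) (with_proj (clique_with_paths m p'))"
        using balanced_iso[OF _ True b less.prems] m by simp
      then show ?thesis
        using slee_digraph_iso[OF pair_graph_clique_with_paths pair_graph_clique_with_paths] by auto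
    next
      case False
      then obtain i j where ij: "i < m" "j < m" "p j + 2 \<le> p i"
        unfolding balanced_def by (auto simp: not_le Suc_le_eq)
      then have "i \<noteq> j" by auto
      let ?p = "p(i := p i - 1, j := p j + 1)"
      have split: "(\<Sum>k<m. f k) = f i + (f j + (\<Sum>k\<in>{..<m} - {i} - {j}. f k))" for f :: "nat \<Rightarrow> nat"
        using ij \<open>i \<noteq> j\<close> by (simp add: sum.remove[of "{..<m}" i] sum.remove[of "{..<m} - {i}" j])
      have rest: "(\<Sum>k\<in>{..<m} - {i} - {j}. f (?p k)) = (\<Sum>k\<in>{..<m} - {i} - {j}. f (p k))" for f :: "nat \<Rightarrow> nat"
        by (rule sum.cong) auto
      obtain d where d: "p i = p j + 2 + d" using ij(3) le_iff_add by blast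
      have "(\<Sum>k<m. ?p k) = (\<Sum>k<m. p k)"
        unfolding split[of ?p] split[of p] rest[of "\<lambda>x. x"] using \<open>i \<noteq> j\<close> d by simp
      then have s': "(\<Sum>k<m. ?p k) = (\<Sum>k<m. p' k)" using less.prems by simp
      have sq: "(\<Sum>k<m. (?p k)\<^sup>2) < (\<Sum>k<m. (p k)\<^sup>2)"
        unfolding split[of "\<lambda>k. (?p k)\<^sup>2"] split[of "\<lambda>k. (p k)\<^sup>2"] rest[of "\<lambda>x. x\<^sup>2"]
        using \<open>i \<noteq> j\<close> d by (simp add: power2_eq_square algebra_simps)
      from less.hyps[OF sq s'] shift_path_less[where p = p, OF m3 ij(1,2) \<open>i \<noteq> j\<close> ij(3)]
      show ?thesis by linarith
    qed
  qed
qed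

section \<open>Cut vertices and dominators\<close>

text \<open>The vertex \<open>d\<close> is deleted from the arcs only. The empty walk at
  \<open>d\<close> survives in the reflexive closure, hence the extra conditions on end points
  below.\<close>

definition avoid :: "('a \<times> 'a) set \<Rightarrow> 'a \<Rightarrow> ('a \<times> 'a) set" where
  "avoid E d = {(a, b) \<in> E. a \<noteq> d \<and> b \<noteq> d}"

lemma avoid_subset: "avoid E d \<subseteq> E"
  by (auto simp: avoid_def)

lemma avoid_mono: "E \<subseteq> F \<Longrightarrow> avoid E d \<subseteq> avoid F d"
  by (auto simp: avoid_def)

lemma sym_avoid: "sym E \<Longrightarrow> sym (avoid E d)"
  unfolding sym_def avoid_def by blast

lemma avoid_rtrancl: "(x, y) \<in> (avoid E d)\<^sup>* \<Longrightarrow> (x, y) \<in> E\<^sup>*"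
  by (rule subsetD[OF rtrancl_mono[OF avoid_subset]])

lemma rtrancl_sym_iff: "sym E \<Longrightarrow> (x, y) \<in> E\<^sup>* \<longleftrightarrow> (y, x) \<in> E\<^sup>*"
  using symD[OF sym_rtrancl[of E], of x y] symD[OF sym_rtrancl[of E], of y x] by blast

lemma avoid_or_hit:
  assumes "(x, y) \<in> E\<^sup>*" "x \<noteq> d"
  shows "(x, y) \<in> (avoid E d)\<^sup>* \<and> y \<noteq> d \<or> (x, d) \<in> E\<^sup>*"
  using assms(1)
proof (induction rule: rtrancl_induct)
  case (step y z)
  show ?case
  proof (cases "(x, d) \<in> E\<^sup>*")
    case False
    then have y: "(x, y) \<in> (avoid E d)\<^sup>*" "y \<noteq> d" using step.IH by auto
    have "z \<noteq> d" using False step.hyps by (metis rtrancl.rtrancl_into_rtrancl)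
    then have "(y, z) \<in> avoid E d" using step.hyps y by (simp add: avoid_def)
    then show ?thesis using y \<open>z \<noteq> d\<close> by (meson rtrancl.rtrancl_into_rtrancl)
  qed simp
qed (use assms in simp)

text \<open>A walk that meets \<open>d\<close> or \<open>e\<close> meets one of them first, and up
  to that point it avoids the other.\<close>

lemma first_hit:
  assumes "(x, y) \<in> E\<^sup>*" "x \<noteq> d" "x \<noteq> e" "d \<noteq> e"
  shows "(x, y) \<in> (avoid (avoid E d) e)\<^sup>* \<and> y \<noteq> d \<and> y \<noteq> e \<or> (x, d) \<in> (avoid E e)\<^sup>* \<or> (x, e) \<in> (avoid E d)\<^sup>*"
  using assms(1)
proof (induction rule: rtrancl_induct)
  case (step y z)
  show ?case
  proof (cases "(x, d) \<in> (avoid E e)\<^sup>* \<or> (x, e) \<in> (avoid E d)\<^sup>*")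
    case False
    then have y: "(x, y) \<in> (avoid (avoid E d) e)\<^sup>*" "y \<noteq> d" "y \<noteq> e" using step.IH by auto
    have yd: "(x, y) \<in> (avoid E d)\<^sup>*" "(x, y) \<in> (avoid E e)\<^sup>*"
      using y(1) rtrancl_mono[OF avoid_mono[OF avoid_subset, of E d e]] avoid_rtrancl[of x y "avoid E d" e] by blast+
    have "z \<noteq> d"
    proof
      assume "z = d"
      then have "(y, z) \<in> avoid E e" using step.hyps y assms by (simp add: avoid_def)
      then show False using False yd(2) \<open>z = d\<close> by (meson rtrancl.rtrancl_into_rtrancl)
    qed
    moreover have "z \<noteq> e"
    proof
      assume "z = e"
      then have "(y, z) \<in> avoid E d" using step.hyps y assms by (simp add: avoid_def)
      then show False using False yd(1) \<open>z = e\<close> by (meson rtrancl.rtrancl_into_rtrancl)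
    qed
    ultimately have "(y, z) \<in> avoid (avoid E d) e" using step.hyps y by (simp add: avoid_def)
    then show ?thesis using y(1) \<open>z \<noteq> d\<close> \<open>z \<noteq> e\<close> by (meson rtrancl.rtrancl_into_rtrancl)
  qed simp
qed (use assms in simp)

text \<open>On \<open>A\<close> the map \<open>g\<close> factors through \<open>f\<close>, and the
  factor is not injective if \<open>g\<close> identifies what \<open>f\<close> separates. With
  components as values this compares their numbers before and after a deletion.\<close>

lemma card_image_factor:
  assumes "finite A" "\<And>x y. x \<in> A \<Longrightarrow> y \<in> A \<Longrightarrow> f x = f y \<Longrightarrow> g x = g y"
  shows "card (g ` A) \<le> card (f ` A)"
    and "x \<in> A \<Longrightarrow> y \<in> A \<Longrightarrow> g x = g y \<Longrightarrow> f x \<noteq> f y \<Longrightarrow> card (g ` A) < card (f ` A)"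
proof -
  define h where "h = (\<lambda>c. g (SOME x. x \<in> A \<and> f x = c))"
  have h: "h (f x) = g x" if "x \<in> A" for x
  proof -
    have "(SOME z. z \<in> A \<and> f z = f x) \<in> A \<and> f (SOME z. z \<in> A \<and> f z = f x) = f x"
      by (rule someI[of "\<lambda>z. z \<in> A \<and> f z = f x" x]) (simp add: that)
    then show ?thesis unfolding h_def using assms(2) that by blast
  qed
  have eq: "g ` A = h ` f ` A" unfolding image_image using h by (auto intro: image_cong)
  show le: "card (g ` A) \<le> card (f ` A)" unfolding eq using assms(1) by (intro card_image_le) simp
  assume xy: "x \<in> A" "y \<in> A" "g x = g y" "f x \<noteq> f y"
  have "\<not> inj_on h (f ` A)" using xy h by (metis imageI inj_onD)
  then have "card (h ` f ` A) \<noteq> card (f ` A)" using assms(1) eq_card_imp_inj_on by blast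
  then show "card (g ` A) < card (f ` A)" using le unfolding eq by simp
qed

section \<open>Cut vertices in terms of reachability\<close>

lemma num_components_eq:
  assumes "wf_digraph H" "sym (arcs_ends H)"
  shows "num_components H = card ((\<lambda>x. {y \<in> verts H. (x, y) \<in> (arcs_ends H)\<^sup>*}) ` verts H)"
proof -
  interpret wf_digraph H by fact
  have r: "reachable H u v \<longleftrightarrow> u \<in> verts H \<and> (u, v) \<in> (arcs_ends H)\<^sup>*" for u v
  proof
    assume "reachable H u v"
    then show "u \<in> verts H \<and> (u, v) \<in> (arcs_ends H)\<^sup>*"
      using reachable_in_verts(1) unfolding reachable_def by (auto dest: rtrancl_on_rtranclI)
  next
    assume "u \<in> verts H \<and> (u, v) \<in> (arcs_ends H)\<^sup>*"
    then have "u \<in> verts H" "(u, v) \<in> (arcs_ends H)\<^sup>*" by auto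
    from this(2,1) show "reachable H u v"
    proof (induction rule: rtrancl_induct)
      case (step y z)
      then show ?case using reachable_adj_trans by blast
    qed simp
  qed
  have "scc_of x = {y \<in> verts H. (x, y) \<in> (arcs_ends H)\<^sup>*}" if "x \<in> verts H" for x
    unfolding scc_of_def r using that rtrancl_sym_iff[OF assms(2)] reachable_in_verts(2) r by blast
  then have "scc_of ` verts H = (\<lambda>x. {y \<in> verts H. (x, y) \<in> (arcs_ends H)\<^sup>*}) ` verts H" by (rule image_cong[OF refl])
  then show ?thesis unfolding num_components_def card_sccs_verts[symmetric] sccs_verts_conv_scc_of by simp
qed

text \<open>Deleting \<open>v\<close> refines the partition of the remaining vertices. The number of
  classes grows exactly if a class is split; if \<open>v\<close> is isolated, its class just
  disappears.\<close>

lemma cut_vertex_iff: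
  assumes "pair_graph G"
  shows "cut_vertex G v \<longleftrightarrow> v \<in> pverts G \<and> (\<exists>x\<in>pverts G - {v}. \<exists>y\<in>pverts G - {v}.
    (x, y) \<in> (parcs G)\<^sup>* \<and> (x, y) \<notin> (avoid (parcs G) v)\<^sup>*)"
proof (cases "v \<in> pverts G")
  case vV: True
  interpret pair_graph G by fact
  let ?V = "pverts G" and ?E = "parcs G" and ?A = "avoid (parcs G) v"
  let ?H = "pre_digraph.del_vert (with_proj G) v"
  have symE: "sym ?E" using sym_arcs by (simp add: symmetric_def)
  note sy = rtrancl_sym_iff[OF symE] and sy' = rtrancl_sym_iff[OF sym_avoid[OF symE]]
  define c where "c = (\<lambda>x. {y \<in> ?V. (x, y) \<in> ?E\<^sup>*})"
  define c' where "c' = (\<lambda>x. {y \<in> ?V - {v}. (x, y) \<in> ?A\<^sup>*})"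
  have c: "c x = c y \<longleftrightarrow> (x, y) \<in> ?E\<^sup>*" if "x \<in> ?V" "y \<in> ?V" for x y
    unfolding c_def using that sy by (auto intro: rtrancl_trans)
  have c': "c' x = c' y \<longleftrightarrow> (x, y) \<in> ?A\<^sup>*" if "x \<in> ?V - {v}" "y \<in> ?V - {v}" for x y
    unfolding c'_def using that sy' by (auto intro: rtrancl_trans)
  have n: "num_components (with_proj G) = card (c ` ?V)"
    unfolding c_def using num_components_eq[OF wf_digraph_axioms] symE by simp
  have Hv: "verts ?H = ?V - {v}" "arcs_ends ?H = ?A"
    by (auto simp: verts_del_vert arcs_ends_def arc_to_ends_def arcs_del_vert tail_del_vert head_del_vert avoid_def image_iff)
  have n': "num_components ?H = card (c' ` (?V - {v}))"
    unfolding c'_def using num_components_eq[OF wf_digraph_del_vert, of v] sym_avoid[OF symE] unfolding Hv by simp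
  have fin: "finite (?V - {v})" by simp
  show ?thesis
  proof (cases "\<exists>x\<in>?V - {v}. \<exists>y\<in>?V - {v}. (x, y) \<in> ?E\<^sup>* \<and> (x, y) \<notin> ?A\<^sup>*")
    case True
    then obtain x y where xy: "x \<in> ?V - {v}" "y \<in> ?V - {v}" "(x, y) \<in> ?E\<^sup>*" "(x, y) \<notin> ?A\<^sup>*" by blast
    \<comment> \<open>A separated pair lies in the component of \<open>v\<close>, so that component
      is still represented once \<open>v\<close> is dropped.\<close>
    have "(x, v) \<in> ?E\<^sup>*" using avoid_or_hit[OF xy(3), of v] xy by auto
    then have "c v = c x" using c[of x v] vV xy by simp
    then have e: "c ` ?V = c ` (?V - {v})" using xy(1) by blast
    have "card (c ` (?V - {v})) < card (c' ` (?V - {v}))"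
      by (rule card_image_factor(2)[OF fin _ xy(1,2)]) (use c c' xy avoid_rtrancl in \<open>auto\<close>)
    then show ?thesis using True vV unfolding cut_vertex_def n n' e by simp
  next
    case False
    have "card (c' ` (?V - {v})) \<le> card (c ` (?V - {v}))"
      by (rule card_image_factor(1)[OF fin]) (use c c' False in \<open>auto\<close>)
    also have "\<dots> \<le> card (c ` ?V)" by (intro card_mono) auto
    finally show ?thesis using False vV unfolding cut_vertex_def n n' by auto
  qed
qed (simp add: cut_vertex_def)

section \<open>Dominators and the dominator forest\<close>

locale component_reps =
  fixes V :: "'a set" and E :: "('a \<times> 'a) set" and R :: "'a set"
  assumes finV: "finite V" and EV: "E \<subseteq> V \<times> V" and symE: "sym E" and RV: "R \<subseteq> V"
    and reps: "\<And>x. x \<in> V \<Longrightarrow> \<exists>\<rho>\<in>R. (\<rho>, x) \<in> E\<^sup>*"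
    and unique: "\<And>\<rho> \<sigma>. \<rho> \<in> R \<Longrightarrow> \<sigma> \<in> R \<Longrightarrow> (\<rho>, \<sigma>) \<in> E\<^sup>* \<Longrightarrow> \<rho> = \<sigma>"
begin

text \<open>\<open>d\<close> separates \<open>x\<close> from the chosen representative of its component.\<close>

definition dom :: "'a \<Rightarrow> 'a \<Rightarrow> bool" where
  "dom d x \<longleftrightarrow> d \<in> V - R \<and> x \<in> V \<and> d \<noteq> x \<and> (\<forall>\<rho>\<in>R. (\<rho>, x) \<notin> (avoid E d)\<^sup>*)"

definition Dom :: "'a \<Rightarrow> 'a set" where
  "Dom x = {d. dom d x}"

lemma dom_V: "dom d x \<Longrightarrow> d \<in> V" "dom d x \<Longrightarrow> x \<in> V" "dom d x \<Longrightarrow> d \<noteq> x"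
  by (auto simp: dom_def)

lemma dom_not_R: "dom d x \<Longrightarrow> d \<notin> R" "dom d x \<Longrightarrow> x \<notin> R"
  by (auto simp: dom_def)

lemma not_dom: "d \<in> V - R \<Longrightarrow> x \<in> V \<Longrightarrow> d \<noteq> x \<Longrightarrow> \<not> dom d x \<Longrightarrow> \<exists>\<rho>\<in>R. (\<rho>, x) \<in> (avoid E d)\<^sup>*"
  by (auto simp: dom_def)

lemma finite_Dom: "finite (Dom x)"
  by (rule finite_subset[OF _ finV]) (auto simp: Dom_def dom_V)

text \<open>On a walk from the representative, whichever of the two vertices is met first is reached
  without the other.\<close>

lemma dom_asym: "dom d e \<Longrightarrow> dom e d \<Longrightarrow> False"
proof -
  assume d: "dom d e" and e: "dom e d"
  obtain \<rho> where \<rho>: "\<rho> \<in> R" "(\<rho>, e) \<in> E\<^sup>*" using reps dom_V(2)[OF d] by blast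
  have "\<rho> \<noteq> d" "\<rho> \<noteq> e" "d \<noteq> e" using \<rho> dom_not_R[OF d] dom_V[OF d] by auto
  from first_hit[OF \<rho>(2) this] show False using \<rho>(1) d e by (auto simp: dom_def)
qed

lemma dom_trans: "dom e d \<Longrightarrow> dom d x \<Longrightarrow> dom e x"
proof -
  assume e: "dom e d" and d: "dom d x"
  have "e \<noteq> x" using dom_asym e d by blast
  moreover have "(\<rho>, x) \<notin> (avoid E e)\<^sup>*" if \<rho>: "\<rho> \<in> R" for \<rho>
  proof
    assume x: "(\<rho>, x) \<in> (avoid E e)\<^sup>*"
    have "\<rho> \<noteq> d" using \<rho> dom_not_R(1)[OF d] by auto
    from avoid_or_hit[OF x this] show False
    proof
      assume "(\<rho>, x) \<in> (avoid (avoid E e) d)\<^sup>* \<and> x \<noteq> d"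
      then have "(\<rho>, x) \<in> (avoid E d)\<^sup>*"
        using rtrancl_mono[OF avoid_mono[OF avoid_subset, of E e d]] by blast
      then show False using d \<rho> by (auto simp: dom_def)
    next
      assume "(\<rho>, d) \<in> (avoid E e)\<^sup>*"
      then show False using e \<rho> by (auto simp: dom_def)
    qed
  qed
  ultimately show ?thesis using e d by (auto simp: dom_def)
qed

text \<open>A walk from \<open>x\<close> back to its representative meets \<open>d\<close> or
  \<open>e\<close>, say \<open>d\<close> first. If \<open>e\<close> does not dominate
  \<open>d\<close>, some walk reaches \<open>d\<close> without \<open>e\<close>, and it continues to
  \<open>x\<close> without \<open>e\<close>.\<close>

lemma dom_linear: "dom d x \<Longrightarrow> dom e x \<Longrightarrow> d \<noteq> e \<Longrightarrow> dom d e \<or> dom e d"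
proof (rule ccontr)
  assume d: "dom d x" and e: "dom e x" and ne: "d \<noteq> e" and n: "\<not> (dom d e \<or> dom e d)"
  have V: "d \<in> V - R" "e \<in> V - R" "x \<in> V" using d e by (auto simp: dom_def)
  obtain \<rho> where \<rho>: "\<rho> \<in> R" "(\<rho>, e) \<in> (avoid E d)\<^sup>*" using not_dom[of d e] V ne n by auto
  obtain \<sigma> where \<sigma>: "\<sigma> \<in> R" "(\<sigma>, d) \<in> (avoid E e)\<^sup>*" using not_dom[of e d] V ne n by auto
  obtain \<nu> where \<nu>: "\<nu> \<in> R" "(\<nu>, x) \<in> E\<^sup>*" using reps V by blast
  then have "(x, \<nu>) \<in> E\<^sup>*" unfolding rtrancl_sym_iff[OF symE, of x] by blast
  note sy = rtrancl_sym_iff[OF sym_avoid[OF symE]]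
  have "x \<noteq> d" "x \<noteq> e" using d e by (auto simp: dom_def)
  from first_hit[OF \<open>(x, \<nu>) \<in> E\<^sup>*\<close> this ne] show False
  proof (elim disjE conjE)
    assume "(x, \<nu>) \<in> (avoid (avoid E d) e)\<^sup>*"
    then have "(x, \<nu>) \<in> (avoid E d)\<^sup>*" by (rule avoid_rtrancl)
    then have "(\<nu>, x) \<in> (avoid E d)\<^sup>*" unfolding sy[of x] .
    then show False using d \<nu> by (auto simp: dom_def)
  next
    assume "(x, d) \<in> (avoid E e)\<^sup>*"
    then have "(d, x) \<in> (avoid E e)\<^sup>*" unfolding sy[of x] .
    with \<sigma>(2) have "(\<sigma>, x) \<in> (avoid E e)\<^sup>*" by (rule rtrancl_trans)
    then show False using e \<sigma> by (auto simp: dom_def)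
  next
    assume "(x, e) \<in> (avoid E d)\<^sup>*"
    then have "(e, x) \<in> (avoid E d)\<^sup>*" unfolding sy[of x] .
    with \<rho>(2) have "(\<rho>, x) \<in> (avoid E d)\<^sup>*" by (rule rtrancl_trans)
    then show False using d \<rho> by (auto simp: dom_def)
  qed
qed

lemma dom_cut_iff:
  assumes "d \<in> V - R"
  shows "(\<exists>x. dom d x) \<longleftrightarrow> (\<exists>x\<in>V - {d}. \<exists>y\<in>V - {d}. (x, y) \<in> E\<^sup>* \<and> (x, y) \<notin> (avoid E d)\<^sup>*)"
proof
  assume "\<exists>x. dom d x"
  then obtain x where x: "dom d x" ..
  then obtain \<rho> where \<rho>: "\<rho> \<in> R" "(\<rho>, x) \<in> E\<^sup>*" using reps dom_V by blast
  then have "\<rho> \<in> V - {d}" "x \<in> V - {d}" "(\<rho>, x) \<notin> (avoid E d)\<^sup>*" using x RV by (auto simp: dom_def)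
  then show "\<exists>x\<in>V - {d}. \<exists>y\<in>V - {d}. (x, y) \<in> E\<^sup>* \<and> (x, y) \<notin> (avoid E d)\<^sup>*" using \<rho>(2) by blast
next
  assume "\<exists>x\<in>V - {d}. \<exists>y\<in>V - {d}. (x, y) \<in> E\<^sup>* \<and> (x, y) \<notin> (avoid E d)\<^sup>*"
  then obtain x y where xy: "x \<in> V - {d}" "y \<in> V - {d}" "(x, y) \<in> E\<^sup>*" "(x, y) \<notin> (avoid E d)\<^sup>*" by blast
  show "\<exists>x. dom d x"
  proof (rule ccontr)
    assume n: "\<not> ?thesis"
    obtain \<rho> where \<rho>: "\<rho> \<in> R" "(\<rho>, x) \<in> (avoid E d)\<^sup>*" using not_dom[OF assms, of x] xy n by auto
    obtain \<sigma> where \<sigma>: "\<sigma> \<in> R" "(\<sigma>, y) \<in> (avoid E d)\<^sup>*" using not_dom[OF assms, of y] xy n by auto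
    have "(\<rho>, y) \<in> E\<^sup>*" using avoid_rtrancl[OF \<rho>(2)] xy(3) by (rule rtrancl_trans)
    moreover have "(y, \<sigma>) \<in> E\<^sup>*" using avoid_rtrancl[OF \<sigma>(2)] unfolding rtrancl_sym_iff[OF symE, of \<sigma>] .
    ultimately have "(\<rho>, \<sigma>) \<in> E\<^sup>*" by (rule rtrancl_trans)
    then have "\<rho> = \<sigma>" using unique \<rho> \<sigma> by blast
    moreover have "(x, \<rho>) \<in> (avoid E d)\<^sup>*" using \<rho>(2) unfolding rtrancl_sym_iff[OF sym_avoid[OF symE], of \<rho>] .
    ultimately have "(x, y) \<in> (avoid E d)\<^sup>*" using \<sigma>(2) rtrancl_trans[of x \<rho> _ y] by simp
    then show False using xy(4) by blast
  qed
qed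

lemma Dom_insert: "dom d x \<Longrightarrow> insert d (Dom d) \<subseteq> Dom x"
  using dom_trans by (auto simp: Dom_def)

lemma Dom_card_less: "dom d x \<Longrightarrow> card (Dom d) < card (Dom x)"
proof -
  assume d: "dom d x"
  have "d \<notin> Dom d" using dom_V(3) by (auto simp: Dom_def)
  then show ?thesis using Dom_insert[OF d] psubset_card_mono[OF finite_Dom, of "Dom d" x] by blast
qed

text \<open>The dominators of \<open>x\<close> are linearly ordered, so one with the most dominators
  is dominated by all others: the one closest to \<open>x\<close>.\<close>

lemma ex_idom:
  assumes "Dom x \<noteq> {}"
  shows "\<exists>d. d \<in> Dom x \<and> Dom x = insert d (Dom d)"
proof -
  obtain d where d: "d \<in> Dom x" "\<And>e. e \<in> Dom x \<Longrightarrow> card (Dom e) \<le> card (Dom d)"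
  proof -
    have "Max ((\<lambda>d. card (Dom d)) ` Dom x) \<in> (\<lambda>d. card (Dom d)) ` Dom x"
      using assms finite_Dom by (intro Max_in) auto
    then obtain d where "d \<in> Dom x" "card (Dom d) = Max ((\<lambda>d. card (Dom d)) ` Dom x)" by auto
    then show ?thesis using that[of d] finite_Dom Max_ge[of "(\<lambda>d. card (Dom d)) ` Dom x"] by auto
  qed
  have dx: "dom d x" using d(1) by (simp add: Dom_def)
  have "e \<in> insert d (Dom d)" if e: "e \<in> Dom x" for e
  proof (rule ccontr)
    assume n: "e \<notin> insert d (Dom d)"
    then have "dom d e" using dom_linear[OF dx, of e] e by (auto simp: Dom_def)
    then show False using Dom_card_less[of d e] d(2)[OF e] by simp
  qed
  then have "Dom x = insert d (Dom d)" using Dom_insert[OF dx] by blast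
  then show ?thesis using d(1) by blast
qed

definition idom :: "'a \<Rightarrow> 'a option" where
  "idom x = (if Dom x = {} then None else Some (SOME d. d \<in> Dom x \<and> Dom x = insert d (Dom d)))"

lemma idom_Some: "idom x = Some d \<Longrightarrow> dom d x \<and> Dom x = insert d (Dom d)"
  using someI_ex[OF ex_idom, of x] unfolding idom_def
  by (auto simp: Dom_def[of x] split: if_splits)

lemma idom_eqI: "dom d x \<Longrightarrow> Dom x = insert d (Dom d) \<Longrightarrow> idom x = Some d"
proof -
  assume d: "dom d x" "Dom x = insert d (Dom d)"
  then obtain e where e: "idom x = Some e" by (auto simp: idom_def)
  then have e': "dom e x" "Dom x = insert e (Dom e)" using idom_Some by auto
  have "d = e"
  proof (rule ccontr)
    assume "d \<noteq> e"
    then have "dom e d" "dom d e" using d e' by (auto simp: Dom_def set_eq_iff)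
    then show False by (rule dom_asym)
  qed
  then show ?thesis using e by simp
qed

text \<open>A dominator of \<open>x\<close> other than \<open>y\<close> also dominates the neighbour
  \<open>y\<close>, since a walk avoiding it could be extended from \<open>y\<close> to
  \<open>x\<close>. So the two sets of dominators differ at most in \<open>x\<close> and
  \<open>y\<close>, which leaves siblings or parent and child. This embeds the graph into
  \<open>sgraph\<close>.\<close>

lemma idom_adjacent:
  assumes xy: "(x, y) \<in> E" "x \<noteq> y"
  shows "idom x = idom y \<or> idom x = Some y \<or> idom y = Some x"
proof -
  have step: "dom d y" if e: "(x, y) \<in> E" and d: "dom d x" and ne: "d \<noteq> y" for x y d
  proof (rule ccontr)
    assume "\<not> dom d y"
    then obtain \<rho> where \<rho>: "\<rho> \<in> R" "(\<rho>, y) \<in> (avoid E d)\<^sup>*"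
      using not_dom[of d y] e ne EV d dom_V(1)[OF d] dom_not_R(1)[OF d] by blast
    have "(y, x) \<in> avoid E d" using e ne dom_V(3)[OF d] symD[OF symE e] by (simp add: avoid_def)
    then have "(\<rho>, x) \<in> (avoid E d)\<^sup>*" using \<rho>(2) by (meson rtrancl.rtrancl_into_rtrancl)
    then show False using d \<rho>(1) by (auto simp: dom_def)
  qed
  have yx: "(y, x) \<in> E" using xy symE by (auto dest: symD)
  have 1: "Dom x - {y} \<subseteq> Dom y" using step[OF xy(1)] by (auto simp: Dom_def)
  have 2: "Dom y - {x} \<subseteq> Dom x" using step[OF yx] by (auto simp: Dom_def)
  consider "dom y x" | "dom x y" | "\<not> dom y x" "\<not> dom x y" by blast
  then show ?thesis
  proof cases
    case 1
    then have "Dom x = insert y (Dom y)"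
      using \<open>Dom x - {y} \<subseteq> Dom y\<close> Dom_insert[OF 1] by blast
    then show ?thesis using idom_eqI[OF 1] by simp
  next
    case 2
    then have "Dom y = insert x (Dom x)"
      using \<open>Dom y - {x} \<subseteq> Dom x\<close> Dom_insert[OF 2] by blast
    then show ?thesis using idom_eqI[OF 2] by simp
  next
    case 3
    then have "Dom x = Dom y" using 1 2 by (auto simp: Dom_def)
    then show ?thesis by (simp add: idom_def)
  qed
qed

lemma forest_idom: "forest V idom"
proof -
  have sub: "prel V idom \<subseteq> {(d, x). dom d x}" using idom_Some by (auto simp: prel_def)
  have "(d, x) \<in> (prel V idom)\<^sup>+ \<Longrightarrow> dom d x" for d x
  proof (induction rule: trancl_induct)
    case (base y)
    then show ?case using sub by auto
  next
    case (step y z)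
    then show ?case using sub dom_trans by blast
  qed
  then have "acyclic (prel V idom)" using dom_V(3) by (auto simp: acyclic_def)
  moreover have "u \<in> V" if "idom v = Some u" for u v using idom_Some[OF that] dom_V(1) by blast
  ultimately show ?thesis using finV by (simp add: forest_def)
qed

text \<open>Climbing along immediate dominators from a vertex dominated by \<open>d\<close> passes
  through a child of \<open>d\<close>; the number of dominators drops at every step.\<close>

lemma internal_idom: "internal V idom = {d. \<exists>x. dom d x}"
proof (intro equalityI subsetI)
  fix d assume "d \<in> internal V idom"
  then show "d \<in> {d. \<exists>x. dom d x}" using idom_Some by (auto simp: internal_def kids_def)
next
  fix d assume "d \<in> {d. \<exists>x. dom d x}"
  then obtain x where "dom d x" by blast
  then have "\<exists>x. dom d x \<and> idom x = Some d"
  proof (induction "card (Dom x)" arbitrary: x rule: less_induct)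
    case less
    then have "Dom x \<noteq> {}" by (auto simp: Dom_def)
    then obtain e where "idom x = Some e" by (auto simp: idom_def)
    then have e: "dom e x" "Dom x = insert e (Dom e)" "idom x = Some e" using idom_Some by auto
    show ?case
    proof (cases "d = e")
      case True
      then show ?thesis using e by blast
    next
      case False
      then have "dom d e" using e(2) less.prems by (auto simp: Dom_def set_eq_iff)
      then show ?thesis using less.hyps[OF Dom_card_less[OF e(1)]] by blast
    qed
  qed
  then show "d \<in> internal V idom" using dom_V(2) by (auto simp: internal_def kids_def)
qed

lemma R_roots: "R \<subseteq> roots V idom"
proof
  fix x assume x: "x \<in> R"
  then have "Dom x = {}" using dom_not_R(2) by (auto simp: Dom_def)
  then show "x \<in> roots V idom" using x RV by (auto simp: roots_def idom_def)
qed

text \<open>A sole root would be a representative, and every other vertex would lie below it; but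
  representatives dominate nothing.\<close>

lemma two_roots:
  assumes "2 \<le> card V"
  shows "2 \<le> card (roots V idom)"
proof (rule ccontr)
  assume "\<not> ?thesis"
  then have le: "card (roots V idom) \<le> 1" by simp
  have ne: "V \<noteq> {}" using assms by auto
  then obtain \<rho> where \<rho>: "\<rho> \<in> R" using reps by blast
  have fin: "finite (roots V idom)" by (rule finite_roots[OF forest_idom])
  have rt: "x = \<rho>" if "x \<in> roots V idom" for x
    using le fin that \<rho> R_roots card_le_Suc0_iff_eq[OF fin] by auto
  have "\<not> V \<subseteq> {\<rho>}" using assms card_mono[of "{\<rho>}" V] by auto
  then obtain x where x: "x \<in> V" "x \<noteq> \<rho>" by blast
  obtain y where "y \<in> roots V idom" "(y, x) \<in> (prel V idom)\<^sup>*" using root_above[OF forest_idom x(1)] by blast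
  then have "(\<rho>, x) \<in> (prel V idom)\<^sup>*" using rt by simp
  then obtain z where "(\<rho>, z) \<in> prel V idom" using x(2) by (auto elim: converse_rtranclE)
  then have "dom \<rho> z" using idom_Some by (simp add: prel_def)
  then show False using dom_not_R(1) \<rho> by blast
qed

text \<open>A vertex of the component with the most dominators dominates nothing and so is no cut
  vertex. If the component has only its representative, that vertex serves.\<close>

lemma ex_noncut:
  assumes "w \<in> V"
  shows "\<exists>u\<in>V. (w, u) \<in> E\<^sup>* \<and>
    \<not> (\<exists>x\<in>V - {u}. \<exists>y\<in>V - {u}. (x, y) \<in> E\<^sup>* \<and> (x, y) \<notin> (avoid E u)\<^sup>*)"
proof -
  define C where "C = {u \<in> V - R. (w, u) \<in> E\<^sup>*}"
  note sy = rtrancl_sym_iff[OF symE]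
  show ?thesis
  proof (cases "C = {}")
    case True
    obtain \<rho> where \<rho>: "\<rho> \<in> R" "(\<rho>, w) \<in> E\<^sup>*" using reps assms by blast
    have w\<rho>: "(w, \<rho>) \<in> E\<^sup>*" using \<rho>(2) unfolding sy[of w] .
    have "(x, y) \<in> (avoid E \<rho>)\<^sup>*" if "x \<in> V - {\<rho>}" "y \<in> V - {\<rho>}" "(x, y) \<in> E\<^sup>*" for x y
    proof (rule ccontr)
      assume "(x, y) \<notin> (avoid E \<rho>)\<^sup>*"
      then have "(x, \<rho>) \<in> E\<^sup>*" using avoid_or_hit[OF that(3), of \<rho>] that(1) by auto
      then have \<rho>x: "(\<rho>, x) \<in> E\<^sup>*" unfolding sy[of x] .
      have "(w, x) \<in> E\<^sup>*" by (rule rtrancl_trans[OF w\<rho> \<rho>x])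
      then have "x \<in> R" using True that(1) by (auto simp: C_def)
      then show False using unique[OF \<rho>(1) _ \<open>(\<rho>, x) \<in> E\<^sup>*\<close>] that(1) by blast
    qed
    then show ?thesis using w\<rho> \<rho>(1) RV by blast
  next
    case False
    have finC: "finite C" using finV by (simp add: C_def)
    have "Max ((\<lambda>d. card (Dom d)) ` C) \<in> (\<lambda>d. card (Dom d)) ` C"
      using False finC by (intro Max_in) auto
    then obtain u where u: "u \<in> C" "card (Dom u) = Max ((\<lambda>d. card (Dom d)) ` C)" by auto
    have "\<not> dom u x" for x
    proof
      assume ux: "dom u x"
      obtain \<rho> where \<rho>: "\<rho> \<in> R" "(\<rho>, x) \<in> E\<^sup>*" using reps dom_V(2)[OF ux] by blast
      have "\<rho> \<noteq> u" using \<rho> dom_not_R(1)[OF ux] by auto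
      then have "(\<rho>, u) \<in> E\<^sup>*" using avoid_or_hit[OF \<rho>(2), of u] ux \<rho>(1) by (auto simp: dom_def)
      then have "(u, \<rho>) \<in> E\<^sup>*" unfolding sy[of u] .
      then have "(u, x) \<in> E\<^sup>*" using \<rho>(2) by (rule rtrancl_trans)
      then have "x \<in> C" using u(1) dom_V(2)[OF ux] dom_not_R(2)[OF ux] rtrancl_trans[of w u E x] by (simp add: C_def)
      then have "card (Dom x) \<le> card (Dom u)" unfolding u(2) using finC by (intro Max_ge) auto
      then show False using Dom_card_less[OF ux] by simp
    qed
    moreover have "u \<in> V - R" "(w, u) \<in> E\<^sup>*" using u(1) by (auto simp: C_def)
    ultimately show ?thesis using dom_cut_iff[of u] by blast
  qed
qed

end

text \<open>The choice \<open>f w\<close> depends on the set of vertices reachable from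
  \<open>w\<close> alone, so it is constant on components.\<close>

lemma component_reps_exists:
  assumes "finite V" "E \<subseteq> V \<times> V" "sym E" and P: "\<And>w. w \<in> V \<Longrightarrow> \<exists>u\<in>V. (w, u) \<in> E\<^sup>* \<and> P u"
  shows "\<exists>R. component_reps V E R \<and> (\<forall>\<rho>\<in>R. P \<rho>)"
proof -
  note sy = rtrancl_sym_iff[OF assms(3)]
  define f where "f = (\<lambda>w. SOME u. u \<in> V \<and> (w, u) \<in> E\<^sup>* \<and> P u)"
  have f: "f w \<in> V \<and> (w, f w) \<in> E\<^sup>* \<and> P (f w)" if "w \<in> V" for w
  proof -
    have "\<exists>u. u \<in> V \<and> (w, u) \<in> E\<^sup>* \<and> P u" using P[OF that] by blast
    then show ?thesis unfolding f_def by (rule someI_ex)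
  qed
  have same: "f x = f y" if "(x, y) \<in> E\<^sup>*" for x y
  proof -
    have "(x, u) \<in> E\<^sup>* \<longleftrightarrow> (y, u) \<in> E\<^sup>*" for u 
      using that rtrancl_trans[of x y E u] rtrancl_trans[of y x E u] unfolding sy[of y x] by blast
    then show ?thesis by (simp add: f_def)
  qed
  have "component_reps V E (f ` V)"
  proof
    show "finite V" "E \<subseteq> V \<times> V" "sym E" by fact+
    show "f ` V \<subseteq> V" using f by blast
    show "\<exists>\<rho>\<in>f ` V. (\<rho>, x) \<in> E\<^sup>*" if "x \<in> V" for x
      using f[OF that] that unfolding sy[of x] by blast
    show "\<rho> = \<sigma>" if r: "\<rho> \<in> f ` V" "\<sigma> \<in> f ` V" "(\<rho>, \<sigma>) \<in> E\<^sup>*" for \<rho> \<sigma>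
    proof -
      from r obtain x y where xy: "x \<in> V" "y \<in> V" "\<rho> = f x" "\<sigma> = f y" by blast
      have "f (f x) = f x" "f (f y) = f y" using same f xy(1,2) by metis+
      then show ?thesis using same[OF r(3)] xy by simp
    qed
  qed
  then show ?thesis using f by blast
qed

text \<open>
  The dominator forest with respect to a representative that is no cut vertex in each component.
\<close>

lemma dominator_forest:
  assumes "pair_graph G" "2 \<le> card (pverts G)"
  shows "\<exists>par\<in>forests (pverts G) (card {v. cut_vertex G v}). parcs G \<subseteq> parcs (sgraph (pverts G) par)"
proof -
  interpret pair_graph G by fact
  let ?V = "pverts G" and ?E = "parcs G"
  have b: "finite ?V" "?E \<subseteq> ?V \<times> ?V" "sym ?E"
    using sym_arcs by (auto simp: symmetric_def dest: in_arcsD1 in_arcsD2)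
  \<comment> \<open>Arbitrary representatives serve to find a vertex that is no cut vertex in each
    component; the forest is then built from such vertices. Representatives never dominate, so a cut
    vertex among them would be missing from the internal vertices.\<close>
  obtain R0 where "component_reps ?V ?E R0"
    using component_reps_exists[OF b, of "\<lambda>_. True"] by blast
  then interpret R0: component_reps ?V ?E R0 .
  obtain R where R: "component_reps ?V ?E R"
    "\<forall>u\<in>R. \<not> (\<exists>x\<in>?V - {u}. \<exists>y\<in>?V - {u}. (x, y) \<in> ?E\<^sup>* \<and> (x, y) \<notin> (avoid ?E u)\<^sup>*)"
    using component_reps_exists[OF b R0.ex_noncut] by blast
  interpret R: component_reps ?V ?E R by (rule R(1))
  have "internal ?V R.idom = {v. cut_vertex G v}"
  proof (intro equalityI subsetI)
    fix v assume "v \<in> internal ?V R.idom"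
    then have "\<exists>x. R.dom v x" by (simp add: R.internal_idom)
    then show "v \<in> {v. cut_vertex G v}"
      using R.dom_cut_iff[of v] R.dom_not_R(1) R.dom_V(1) unfolding mem_Collect_eq cut_vertex_iff[OF assms(1)] by blast
  next
    fix v assume "v \<in> {v. cut_vertex G v}"
    then have v: "v \<in> ?V" "\<exists>x\<in>?V - {v}. \<exists>y\<in>?V - {v}. (x, y) \<in> ?E\<^sup>* \<and> (x, y) \<notin> (avoid ?E v)\<^sup>*"
      unfolding mem_Collect_eq cut_vertex_iff[OF assms(1)] by blast+
    then have "v \<notin> R" using R(2) by blast
    then show "v \<in> internal ?V R.idom" using R.dom_cut_iff[of v] v by (simp add: R.internal_idom)
  qed
  then have "R.idom \<in> forests ?V (card {v. cut_vertex G v})"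
    using R.forest_idom R.two_roots[OF assms(2)] by (simp add: forests_def)
  moreover have "?E \<subseteq> parcs (sgraph ?V R.idom)"
  proof (rule subrelI)
    fix x y assume xy: "(x, y) \<in> ?E"
    then have "x \<noteq> y" using no_loops by fastforce
    then show "(x, y) \<in> parcs (sgraph ?V R.idom)" using R.idom_adjacent[OF xy] xy b(2) by auto
  qed
  ultimately show ?thesis by blast
qed

section \<open>Cut vertices of complete graphs with pendent paths\<close>

lemma avoid_arcs: "(a, b) \<in> avoid E d \<longleftrightarrow> (a, b) \<in> E \<and> a \<noteq> d \<and> b \<noteq> d"
  by (simp add: avoid_def)

lemma cut_vertices_clique_with_paths:
  assumes "2 \<le> m"
  shows "{v. cut_vertex (clique_with_paths m p) v} = (SIGMA i:{..<m}. {..<p i})"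
proof -
  let ?G = "clique_with_paths m p"
  let ?E = "parcs ?G" and ?V = "pverts ?G"
  interpret pair_graph ?G by (rule pair_graph_clique_with_paths)
  have symE: "sym ?E" using sym_arcs by (simp add: symmetric_def)
  have down: "((i, j), (i, 0)) \<in> (avoid ?E v)\<^sup>*" if "i < m" "j \<le> p i" "\<And>k. k \<le> j \<Longrightarrow> v \<noteq> (i, k)" for i j v
    using that(2,3)
  proof (induction j)
    case (Suc j)
    have "(i, Suc j) \<noteq> v" "(i, j) \<noteq> v" using Suc.prems(2)[of j] Suc.prems(2)[of "Suc j"] by auto
    then have "((i, Suc j), (i, j)) \<in> avoid ?E v"
      using Suc.prems(1) that(1) by (simp add: avoid_arcs clique_with_paths_arcs)
    moreover have "((i, j), (i, 0)) \<in> (avoid ?E v)\<^sup>*" using Suc by simp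
    ultimately show ?case by (rule converse_rtrancl_into_rtrancl)
  qed simp
  have across: "((i, 0), (i', 0)) \<in> (avoid ?E v)\<^sup>*" if "i < m" "i' < m" "v \<noteq> (i, 0)" "v \<noteq> (i', 0)" for i i' v
  proof (cases "i = i'")
    case False
    then have "((i, 0), (i', 0)) \<in> avoid ?E v" using that by (simp add: avoid_arcs clique_with_paths_arcs)
    then show ?thesis by blast
  qed simp
  have conn: "(x, y) \<in> (avoid ?E v)\<^sup>*"
    if x: "x \<in> ?V" "\<And>k. k \<le> snd x \<Longrightarrow> v \<noteq> (fst x, k)" and y: "y \<in> ?V" "\<And>k. k \<le> snd y \<Longrightarrow> v \<noteq> (fst y, k)" for x y v
  proof -
    have x': "fst x < m" "snd x \<le> p (fst x)" and y': "fst y < m" "snd y \<le> p (fst y)"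
      using x(1) y(1) by (cases x, cases y, auto simp: clique_with_paths_verts)+
    have 1: "(x, (fst x, 0)) \<in> (avoid ?E v)\<^sup>*" using down[OF x' x(2)] by simp
    have 2: "((fst x, 0), (fst y, 0)) \<in> (avoid ?E v)\<^sup>*" using across x' y' x(2)[of 0] y(2)[of 0] by simp
    have "(y, (fst y, 0)) \<in> (avoid ?E v)\<^sup>*" using down[OF y' y(2)] by simp
    then have 3: "((fst y, 0), y) \<in> (avoid ?E v)\<^sup>*" unfolding rtrancl_sym_iff[OF sym_avoid[OF symE], of y] .
    show ?thesis by (rule rtrancl_trans[OF rtrancl_trans[OF 1 2] 3])
  qed
  \<comment> \<open>The pair \<open>(m, 0)\<close> is no vertex, so avoiding it is no restriction
    and \<open>conn\<close> yields plain connectedness.\<close>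
  have all: "(x, y) \<in> ?E\<^sup>*" if "x \<in> ?V" "y \<in> ?V" for x y
  proof (rule avoid_rtrancl[of x y ?E "(m, 0)"], rule conn)
    have "fst z \<noteq> m" if "z \<in> ?V" for z using that by (cases z) (simp add: clique_with_paths_verts)
    from this[of x] this[of y] that have "fst x \<noteq> m" "fst y \<noteq> m" by blast+
    then show "(m, 0) \<noteq> (fst x, k)" "(m, 0) \<noteq> (fst y, k)" for k by auto
  qed (use that in auto)
  show ?thesis
  proof (intro equalityI subsetI)
    fix v assume "v \<in> {v. cut_vertex ?G v}"
    then have v: "v \<in> ?V" "\<exists>x\<in>?V - {v}. \<exists>y\<in>?V - {v}. (x, y) \<in> ?E\<^sup>* \<and> (x, y) \<notin> (avoid ?E v)\<^sup>*"
      unfolding mem_Collect_eq cut_vertex_iff[OF pair_graph_clique_with_paths] by blast+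
    obtain i j where ij: "v = (i, j)" "i < m" "j \<le> p i" using v(1) by (cases v) (auto simp: clique_with_paths_verts)
    have "j \<noteq> p i"
    proof
      assume j: "j = p i"
      have "v \<noteq> (fst x, k)" if "x \<in> ?V - {v}" "k \<le> snd x" for x k
        using that ij j by (cases x) (auto simp: clique_with_paths_verts)
      then show False using v(2) conn by blast
    qed
    then show "v \<in> (SIGMA i:{..<m}. {..<p i})" using ij by simp
  next
    fix v assume "v \<in> (SIGMA i:{..<m}. {..<p i})"
    then obtain i j where ij: "v = (i, j)" "i < m" "j < p i" by auto
    define i' where "i' = (if i = 0 then 1 else 0 :: nat)"
    have i': "i' < m" "i' \<noteq> i" using assms by (auto simp: i'_def)
    \<comment> \<open>Without \<open>(i, j)\<close> the part of path \<open>i\<close> beyond it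
      cannot be left, whereas \<open>(i', 0)\<close> lies outside; \<open>m \<ge> 2\<close> provides
      \<open>i'\<close>.\<close>
    have inv: "fst y = i \<and> j < snd y" if "((i, Suc j), y) \<in> (avoid ?E v)\<^sup>*" for y
      using that
    proof (induction rule: rtrancl_induct)
      case (step y z)
      then show ?case unfolding ij by (cases y; cases z) (auto simp: avoid_arcs clique_with_paths_arcs)
    qed simp
    have "(i, Suc j) \<in> ?V - {v}" "(i', 0) \<in> ?V - {v}" using ij i' by (auto simp: clique_with_paths_verts)
    moreover have "((i, Suc j), (i', 0)) \<notin> (avoid ?E v)\<^sup>*" using inv i' by force
    moreover have "v \<in> ?V" using ij by (simp add: clique_with_paths_verts)
    ultimately show "v \<in> {v. cut_vertex ?G v}"
      unfolding mem_Collect_eq cut_vertex_iff[OF pair_graph_clique_with_paths] using all by blast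
  qed
qed

theorem theorem4p2:
  fixes n r :: nat and p :: "nat \<Rightarrow> nat"
  assumes "r + 2 \<le> n"
    and "balanced_lengths n r p"
  shows "clique_with_paths (n - r) p \<in> graphs_with_cut_vertices n r \<and>
    (\<forall>G :: 'a pair_pre_digraph. G \<in> graphs_with_cut_vertices n r \<longrightarrow>
       slee G \<le> slee (clique_with_paths (n - r) p) \<and>
       (slee G = slee (clique_with_paths (n - r) p) \<longleftrightarrow>
         digraph_iso (with_proj G) (with_proj (clique_with_paths (n - r) p))))"
proof (intro conjI allI impI)
  define m where "m = n - r"
  have m: "2 \<le> m" using assms(1) by (simp add: m_def)
  have s: "(\<Sum>i<m. p i) = r" and b: "balanced m p"
  proof -
    have "p i \<le> Suc (p j)" if "i < m" "j < m" for i j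
    proof -
      have "\<bar>int (p i) - int (p j)\<bar> \<le> 1" using assms(2) that by (simp add: balanced_lengths_def m_def)
      then show ?thesis by linarith
    qed
    then show "balanced m p" by (simp add: balanced_def)
    show "(\<Sum>i<m. p i) = r" using assms(2) by (simp add: balanced_lengths_def m_def)
  qed
  have "card {v. cut_vertex (clique_with_paths m p) v} = r"
    unfolding cut_vertices_clique_with_paths[OF m] using s by simp
  moreover have "card (pverts (clique_with_paths m p)) = n"
    using card_clique_with_paths[OF assms(2)] assms(1) by (simp add: m_def)
  ultimately show "clique_with_paths (n - r) p \<in> graphs_with_cut_vertices n r"
    by (simp add: graphs_with_cut_vertices_def pair_graph_clique_with_paths m_def)
  fix G :: "'a pair_pre_digraph"
  assume "G \<in> graphs_with_cut_vertices n r"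
  then have G: "pair_graph G" "card (pverts G) = n" "card {v. cut_vertex G v} = r"
    by (auto simp: graphs_with_cut_vertices_def)
  let ?V = "pverts G" and ?K = "clique_with_paths (n - r) p"
  interpret G: pair_graph G by (rule G(1))
  have fV: "finite ?V" by simp
  have reduce: "\<exists>q. digraph_iso (with_proj (sgraph ?V par)) (with_proj (clique_with_paths m q)) \<and>
      slee (sgraph ?V par) = slee (clique_with_paths m q) \<and> (\<Sum>i<m. q i) = r"
    if par: "par \<in> forests ?V r" "\<forall>u. card (kids ?V par u) \<le> 1" for par
  proof -
    obtain q where q: "(\<Sum>i<m. q i) = r" "digraph_iso (with_proj (clique_with_paths m q)) (with_proj (sgraph ?V par))"
      using forest_clique_with_paths[OF par] unfolding G(2) m_def[symmetric] by blast
    interpret C: pair_graph "clique_with_paths m q" by (rule pair_graph_clique_with_paths)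
    show ?thesis
      using q digraph_iso_swap[OF C.wf_digraph_axioms q(2)]
        slee_digraph_iso[OF pair_graph_clique_with_paths pair_graph_sgraph[OF fV] q(2)] by auto
  qed
  obtain par0 where par0: "par0 \<in> forests ?V r" "parcs G \<subseteq> parcs (sgraph ?V par0)"
    using dominator_forest[OF G(1)] G(2,3) assms(1) by auto
  \<comment> \<open>Both graphs have the same vertices, so any arc that \<open>G\<close> lacks makes
    the index of \<open>sgraph ?V par0\<close> strictly larger.\<close>
  have le0: "slee G \<le> slee (sgraph ?V par0)" and eq0: "slee G = slee (sgraph ?V par0) \<Longrightarrow> G = sgraph ?V par0"
  proof -
    have "slee G < slee (sgraph ?V par0)" if "G \<noteq> sgraph ?V par0"
    proof (rule slee_subgraph_less[OF G(1) pair_graph_sgraph[OF fV]])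
      show "parcs G \<subset> parcs (sgraph ?V par0)" using par0(2) that by (cases G) (auto simp: sgraph_def)
    qed simp
    then show "slee G \<le> slee (sgraph ?V par0)" "slee G = slee (sgraph ?V par0) \<Longrightarrow> G = sgraph ?V par0"
      by fastforce+
  qed
  obtain par where par: "par \<in> forests ?V r" "\<forall>u. card (kids ?V par u) \<le> 1"
    and le1: "slee (sgraph ?V par0) \<le> slee (sgraph ?V par)"
    and eq1: "slee (sgraph ?V par0) = slee (sgraph ?V par) \<Longrightarrow>
      \<exists>p'\<in>forests ?V r. sgraph ?V p' = sgraph ?V par0 \<and> (\<forall>u. card (kids ?V p' u) \<le> 1)"
    using maximal_forest[OF fV, of r] par0(1) by blast
  obtain q where q: "slee (sgraph ?V par) = slee (clique_with_paths m q)" "(\<Sum>i<m. q i) = r"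
    using reduce[OF par] by blast
  have le2: "slee (sgraph ?V par) \<le> slee ?K"
    using slee_le_balanced[OF m b, of q] q s by (simp add: m_def)
  show "slee G \<le> slee ?K" using le0 le1 le2 by linarith
  show "slee G = slee ?K \<longleftrightarrow> digraph_iso (with_proj G) (with_proj ?K)"
  proof
    \<comment> \<open>\<open>le0\<close>, \<open>le1\<close> and \<open>le2\<close> form a chain
      with equal ends, so all are equalities: \<open>G\<close> is the graph of an unbranched forest,
      and its path lengths give a graph isomorphic to the balanced one.\<close>
    assume "slee G = slee ?K"
    then have e: "slee G = slee (sgraph ?V par0)" "slee (sgraph ?V par0) = slee (sgraph ?V par)"
      using le0 le1 le2 by linarith+
    obtain p' where p': "p' \<in> forests ?V r" "sgraph ?V p' = sgraph ?V par0" "\<forall>u. card (kids ?V p' u) \<le> 1"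
      using eq1[OF e(2)] by blast
    have GG: "sgraph ?V p' = G" using eq0[OF e(1)] p'(2) by simp
    obtain q' where q': "digraph_iso (with_proj G) (with_proj (clique_with_paths m q'))"
      "slee G = slee (clique_with_paths m q')" "(\<Sum>i<m. q' i) = r"
      using reduce[OF p'(1,3)] unfolding GG by blast
    have "digraph_iso (with_proj (clique_with_paths m q')) (with_proj ?K)"
      using slee_le_balanced[OF m b, of q'] q' s \<open>slee G = slee ?K\<close> by (simp add: m_def)
    with q'(1) show "digraph_iso (with_proj G) (with_proj ?K)" by (rule digraph_iso_trans)
  next
    assume "digraph_iso (with_proj G) (with_proj ?K)"
    then show "slee G = slee ?K" by (rule slee_digraph_iso[OF G(1) pair_graph_clique_with_paths])
  qed
qed

end
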